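(* A seven-dimensional real Lie algebra with non-trivial center admitting torsion-free $\mathrm{G}_2$-structures is either abelian or isomorphic to \[ \mathfrak{s}_7=(e^{25},-e^{15},e^{45},-e^{35},0,0,0). \]
   Context: $d$ denotes the Chevalley-Eilenberg differential, with $d\alpha(x,y)=-\alpha([x,y])$ for 1-forms $\alpha$. The 7-tuple defining $\mathfrak{s}_7$ lists $(de^1,\ldots,de^7)$ with respect to a basis $(e^1,\ldots,e^7)$ of the dual space, and $e^{ij}=e^i\wedge e^j$. A 3-form $\varphi$ on a seven-dimensional vector space $W$ is definite if $\iota_w\varphi$ has rank six for each non-zero $w\in W$. A $\mathrm{G}_2$-structure on a seven-dimensional Lie algebra $\mathfrak{g}$ is a definite 3-form $\varphi\in\Lambda^3\mathfrak{g}^*$. With $b_\varphi(v,w)=\frac16\,\iota_v\varphi\wedge\iota_w\varphi\wedge\varphi\in\Lambda^7\mathfrak{g}^*$, it induces the inner product $g_\varphi=\det(b_\varphi)^{-1/9}b_\varphi$ and the volume form $\det(b_\varphi)^{1/9}$; $*_\varphi$ is the corresponding Hodge operator. The $\mathrm{G}_2$-structure is torsion-free if $d\varphi=0$ and $d*_\varphi\varphi=0$. *)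

theory Defs
  imports "HOL-Analysis.Analysis"
begin

section \<open>Exterior forms\<close>

text \<open>
  A form is a real-valued function on lists of vectors. A homogeneous form of degree \<open>k\<close> vanishes
  by convention on lists whose length is not \<open>k\<close>, so that equality of forms is equality of functions.
\<close>

type_synonym 'a form = "'a list \<Rightarrow> real"

definition forms :: "nat \<Rightarrow> 'a::real_vector form set" where
  "forms k = {\<alpha>. (\<forall>xs. length xs \<noteq> k \<longrightarrow> \<alpha> xs = 0)
                \<and> (\<forall>xs ys. linear (\<lambda>v. \<alpha> (xs @ v # ys)))
                \<and> (\<forall>xs. \<not> distinct xs \<longrightarrow> \<alpha> xs = 0)}"

definition shuffle_sign :: "nat \<Rightarrow> nat set \<Rightarrow> real" where
  "shuffle_sign n S = (-1) ^ card {(i, j). i \<in> S \<and> j < n \<and> j \<notin> S \<and> j < i}"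

text \<open>
  The wedge product as a sum over shuffles; for homogeneous forms of degrees \<open>p\<close>, \<open>q\<close> only the
  \<open>(p,q)\<close>-shuffles contribute. The normalisation is
  \<open>(\<alpha> \<and> \<beta>)(x,y) = \<alpha>(x) \<beta>(y) - \<alpha>(y) \<beta>(x)\<close> for 1-forms.
\<close>

definition wedge :: "'a form \<Rightarrow> 'a form \<Rightarrow> 'a form" where
  "wedge \<alpha> \<beta> = (\<lambda>xs. \<Sum>S \<in> Pow {..<length xs}.
      shuffle_sign (length xs) S * \<alpha> (nths xs S) * \<beta> (nths xs (- S)))"

definition contract :: "'a \<Rightarrow> 'a form \<Rightarrow> 'a form" where
  "contract v \<alpha> = (\<lambda>xs. \<alpha> (v # xs))"

text \<open>The rank of a 2-form: the codimension of its radical.\<close>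

definition form_rank :: "'a::real_vector form \<Rightarrow> nat" where
  "form_rank \<omega> = dim (UNIV :: 'a set) - dim {v. \<forall>w. \<omega> [v, w] = 0}"


section \<open>Lie algebras\<close>

definition lie_algebra :: "('a::real_vector \<Rightarrow> 'a \<Rightarrow> 'a) \<Rightarrow> bool" where
  "lie_algebra br \<longleftrightarrow> bilinear br \<and> (\<forall>x. br x x = 0)
     \<and> (\<forall>x y z. br x (br y z) + br y (br z x) + br z (br x y) = 0)"

definition lie_center :: "('a::real_vector \<Rightarrow> 'a \<Rightarrow> 'a) \<Rightarrow> 'a set" where
  "lie_center br = {z. \<forall>x. br z x = 0}"

definition lie_abelian :: "('a::real_vector \<Rightarrow> 'a \<Rightarrow> 'a) \<Rightarrow> bool" where
  "lie_abelian br \<longleftrightarrow> (\<forall>x y. br x y = 0)"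

definition lie_isomorphic ::
  "('a::real_vector \<Rightarrow> 'a \<Rightarrow> 'a) \<Rightarrow> ('b::real_vector \<Rightarrow> 'b \<Rightarrow> 'b) \<Rightarrow> bool" where
  "lie_isomorphic br br' \<longleftrightarrow>
     (\<exists>f. linear f \<and> bij f \<and> (\<forall>x y. f (br x y) = br' (f x) (f y)))"

text \<open>The Chevalley--Eilenberg differential; on 1-forms it is \<open>d\<alpha>(x,y) = - \<alpha>([x,y])\<close>.\<close>

definition ce_d :: "('a \<Rightarrow> 'a \<Rightarrow> 'a) \<Rightarrow> 'a form \<Rightarrow> 'a form" where
  "ce_d br \<alpha> = (\<lambda>xs. \<Sum>(i, j) \<in> {(i, j). i < j \<and> j < length xs}.
      (-1) ^ (i + j) * \<alpha> (br (xs ! i) (xs ! j) # nths xs (- {i, j})))"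


section \<open>\<open>G\<^sub>2\<close>-structures on seven-dimensional spaces\<close>

definition definite_form :: "'a::real_vector form \<Rightarrow> bool" where
  "definite_form \<phi> \<longleftrightarrow> \<phi> \<in> forms 3 \<and> (\<forall>w. w \<noteq> 0 \<longrightarrow> form_rank (contract w \<phi>) = 6)"

definition G2_b :: "'a form \<Rightarrow> 'a \<Rightarrow> 'a \<Rightarrow> 'a form" where
  "G2_b \<phi> v w = (\<lambda>xs. 1/6 * wedge (wedge (contract v \<phi>) (contract w \<phi>)) \<phi> xs)"

definition idx7 :: "7 \<Rightarrow> nat" where
  "idx7 = the_inv_into {..<7} of_nat"

text \<open>
  The 7-form \<open>det(b\<^sub>\<phi>)\<^bsup>1/9\<^esup>\<close>. The determinant of \<open>b\<^sub>\<phi>\<close>, which takes values in the line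
  \<open>L = \<Lambda>\<^sup>7 W*\<close>, is an element of the ninth tensor power of \<open>L\<close>; on vectors \<open>x\<^sub>1, \<dots>, x\<^sub>7\<close>
  it evaluates to the determinant of the matrix with entries \<open>b\<^sub>\<phi>(x\<^sub>i,x\<^sub>j)(x\<^sub>1,\<dots>,x\<^sub>7)\<close>, and
  \<^const>\<open>root\<close> is the real, sign-preserving, ninth root. The function \<open>idx7\<close> only turns list
  positions \<open>0, \<dots>, 6\<close> into matrix indices.
\<close>

definition G2_vol :: "'a form \<Rightarrow> 'a form" where
  "G2_vol \<phi> = (\<lambda>xs. if length xs = 7
      then root 9 (det (\<chi> (i::7) (j::7). G2_b \<phi> (xs ! idx7 i) (xs ! idx7 j) xs))
      else 0)"

text \<open>
  The inner product \<open>det(b\<^sub>\<phi>)\<^bsup>-1/9\<^esup> b\<^sub>\<phi>\<close>: the quotient of the 7-form \<open>b\<^sub>\<phi>(v,w)\<close>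
  by the volume form.
\<close>

definition G2_metric :: "'a form \<Rightarrow> 'a \<Rightarrow> 'a \<Rightarrow> real" where
  "G2_metric \<phi> v w = (THE r. \<forall>xs. G2_b \<phi> v w xs = r * G2_vol \<phi> xs)"

definition orthonormal_basis :: "('a::real_vector \<Rightarrow> 'a \<Rightarrow> real) \<Rightarrow> 'a list \<Rightarrow> bool" where
  "orthonormal_basis g es \<longleftrightarrow> distinct es \<and> independent (set es) \<and> span (set es) = UNIV
     \<and> (\<forall>i < length es. \<forall>j < length es. g (es ! i) (es ! j) = (if i = j then 1 else 0))"

text \<open>
  The Hodge operator in terms of an orthonormal basis \<open>e\<close>: for \<open>\<beta>\<close> of degree \<open>k\<close>,
  \<open>(*\<beta>)(y) = \<Sum>\<^sub>I \<beta>(e\<^sub>I) vol(e\<^sub>I, y)\<close>, the sum running over increasing \<open>I\<close> of length \<open>k\<close>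
  (the terms with \<open>|I| \<noteq> k\<close> vanish). Thus \<open>*e\<^sup>I = \<plusminus>e\<^sup>J\<close> with \<open>e\<^sup>I \<and> *e\<^sup>I = vol\<close>, and
  \<open>\<alpha> \<and> *\<beta> = g(\<alpha>,\<beta>) vol\<close> for \<open>\<alpha>\<close> and \<open>\<beta>\<close> of the same degree.
\<close>

definition G2_hodge :: "'a::real_vector form \<Rightarrow> 'a form \<Rightarrow> 'a form" where
  "G2_hodge \<phi> \<beta> = (let es = (SOME es. orthonormal_basis (G2_metric \<phi>) es) in
     (\<lambda>ys. \<Sum>S \<in> Pow {..<length es}. \<beta> (nths es S) * G2_vol \<phi> (nths es S @ ys)))"

definition torsion_free_G2 :: "('a::real_vector \<Rightarrow> 'a \<Rightarrow> 'a) \<Rightarrow> 'a form \<Rightarrow> bool" where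
  "torsion_free_G2 br \<phi> \<longleftrightarrow> definite_form \<phi>
     \<and> ce_d br \<phi> = (\<lambda>_. 0) \<and> ce_d br (G2_hodge \<phi> \<phi>) = (\<lambda>_. 0)"


section \<open>The Lie algebra \<open>s\<^sub>7\<close>\<close>

definition coframe :: "7 \<Rightarrow> (real^7) form" where
  "coframe i = (\<lambda>xs. if length xs = 1 then hd xs $ i else 0)"

abbreviation coframe2 :: "7 \<Rightarrow> 7 \<Rightarrow> (real^7) form" where
  "coframe2 i j \<equiv> wedge (coframe i) (coframe j)"

definition s7_de :: "7 \<Rightarrow> (real^7) form" where
  "s7_de i =
     (if i = 1 then coframe2 2 5
      else if i = 2 then (\<lambda>xs. - coframe2 1 5 xs)
      else if i = 3 then coframe2 4 5
      else if i = 4 then (\<lambda>xs. - coframe2 3 5 xs)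
      else (\<lambda>_. 0))"

text \<open>The bracket determined by \<open>e\<^sup>i([x,y]) = - de\<^sup>i(x,y)\<close>.\<close>

definition s7_bracket :: "real^7 \<Rightarrow> real^7 \<Rightarrow> real^7" where
  "s7_bracket x y = (\<chi> i. - s7_de i [x, y])"

lemma Pow_lessThan_2:
  "Pow {..<Suc (Suc 0)} = {{}, {0}, {1}, {0, 1}}"
  by (auto simp: lessThan_Suc Pow_insert insert_commute)

lemma coframe2_pair: "coframe2 i j [x, y] = x $ i * y $ j - x $ j * y $ i"
proof -
  have "{(i, j). i \<in> {0} \<and> j < 2 \<and> j \<notin> {0} \<and> j < i} = ({} :: (nat \<times> nat) set)" by auto
  hence s0: "shuffle_sign 2 {0} = 1" by (simp only: shuffle_sign_def card.empty power_0)
  have "{(i, j). i \<in> {1} \<and> j < 2 \<and> j \<notin> {1} \<and> j < i} = ({(1, 0)} :: (nat \<times> nat) set)" by auto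
  hence s1: "shuffle_sign 2 {1} = -1" by (simp add: shuffle_sign_def)
  show ?thesis
    using s0 s1 by (simp add: wedge_def Pow_lessThan_2 coframe_def nths_Cons numeral_2_eq_2)
qed

lemma s7_bracket_nth:
  "s7_bracket x y $ 1 = x $ 5 * y $ 2 - x $ 2 * y $ 5"
  "s7_bracket x y $ 2 = x $ 1 * y $ 5 - x $ 5 * y $ 1"
  "s7_bracket x y $ 3 = x $ 5 * y $ 4 - x $ 4 * y $ 5"
  "s7_bracket x y $ 4 = x $ 3 * y $ 5 - x $ 5 * y $ 3"
  "i \<notin> {1, 2, 3, 4} \<Longrightarrow> s7_bracket x y $ i = 0"
  by (simp_all add: s7_bracket_def s7_de_def coframe2_pair)

lemma s7_vec_eqI:
  fixes x y :: "real^7"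
  assumes "x $ 1 = y $ 1" "x $ 2 = y $ 2" "x $ 3 = y $ 3" "x $ 4 = y $ 4"
    and "\<And>i. i \<notin> {1, 2, 3, 4} \<Longrightarrow> x $ i = y $ i"
  shows "x = y"
  using assms by (metis vec_eq_iff insert_iff empty_iff)

lemma lie_algebra_s7: "lie_algebra s7_bracket"
  unfolding lie_algebra_def bilinear_def
  by (intro conjI allI linearI; rule s7_vec_eqI) (auto simp: s7_bracket_nth algebra_simps)

lemma not_abelian_s7: "\<not> lie_abelian s7_bracket"
proof
  assume "lie_abelian s7_bracket"
  hence "s7_bracket (axis 1 1) (axis 5 1) $ 2 = 0" by (simp add: lie_abelian_def)
  thus False by (simp add: s7_bracket_nth axis_def)
qed

lemma ce_d_coframe: "ce_d s7_bracket (coframe i) [x, y] = s7_de i [x, y]"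
proof -
  have "{(i, j). i < j \<and> j < length [x, y]} = {(0, 1)}" by auto
  thus ?thesis by (simp add: ce_d_def coframe_def nths_Cons s7_bracket_def)
qed

end

theory Submission
  imports Defs
begin

text \<open>
  A definite 3-form is brought to the standard form \<open>\<phi>\<^sub>0\<close> on seven-dimensional Euclidean space by
  maximising it over triples of unit vectors. For the standard form the equations \<open>d\<phi> = 0\<close> and
  \<open>d*\<phi> = 0\<close> say that every operator \<open>A x\<close> of the Levi-Civita connection lies in \<open>g\<^sub>2\<close>. Hence the
  curvature is a \<open>g\<^sub>2\<close>-instanton and Ricci-flat; Bochner's argument, applied to the closed 1-form
  \<open>tr ad\<close>, shows that the Lie algebra is unimodular. Left-invariant 7-forms that are exact then
  vanish, so the Chern--Simons formula \<open>tr (R \<and> R) \<and> \<phi> = d(CS \<and> \<phi>)\<close> forces \<open>|R|\<^sup>2 = 0\<close>.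

  For a flat metric Lie algebra, \<open>ker A\<close> is an abelian ideal and its orthogonal complement is an
  abelian subalgebra acting on it by commuting skew maps (Milnor). If the algebra is not abelian, take
  \<open>x\<^sub>0 \<noteq> 0\<close> in the complement and \<open>z \<noteq> 0\<close> in the center. The derivations \<open>A x\<close> of the cross product
  kill \<open>x\<^sub>0\<close>, \<open>z\<close> and \<open>x\<^sub>0 \<times> z\<close>, so on the remaining four-dimensional space they are imaginary
  quaternions; as they commute, the complement is the line spanned by \<open>x\<^sub>0\<close>, and \<open>A x\<^sub>0\<close> is a
  multiple of a complex structure there. This is the algebra \<open>s\<^sub>7\<close>.
\<close>

section \<open>Flatness of unimodular Lie algebras with a parallel instanton 4-form\<close>

text \<open>The center decides how small the acting algebra is: derivations of the cross product
  that kill one vector form su(3), where commuting families can be planes, while those that kill two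
  independent vectors form su(2), where they are lines. No compact quotient is at hand, so
  integration is replaced by an algebraic Stokes theorem, which needs unimodularity. That is not
  given and has to be extracted from Ricci-flatness before the Chern-Simons argument can start. The
  sign in that argument comes from the 4-form: contraction with it has the same eigenvalue on all of
  g2, so the pairing is a positive multiple of the squared norm of R. The 3-form is maximised only
  after its bilinear form b has been made a multiple of the Euclidean inner product. The maximum
  then contributes first-order conditions only. All further information comes from b, which makes
  three 2-forms on the complementary four-space orthonormal and removes the part of the 3-form
  living on that space.\<close>

lemma linear_sum_Basis:
  fixes f :: "'v::euclidean_space \<Rightarrow> 'w::real_vector"
  assumes "linear f"
  shows "f x = (\<Sum>i\<in>Basis. (x \<bullet> i) *\<^sub>R f i)"
  by (subst euclidean_representation[symmetric, of x])
     (simp add: linear_sum[OF assms] linear_scale[OF assms])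

text \<open>Both sides are the same double sum over the matrix entries
  \<open>S i \<bullet> j\<close>. For skew \<open>S\<close> this moves an operator between two slots
  of a contraction, at the cost of a sign.\<close>

lemma sum_Basis_adjoint:
  fixes B :: "'v::euclidean_space \<Rightarrow> 'v \<Rightarrow> 'w::real_vector"
  assumes l: "\<And>y. linear (\<lambda>x. B x y)" and r: "\<And>x. linear (B x)"
    and adj: "\<And>x y. S x \<bullet> y = x \<bullet> S' y"
  shows "(\<Sum>i\<in>Basis. B (S i) i) = (\<Sum>i\<in>Basis. B i (S' i))"
proof -
  have "(\<Sum>i\<in>Basis. B (S i) i) = (\<Sum>i\<in>Basis. \<Sum>j\<in>Basis. (S i \<bullet> j) *\<^sub>R B j i)"
    by (intro sum.cong refl linear_sum_Basis[OF l])
  also have "\<dots> = (\<Sum>j\<in>Basis. \<Sum>i\<in>Basis. (S' j \<bullet> i) *\<^sub>R B j i)"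
    by (subst sum.swap) (simp add: adj inner_commute[of _ "S' _"])
  also have "\<dots> = (\<Sum>j\<in>Basis. B j (S' j))"
    by (intro sum.cong refl linear_sum_Basis[OF r, symmetric])
  finally show ?thesis .
qed

section \<open>Connections, curvature and Bochner's argument\<close>

text \<open>These axioms characterise the Levi-Civita connection of a left-invariant metric.
  Curvature computations use them alone; \<open>levi_civita\<close> is the instance.\<close>

locale metric_connection =
  fixes br A :: "'v::euclidean_space \<Rightarrow> 'v \<Rightarrow> 'v"
  assumes lie: "lie_algebra br"
    and bilinear_A: "bilinear A"
    and skew: "A x y \<bullet> z = - (y \<bullet> A x z)"
    and torsion_free: "br x y = A x y - A y x"
begin

definition curv :: "'v \<Rightarrow> 'v \<Rightarrow> 'v \<Rightarrow> 'v" where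
  "curv x y z = A x (A y z) - A y (A x z) - A (br x y) z"

lemmas A_simps = bilinear_ladd[OF bilinear_A] bilinear_radd[OF bilinear_A]
  bilinear_lsub[OF bilinear_A] bilinear_rsub[OF bilinear_A]
  bilinear_lmul[OF bilinear_A] bilinear_rmul[OF bilinear_A]
  bilinear_lneg[OF bilinear_A] bilinear_rneg[OF bilinear_A]
  bilinear_lzero[OF bilinear_A] bilinear_rzero[OF bilinear_A]

lemma linear_A: "linear (A x)" "linear (\<lambda>y. A y x)"
  using bilinear_A by (auto simp: bilinear_def)

lemma jacobi: "br x (br y z) + br y (br z x) + br z (br x y) = 0"
  using lie by (simp add: lie_algebra_def)

lemma bilinear_br: "bilinear br"
  using lie by (simp add: lie_algebra_def)

lemmas br_simps = bilinear_ladd[OF bilinear_br] bilinear_radd[OF bilinear_br]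
  bilinear_lsub[OF bilinear_br] bilinear_rsub[OF bilinear_br]
  bilinear_lmul[OF bilinear_br] bilinear_rmul[OF bilinear_br]
  bilinear_lneg[OF bilinear_br] bilinear_rneg[OF bilinear_br]

lemma linear_br: "linear (br x)" "linear (\<lambda>y. br y x)"
  using bilinear_br by (auto simp: bilinear_def)

lemma br_swap: "br y x = - br x y"
  by (simp add: torsion_free)

lemma A_self_orth [simp]: "A x y \<bullet> y = 0"
  using skew[of x y y] by (simp add: inner_commute)

lemma curv_swap: "curv y x z = - curv x y z"
  by (simp add: curv_def br_swap[of y x] A_simps)

lemma linear_curv:
  "linear (curv x y)" "linear (\<lambda>z. curv x z y)" "linear (\<lambda>z. curv z x y)"
  by (rule linearI; simp add: curv_def A_simps br_simps algebra_simps)+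

lemma curv_skew: "curv x y z \<bullet> w = - (z \<bullet> curv x y w)"
  by (simp add: curv_def inner_diff_left inner_diff_right skew)

lemma bianchi: "curv x y z + curv y z x + curv z x y = 0"
  using jacobi[of x y z]
  by (simp add: curv_def torsion_free A_simps algebra_simps)

text \<open>Milnor's octahedron: each of six terms occurs in two of the four Bianchi identities
  below, and first minus second minus third plus fourth leaves twice the desired difference.\<close>

lemma curv_pair: "curv x y z \<bullet> w = curv z w x \<bullet> y"
proof -
  define r where "r x y z w = curv x y z \<bullet> w" for x y z w
  have b: "r x y z w + r y z x w + r z x y w = 0" for x y z w
    by (simp add: r_def bianchi flip: inner_add_left)
  have s: "r y x z w = - r x y z w" for x y z w
    by (simp add: r_def curv_swap[of y x])
  have t: "r x y w z = - r x y z w" for x y z w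
    unfolding r_def by (subst curv_skew) (simp add: inner_commute)
  have "r x y z w + r y z x w + r z x y w = 0" by (rule b)
  moreover have "r y z x w + r z w x y + r y w z x = 0"
    using b[of y z w x] t[of y z x w] t[of z w x y] s[of y w z x] by linarith
  moreover have "r z w x y + r x w y z + r z x y w = 0"
    using b[of z w x y] s[of x w z y] t[of x w y z] s[of z x w y] t[of z x y w] by linarith
  moreover have "r x w y z + r x y z w + r y w z x = 0"
    using b[of w x y z] s[of x w y z] t[of x y z w] t[of y w z x] by linarith
  ultimately have "r x y z w = r z w x y" by linarith
  then show ?thesis by (simp only: r_def)
qed

lemma trace_commute:
  fixes S T :: "'v \<Rightarrow> 'v"
  assumes S: "linear S" and T: "linear T"
  shows "(\<Sum>i\<in>Basis. S (T i) \<bullet> i) = (\<Sum>i\<in>Basis. T (S i) \<bullet> i)"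
proof -
  have "(\<Sum>i\<in>Basis. S (T i) \<bullet> i) = (\<Sum>i\<in>Basis. S i \<bullet> adjoint T i)"
    by (rule sum_Basis_adjoint)
       (auto intro!: linearI simp: linear_add[OF S] linear_scale[OF S] inner_simps
           adjoint_clauses(1)[OF T])
  then show ?thesis by (simp add: adjoint_clauses(1)[OF T])
qed

text \<open>By \<open>trace_ad\<close> this vector represents the 1-form tr ad, so its vanishing is
  unimodularity.\<close>

definition mean :: 'v where "mean = (\<Sum>i\<in>Basis. A i i)"

lemma trace_ad: "(\<Sum>i\<in>Basis. br x i \<bullet> i) = x \<bullet> mean"
proof -
  have "(\<Sum>i\<in>Basis. br x i \<bullet> i) = (\<Sum>i\<in>Basis. x \<bullet> A i i)"
    by (rule sum.cong) (simp_all add: torsion_free inner_diff_left skew[of _ x])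
  then show ?thesis by (simp add: mean_def inner_sum_right)
qed

text \<open>By the Jacobi identity ad [x,y] is a commutator, so its trace is zero. This is
  closedness of the 1-form tr ad.\<close>

lemma mean_br: "br x y \<bullet> mean = 0"
proof -
  have "br x y \<bullet> mean = (\<Sum>i\<in>Basis. br (br x y) i \<bullet> i)" by (simp add: trace_ad)
  also have "\<dots> = (\<Sum>i\<in>Basis. br x (br y i) \<bullet> i) - (\<Sum>i\<in>Basis. br y (br x i) \<bullet> i)"
  proof -
    have "br (br x y) i = br x (br y i) - br y (br x i)" for i
      using jacobi[of x y i] br_swap[of i "br x y"] br_swap[of i x]
      by (simp add: br_simps algebra_simps)
    then show ?thesis by (simp add: inner_diff_left sum_subtractf)
  qed
  also have "\<dots> = 0" by (simp add: trace_commute[OF linear_br(1) linear_br(1), of x y])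
  finally show ?thesis .
qed

text \<open>The vector \<open>mean\<close> is dual to a closed 1-form, so this is Bochner's argument.\<close>

lemma Ricci_flat_imp_unimodular:
  assumes ric: "\<And>x. (\<Sum>j\<in>Basis. curv x j j) = 0"
  shows "mean = 0"
proof -
  let ?H = mean
  \<comment> \<open>Closedness of the dual 1-form makes the covariant derivative of
    \<open>?H\<close> a symmetric operator.\<close>
  have sym: "A x ?H \<bullet> y = A y ?H \<bullet> x" for x y
    using mean_br[of x y] skew[of x ?H y] skew[of y ?H x]
    by (simp add: torsion_free inner_diff_right inner_commute)
  \<comment> \<open>The trace of a symmetric operator composed with the skew operator
    \<open>A ?H\<close> vanishes.\<close>
  have tr0: "(\<Sum>j\<in>Basis. A j ?H \<bullet> A ?H j) = 0"
  proof -
    have "(\<Sum>j\<in>Basis. A (A ?H j) ?H \<bullet> j) = (\<Sum>j\<in>Basis. A j ?H \<bullet> (- A ?H j))"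
      by (rule sum_Basis_adjoint[where B = "\<lambda>x y. A x ?H \<bullet> y"])
         (auto intro!: linearI simp: A_simps inner_simps skew)
    then show ?thesis using sym by (simp add: sum_negf)
  qed
  \<comment> \<open>Bochner's identity before summation: over an orthonormal basis the right-hand
    side reduces to minus the squared norm of the covariant derivative of \<open>?H\<close>.\<close>
  have "curv ?H j j \<bullet> ?H = (A ?H (A j j) \<bullet> ?H) + A ?H j \<bullet> A j ?H
      + (A j ?H \<bullet> A ?H j - A j ?H \<bullet> A j ?H)" for j
    using sym[of "br ?H j" j] skew[of "br ?H j" j ?H] skew[of j "A ?H j" ?H]
    by (simp add: curv_def inner_diff_left inner_diff_right torsion_free inner_commute)
  then have "0 = (\<Sum>j\<in>Basis. A ?H (A j j) \<bullet> ?H) + (\<Sum>j\<in>Basis. A ?H j \<bullet> A j ?H)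
      + ((\<Sum>j\<in>Basis. A j ?H \<bullet> A ?H j) - (\<Sum>j\<in>Basis. A j ?H \<bullet> A j ?H))"
    using arg_cong[OF ric[of ?H], of "\<lambda>v. v \<bullet> ?H"]
    by (simp add: inner_sum_left sum.distrib sum_subtractf)
  moreover have "(\<Sum>j\<in>Basis. A ?H (A j j) \<bullet> ?H) = 0"
  proof -
    have "(\<Sum>j\<in>Basis. A ?H (A j j)) = A ?H ?H"
      by (simp add: mean_def[of] linear_sum[OF linear_A(1)])
    then show ?thesis by (simp flip: inner_sum_left)
  qed
  ultimately have "(\<Sum>j\<in>Basis. A j ?H \<bullet> A j ?H) = 0"
    using tr0 by (simp add: inner_commute)
  then have "\<forall>j\<in>Basis. A j ?H = 0"
    by (subst (asm) sum_nonneg_eq_0_iff) auto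
  \<comment> \<open>A parallel \<open>?H\<close> is orthogonal to every \<open>A i i\<close> by
    skewness, hence to their sum, which is \<open>?H\<close> itself.\<close>
  then have "?H \<bullet> ?H = 0"
    by (subst mean_def) (simp add: inner_sum_left skew)
  then show ?thesis by simp
qed


lemma curv_trace:
  "(\<Sum>m\<in>Basis. curv x y (curv z w m) \<bullet> m) = - (\<Sum>m\<in>Basis. curv x y m \<bullet> curv z w m)"
proof -
  have "curv x y (curv z w m) \<bullet> m = - (curv x y m \<bullet> curv z w m)" for m
    using curv_skew[of x y "curv z w m" m] by (simp add: inner_commute)
  then show ?thesis by (simp add: sum_negf)
qed

end

text \<open>\<open>T\<close> is instantiated by \<open>psi0\<close>. The instanton equation puts the
  curvature into an eigenspace of contraction with \<open>T\<close>; over unordered pairs the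
  eigenvalue is -1, and the sum over ordered pairs doubles it.\<close>

locale calibrated_connection = metric_connection br A for br A :: "'v::euclidean_space \<Rightarrow> 'v \<Rightarrow> 'v" +
  fixes T :: "'v::euclidean_space \<Rightarrow> 'v \<Rightarrow> 'v \<Rightarrow> 'v \<Rightarrow> real"
  assumes linear_T: "linear (\<lambda>x. T x y z w)"
    and T_swap: "T y x z w = - T x y z w" "T x z y w = - T x y z w" "T x y w z = - T x y z w"
    and T_parallel: "T (A v x) y z w + T x (A v y) z w + T x y (A v z) w + T x y z (A v w) = 0"
    and instanton:
      "(\<Sum>k\<in>Basis. \<Sum>l\<in>Basis. T x y k l * (curv z w k \<bullet> l)) = - 2 * (curv z w x \<bullet> y)"
begin

lemma linear_T': "linear (\<lambda>x. T y x z w)" "linear (\<lambda>x. T y z x w)" "linear (\<lambda>x. T y z w x)"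
proof -
  have 1: "linear (\<lambda>x. - f x)" if "linear f" for f :: "'v \<Rightarrow> real"
    using that by (rule linear_compose_neg)
  have "(\<lambda>x. T y x z w) = (\<lambda>x. - T x y z w)" for y z w
    by (rule ext) (rule T_swap(1))
  then show 2: "linear (\<lambda>x. T y x z w)" for y z w
    using 1[OF linear_T] by metis
  have "(\<lambda>x. T y z x w) = (\<lambda>x. - T y x z w)" for y z w
    by (rule ext) (rule T_swap(2))
  then show 3: "linear (\<lambda>x. T y z x w)" for y z w
    using 1[OF 2] by metis
  have "(\<lambda>x. T y z w x) = (\<lambda>x. - T y z x w)" for y z w
    by (rule ext) (rule T_swap(3))
  then show "linear (\<lambda>x. T y z w x)" for y z w
    using 1[OF 3] by metis
qed

lemma T_rotate: "T x z w y = T x y z w"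
  using T_swap(2)[of x z y w] T_swap(3)[of x z w y] by simp

text \<open>Pair symmetry of the curvature moves the instanton equation from the endomorphism slots
  to the 2-form slots.\<close>

lemma instanton': "(\<Sum>k\<in>Basis. \<Sum>l\<in>Basis. T x y k l * (curv k l z \<bullet> w)) = - 2 * (curv x y z \<bullet> w)"
  using instanton[of x y z w] by (simp only: curv_pair[of z w])

lemma sum_rotate:
  fixes f :: "'v \<Rightarrow> 'v \<Rightarrow> 'v \<Rightarrow> real"
  shows "(\<Sum>j\<in>Basis. \<Sum>k\<in>Basis. \<Sum>l\<in>Basis. f j k l) = (\<Sum>j\<in>Basis. \<Sum>k\<in>Basis. \<Sum>l\<in>Basis. f k l j)"
proof -
  have "(\<Sum>j\<in>Basis. \<Sum>k\<in>Basis. \<Sum>l\<in>Basis. f k l j) = (\<Sum>k\<in>Basis. \<Sum>j\<in>Basis. \<Sum>l\<in>Basis. f k l j)"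
    by (rule sum.swap)
  also have "\<dots> = (\<Sum>k\<in>Basis. \<Sum>l\<in>Basis. \<Sum>j\<in>Basis. f k l j)"
    by (rule sum.cong[OF refl], rule sum.swap)
  finally show ?thesis by simp
qed

text \<open>\<open>T\<close> is invariant under cyclic rotation of its last three arguments, so
  three times the contraction with \<open>g\<close> is the contraction with the cyclic sum of
  \<open>g\<close>.\<close>

lemma sum_T_cyclic:
  assumes "\<And>j k l. g j k l + g k l j + g l j k = 0"
  shows "(\<Sum>j\<in>Basis. \<Sum>k\<in>Basis. \<Sum>l\<in>Basis. T x j k l * g j k l) = 0" (is "?s g = 0")
proof -
  have rot: "?s g = ?s (\<lambda>j k l. g k l j)" for g
    by (subst sum_rotate) (simp add: T_rotate)
  have "?s g + ?s (\<lambda>j k l. g k l j) + ?s (\<lambda>j k l. g l j k) = ?s (\<lambda>j k l. g j k l + g k l j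
      + g l j k)"
    by (simp add: sum.distrib distrib_left)
  also have "\<dots> = 0" by (simp add: assms)
  finally show ?thesis using rot[of g] rot[of "\<lambda>j k l. g k l j"] by simp
qed

text \<open>The instanton equation replaces \<open>curv x j\<close> by a contraction of
  \<open>T\<close> with \<open>curv k l\<close>. The trace over \<open>j\<close> then
  antisymmetrises \<open>j\<close>, \<open>k\<close>, \<open>l\<close>, and the first Bianchi
  identity gives zero.\<close>

lemma Ricci_flat: "(\<Sum>j\<in>Basis. curv x j j) = 0"
proof (rule euclidean_eqI)
  fix w :: 'v
  have "- 2 * (\<Sum>j\<in>Basis. curv x j j \<bullet> w)
      = (\<Sum>j\<in>Basis. \<Sum>k\<in>Basis. \<Sum>l\<in>Basis. T x j k l * (curv k l j \<bullet> w))"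
    by (simp only: sum_distrib_left instanton')
  also have "\<dots> = 0"
  proof (rule sum_T_cyclic)
    show "curv k l j \<bullet> w + curv l j k \<bullet> w + curv j k l \<bullet> w = 0" for j k l
      by (simp add: bianchi flip: inner_add_left)
  qed
  finally show "(\<Sum>j\<in>Basis. curv x j j) \<bullet> w = 0 \<bullet> w"
    by (simp add: inner_sum_left)
qed

lemma unimodular: "mean = 0"
  by (rule Ricci_flat_imp_unimodular) (rule Ricci_flat)

section \<open>Full contractions with the parallel 4-form and the Chern-Simons argument\<close>

abbreviation sum4 :: "('v \<Rightarrow> 'v \<Rightarrow> 'v \<Rightarrow> 'v \<Rightarrow> real) \<Rightarrow> real" where
  "sum4 f \<equiv> \<Sum>i\<in>Basis. \<Sum>j\<in>Basis. \<Sum>k\<in>Basis. \<Sum>l\<in>Basis. f i j k l"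

lemma sum4_swap:
  "sum4 f = sum4 (\<lambda>i j k l. f j i k l)"
  "sum4 f = sum4 (\<lambda>i j k l. f i k j l)"
  "sum4 f = sum4 (\<lambda>i j k l. f i j l k)"
  by (rule sum.swap, rule sum.cong[OF refl], rule sum.swap,
      rule sum.cong[OF refl], rule sum.cong[OF refl], rule sum.swap)

text \<open>Stokes' theorem for \<open>d(\<beta> \<and> *T)\<close>: as \<open>T\<close> is parallel and the algebra is unimodular,
  \<open>d\<beta>\<close> pairs to zero with \<open>T\<close>.\<close>

lemma stokes:
  assumes lin: "\<And>y z. linear (\<lambda>x. \<beta> x y z)"
    and sw: "\<And>x y z. \<beta> y x z = - \<beta> x y z" "\<And>x y z. \<beta> x z y = - \<beta> x y z"
  shows "sum4 (\<lambda>i j k l. T i j k l * \<beta> (br i j) k l) = 0"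
proof -
  let ?X = "sum4 (\<lambda>i j k l. T i j k l * \<beta> (A i j) k l)"
  \<comment> \<open>Skewness shifts \<open>A i\<close> from \<open>T\<close> to \<beta>. The two
    facts after this one reduce the remaining slots to this slot.\<close>
  have s: "sum4 (\<lambda>i j k l. T i (A i j) k l * \<beta> j k l) = - ?X"
  proof -
    have "(\<Sum>j\<in>Basis. \<Sum>k\<in>Basis. \<Sum>l\<in>Basis. T i (A i j) k l * \<beta> j k l)
        = (\<Sum>j\<in>Basis. \<Sum>k\<in>Basis. \<Sum>l\<in>Basis. T i j k l * \<beta> (- A i j) k l)" for i
      by (rule sum_Basis_adjoint[where B = "\<lambda>x y. \<Sum>k\<in>Basis. \<Sum>l\<in>Basis. T i x k l * \<beta> y k l"])
         (auto intro!: linear_compose_sum linearI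
            simp: skew linear_add[OF lin] linear_scale[OF lin] linear_add[OF linear_T'(1)]
              linear_scale[OF linear_T'(1)] algebra_simps)
    then show ?thesis by (simp add: linear_neg[OF lin] sum_negf)
  qed
  have s2: "sum4 (\<lambda>i j k l. T i j (A i k) l * \<beta> j k l) = - ?X"
  proof -
    have "(\<Sum>j\<in>Basis. \<Sum>k\<in>Basis. \<Sum>l\<in>Basis. T i j (A i k) l * \<beta> j k l)
       = (\<Sum>j\<in>Basis. \<Sum>k\<in>Basis. \<Sum>l\<in>Basis. T i (A i j) k l * \<beta> j k l)" for i
    proof -
      have "T i j (A i k) l * \<beta> j k l = T i (A i k) j l * \<beta> k j l" for j k l
        using T_swap(2)[of i j "A i k" l] sw(1)[of k j l] by simp
      then show ?thesis by (subst sum.swap) (intro sum.cong[OF refl])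
    qed
    then show ?thesis using s by simp
  qed
  have s3: "sum4 (\<lambda>i j k l. T i j k (A i l) * \<beta> j k l) = - ?X"
  proof -
    have "T i j k (A i l) * \<beta> j k l = T i j (A i l) k * \<beta> j l k" for i j k l
      using T_swap(3)[of i j k "A i l"] sw(2)[of j l k] by simp
    then have "sum4 (\<lambda>i j k l. T i j k (A i l) * \<beta> j k l)
       = (\<Sum>i\<in>Basis. \<Sum>j\<in>Basis. \<Sum>k\<in>Basis. \<Sum>l\<in>Basis. T i j (A i l) k * \<beta> j l k)"
      by (intro sum.cong[OF refl])
    also have "\<dots> = sum4 (\<lambda>i j k l. T i j (A i k) l * \<beta> j k l)"
      by (rule sum4_swap)
    finally show ?thesis using s2 by simp
  qed
  \<comment> \<open>Unimodularity enters here: the vectors \<open>A i i\<close> add up to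
    \<open>mean\<close>.\<close>
  have "sum4 (\<lambda>i j k l. T (A i i) j k l * \<beta> j k l) = 0"
  proof -
    let ?f = "\<lambda>v. \<Sum>j\<in>Basis. \<Sum>k\<in>Basis. \<Sum>l\<in>Basis. T v j k l * \<beta> j k l"
    have "linear ?f"
      by (auto intro!: linear_compose_sum linearI
          simp: linear_add[OF linear_T] linear_scale[OF linear_T] algebra_simps)
    then have "(\<Sum>i\<in>Basis. ?f (A i i)) = ?f mean"
      unfolding mean_def by (rule linear_sum[symmetric])
    then show ?thesis
      by (simp add: unimodular linear_0[OF linear_T])
  qed
  moreover have "T (A i i) j k l * \<beta> j k l + T i (A i j) k l * \<beta> j k l
      + T i j (A i k) l * \<beta> j k l + T i j k (A i l) * \<beta> j k l = 0" for i j k l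
    by (simp only: T_parallel mult_zero_left flip: distrib_right)
  then have "sum4 (\<lambda>i j k l. T (A i i) j k l * \<beta> j k l + T i (A i j) k l * \<beta> j k l
      + T i j (A i k) l * \<beta> j k l + T i j k (A i l) * \<beta> j k l) = 0"
    by (simp only: sum.neutral_const)
  then have "sum4 (\<lambda>i j k l. T (A i i) j k l * \<beta> j k l)
     + sum4 (\<lambda>i j k l. T i (A i j) k l * \<beta> j k l)
     + sum4 (\<lambda>i j k l. T i j (A i k) l * \<beta> j k l)
     + sum4 (\<lambda>i j k l. T i j k (A i l) * \<beta> j k l) = 0"
    by (simp only: sum.distrib)
  ultimately have X: "?X = 0" using s s2 s3 by simp
  have "sum4 (\<lambda>i j k l. T i j k l * \<beta> (A j i) k l) = sum4 (\<lambda>i j k l. T j i k l * \<beta> (A i j) k l)"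
    by (rule sum.swap)
  also have "\<dots> = sum4 (\<lambda>i j k l. - (T i j k l * \<beta> (A i j) k l))"
    by (intro sum.cong[OF refl], subst T_swap(1)) simp
  finally have "sum4 (\<lambda>i j k l. T i j k l * \<beta> (A j i) k l) = - ?X"
    by (simp only: sum_negf)
  then show ?thesis using X
    by (simp add: torsion_free linear_diff[OF lin] right_diff_distrib sum_subtractf)
qed


text \<open>The cyclic sum of K(x,[y,z]) is the quadratic part of the Chern-Simons 3-form. In its
  differential the terms with a double bracket cancel by the Jacobi identity, which leaves K of two
  brackets.\<close>

lemma sum4_T_br_br:
  assumes lin: "\<And>y. linear (\<lambda>x. K x y)" and sym: "\<And>x y. K x y = K y x"
  shows "sum4 (\<lambda>i j k l. T i j k l * K (br i j) (br k l)) = 0"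
proof -
  have lin2: "linear (K x)" for x
  proof -
    have "K x = (\<lambda>y. K y x)" by (rule ext) (rule sym)
    then show ?thesis using lin by simp
  qed
  let ?\<beta> = "\<lambda>x y z. K x (br y z) + K y (br z x) + K z (br x y)"
  have "sum4 (\<lambda>i j k l. T i j k l * ?\<beta> (br i j) k l) = 0"
  proof (rule stokes)
    show "linear (\<lambda>x. ?\<beta> x y z)" for y z
      by (intro linear_compose_add lin linear_compose[OF linear_br(1) lin2, unfolded o_def]
          linear_compose[OF linear_br(2) lin2, unfolded o_def])
    show "?\<beta> y x z = - ?\<beta> x y z" for x y z
      by (simp add: br_swap[of z x] br_swap[of z y] br_swap[of y x] linear_neg[OF lin2])
    show "?\<beta> x z y = - ?\<beta> x y z" for x y z
      by (simp add: br_swap[of y x] br_swap[of z y] br_swap[of z x] linear_neg[OF lin2])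
  qed
  then have "sum4 (\<lambda>i j k l. T i j k l * K (br i j) (br k l))
     + sum4 (\<lambda>i j k l. T i j k l * K k (br l (br i j)))
     + sum4 (\<lambda>i j k l. T i j k l * K l (br (br i j) k)) = 0"
    by (simp only: distrib_left sum.distrib)
  moreover have z: "sum4 (\<lambda>i j k l. T i j k l * K l (br (br i j) k)) = 0"
  proof -
    have "(\<Sum>l\<in>Basis. \<Sum>i\<in>Basis. \<Sum>j\<in>Basis. \<Sum>k\<in>Basis. T l i j k * K l (br (br i j) k)) = 0"
    proof (rule sum.neutral, rule ballI, rule sum_T_cyclic)
      fix l i j k
      have "br (br i j) k + br (br j k) i + br (br k i) j = 0"
        using arg_cong[OF jacobi[of i j k], of uminus]
        by (simp add: br_swap[of "br i j" k] br_swap[of "br j k" i] br_swap[of "br k i" j]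
            algebra_simps)
      then show "K l (br (br i j) k) + K l (br (br j k) i) + K l (br (br k i) j) = 0"
        by (metis linear_add[OF lin2] linear_0[OF lin2])
    qed
    moreover have "T i j k l * K l (br (br i j) k) = - (T l i j k * K l (br (br i j) k))" for i j
        k l
      using T_swap(3)[of i j l k] T_swap(2)[of i l j k] T_swap(1)[of l i j k] by simp
    then have "sum4 (\<lambda>i j k l. T i j k l * K l (br (br i j) k))
      = - sum4 (\<lambda>i j k l. T l i j k * K l (br (br i j) k))"
      by (simp only: sum_negf)
    moreover have "sum4 (\<lambda>i j k l. T l i j k * K l (br (br i j) k))
      = (\<Sum>l\<in>Basis. \<Sum>i\<in>Basis. \<Sum>j\<in>Basis. \<Sum>k\<in>Basis. T l i j k * K l (br (br i j) k))"
      (is "?a = ?b")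
    proof -
      have "?a = (\<Sum>i\<in>Basis. \<Sum>j\<in>Basis. \<Sum>l\<in>Basis. \<Sum>k\<in>Basis. T l i j k * K l (br (br i j) k))"
        by (rule sum4_swap)
      also have "\<dots> = (\<Sum>i\<in>Basis. \<Sum>l\<in>Basis. \<Sum>j\<in>Basis. \<Sum>k\<in>Basis. T l i j k * K l (br (br i j) k))"
        by (rule sum4_swap)
      also have "\<dots> = ?b" by (rule sum.swap)
      finally show ?thesis .
    qed
    ultimately show ?thesis by simp
  qed
  moreover have "sum4 (\<lambda>i j k l. T i j k l * K k (br l (br i j))) = 0"
  proof -
    have "T i j k l * K k (br l (br i j)) = T i j l k * K k (br (br i j) l)" for i j k l
      using T_swap(3)[of i j k l] br_swap[of l "br i j"] by (simp add: linear_neg[OF lin2])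
    then have "sum4 (\<lambda>i j k l. T i j k l * K k (br l (br i j)))
      = sum4 (\<lambda>i j k l. T i j l k * K k (br (br i j) l))"
      by simp
    also have "\<dots> = sum4 (\<lambda>i j k l. T i j k l * K l (br (br i j) k))"
      by (rule sum4_swap)
    finally show ?thesis using z by simp
  qed
  ultimately show ?thesis by simp
qed

abbreviation tr :: "('v \<Rightarrow> 'v) \<Rightarrow> real" where
  "tr f \<equiv> \<Sum>m\<in>Basis. f m \<bullet> m"

lemma linear_AA: "linear (\<lambda>m. A x (A y m))" "linear (\<lambda>m. A x (A y (A z m)))"
  by (rule linearI; simp add: A_simps)+

text \<open>The cubic part of the Chern-Simons form. Subtracting the other cyclic order makes the
  trace of three factors alternating, as \<open>stokes\<close> requires; both halves then contribute
  equally.\<close>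

lemma sum4_T_tr3: "sum4 (\<lambda>i j k l. T i j k l * tr (\<lambda>m. A (br i j) (A k (A l m)))) = 0"
proof -
  let ?\<beta> = "\<lambda>x y z. tr (\<lambda>m. A x (A y (A z m))) - tr (\<lambda>m. A x (A z (A y m)))"
  have rot: "tr (\<lambda>m. A x (A y (A z m))) = tr (\<lambda>m. A y (A z (A x m)))" for x y z
    by (rule trace_commute[OF linear_A(1) linear_AA(1)])
  have "sum4 (\<lambda>i j k l. T i j k l * ?\<beta> (br i j) k l) = 0"
  proof (rule stokes)
    show "linear (\<lambda>x. ?\<beta> x y z)" for y z
      by (rule linearI)
         (simp_all add: A_simps inner_simps sum.distrib sum_distrib_left algebra_simps)
    show "?\<beta> y x z = - ?\<beta> x y z" for x y z
      using rot[of x y z] rot[of z y x] rot[of x z y] rot[of z x y] by simp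
  qed simp
  then have "sum4 (\<lambda>i j k l. T i j k l * tr (\<lambda>m. A (br i j) (A k (A l m))))
     - sum4 (\<lambda>i j k l. T i j k l * tr (\<lambda>m. A (br i j) (A l (A k m)))) = 0"
    by (simp only: right_diff_distrib sum_subtractf)
  moreover have "sum4 (\<lambda>i j k l. T i j k l * tr (\<lambda>m. A (br i j) (A l (A k m))))
     = - sum4 (\<lambda>i j k l. T i j k l * tr (\<lambda>m. A (br i j) (A k (A l m))))"
  proof -
    have "sum4 (\<lambda>i j k l. T i j k l * tr (\<lambda>m. A (br i j) (A l (A k m))))
      = sum4 (\<lambda>i j k l. T i j l k * tr (\<lambda>m. A (br i j) (A k (A l m))))"
      by (rule sum4_swap)
    also have "\<dots> = sum4 (\<lambda>i j k l. - (T i j k l * tr (\<lambda>m. A (br i j) (A k (A l m)))))"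
      by (intro sum.cong[OF refl], subst T_swap(3)) simp
    finally show ?thesis by (simp only: sum_negf)
  qed
  ultimately show ?thesis by simp
qed

text \<open>A trace is unchanged when its four factors are shifted cyclically, but a 4-cycle is an
  odd permutation and reverses the sign of \<open>T\<close>.\<close>

lemma sum4_T_tr4: "sum4 (\<lambda>i j k l. T i j k l * tr (\<lambda>m. A i (A j (A k (A l m))))) = 0"
proof -
  let ?f = "\<lambda>i j k l. tr (\<lambda>m. A i (A j (A k (A l m))))"
  have rot: "?f i j k l = ?f j k l i" for i j k l
    by (rule trace_commute[OF linear_A(1) linear_AA(2)])
  have "T i j k l * ?f i j k l = - (T j k l i * ?f j k l i)" for i j k l
    using rot[of i j k l] T_swap(1)[of j i k l] T_swap(2)[of j k i l] T_swap(3)[of j k l i] by simp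
  then have "sum4 (\<lambda>i j k l. T i j k l * ?f i j k l)
      = sum4 (\<lambda>i j k l. - (T j k l i * ?f j k l i))"
    by (intro sum.cong[OF refl])
  also have "\<dots> = - sum4 (\<lambda>i j k l. T j k l i * ?f j k l i)"
    by (simp only: sum_negf)
  also have "sum4 (\<lambda>i j k l. T j k l i * ?f j k l i) = sum4 (\<lambda>i j k l. T i j k l * ?f i j k l)"
    (is "?a = ?b")
  proof -
    have "?a = (\<Sum>j\<in>Basis. \<Sum>i\<in>Basis. \<Sum>k\<in>Basis. \<Sum>l\<in>Basis. T j k l i * ?f j k l i)"
      by (rule sum.swap)
    also have "\<dots> = (\<Sum>j\<in>Basis. \<Sum>k\<in>Basis. \<Sum>i\<in>Basis. \<Sum>l\<in>Basis. T j k l i * ?f j k l i)"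
      by (rule sum4_swap)
    also have "\<dots> = ?b"
      by (rule sum4_swap)
    finally show ?thesis .
  qed
  finally show ?thesis by simp
qed

text \<open>Contraction with \<open>T\<close> sees only alternating parts, so a commutator counts as
  twice one of its two products.\<close>

lemma sum4_T_antisym:
  assumes "\<And>i j k l. g i j k l = f i j k l - f j i k l"
  shows "sum4 (\<lambda>i j k l. T i j k l * g i j k l) = 2 * sum4 (\<lambda>i j k l. T i j k l * f i j k l)"
proof -
  have "sum4 (\<lambda>i j k l. T i j k l * f j i k l) = sum4 (\<lambda>i j k l. T j i k l * f i j k l)"
    by (rule sum.swap)
  also have "\<dots> = sum4 (\<lambda>i j k l. - (T i j k l * f i j k l))"
    by (intro sum.cong[OF refl], subst T_swap(1)) simp
  finally show ?thesis
    by (simp only: assms right_diff_distrib sum_subtractf sum_negf)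
qed

lemma sum4_T_antisym':
  assumes "\<And>i j k l. g i j k l = f i j k l - f i j l k"
  shows "sum4 (\<lambda>i j k l. T i j k l * g i j k l) = 2 * sum4 (\<lambda>i j k l. T i j k l * f i j k l)"
proof -
  have "sum4 (\<lambda>i j k l. T i j k l * f i j l k) = sum4 (\<lambda>i j k l. T i j l k * f i j k l)"
    by (rule sum4_swap)
  also have "\<dots> = sum4 (\<lambda>i j k l. - (T i j k l * f i j k l))"
    by (intro sum.cong[OF refl], subst T_swap(3)) simp
  finally show ?thesis
    by (simp only: assms right_diff_distrib sum_subtractf sum_negf)
qed

lemma sum4_T_swap_pairs:
  "sum4 (\<lambda>i j k l. T i j k l * f k l i j) = sum4 (\<lambda>i j k l. T i j k l * f i j k l)"
proof -
  have T: "T k l i j = T i j k l" for i j k l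
    using T_swap(2)[of k l i j] T_swap(1)[of k i l j] T_swap(3)[of i k l j] T_swap(2)[of i k j l]
    by linarith
  have "sum4 (\<lambda>i j k l. T i j k l * f k l i j)
     = (\<Sum>i\<in>Basis. \<Sum>k\<in>Basis. \<Sum>j\<in>Basis. \<Sum>l\<in>Basis. T i j k l * f k l i j)"
    by (rule sum4_swap)
  also have "\<dots> = (\<Sum>k\<in>Basis. \<Sum>i\<in>Basis. \<Sum>j\<in>Basis. \<Sum>l\<in>Basis. T i j k l * f k l i j)"
    by (rule sum.swap)
  also have "\<dots> = (\<Sum>k\<in>Basis. \<Sum>i\<in>Basis. \<Sum>l\<in>Basis. \<Sum>j\<in>Basis. T i j k l * f k l i j)"
    by (rule sum4_swap)
  also have "\<dots> = (\<Sum>k\<in>Basis. \<Sum>l\<in>Basis. \<Sum>i\<in>Basis. \<Sum>j\<in>Basis. T i j k l * f k l i j)"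
    by (rule sum4_swap)
  also have "\<dots> = sum4 (\<lambda>k l i j. T k l i j * f k l i j)"
    by (simp only: T)
  finally show ?thesis .
qed

text \<open>The Chern--Simons argument: \<open>tr (curv \<and> curv)\<close> is exact, so it pairs to zero with \<open>T\<close>;
  by the instanton equation the pairing is \<open>|curv|\<^sup>2\<close>.\<close>

theorem flat: "curv x y z = 0"
proof -
  let ?C = "\<lambda>i j m. A i (A j m) - A j (A i m)"
  let ?D = "\<lambda>i j m. A (br i j) m"
  have curv_eq: "curv i j = (\<lambda>m. ?C i j m - ?D i j m)" for i j
    by (simp add: curv_def fun_eq_iff)
  \<comment> \<open>With the curvature split into commutator part C and bracket part D, all four
    products pair to zero: CC by cyclicity of the trace, DC and DD by Stokes, CD by its symmetry
    with DC.\<close>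
  have CC: "sum4 (\<lambda>i j k l. T i j k l * tr (\<lambda>m. ?C i j (?C k l m))) = 0"
  proof -
    have "sum4 (\<lambda>i j k l. T i j k l * tr (\<lambda>m. ?C i j (?C k l m)))
      = 2 * sum4 (\<lambda>i j k l. T i j k l * tr (\<lambda>m. A i (A j (?C k l m))))"
      by (rule sum4_T_antisym) (simp add: inner_diff_left sum_subtractf)
    also have "sum4 (\<lambda>i j k l. T i j k l * tr (\<lambda>m. A i (A j (?C k l m))))
      = 2 * sum4 (\<lambda>i j k l. T i j k l * tr (\<lambda>m. A i (A j (A k (A l m)))))"
      by (rule sum4_T_antisym') (simp add: A_simps inner_diff_left sum_subtractf)
    finally show ?thesis by (simp only: sum4_T_tr4)
  qed
  have DC: "sum4 (\<lambda>i j k l. T i j k l * tr (\<lambda>m. ?D i j (?C k l m))) = 0"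
  proof -
    have "sum4 (\<lambda>i j k l. T i j k l * tr (\<lambda>m. ?D i j (?C k l m)))
      = 2 * sum4 (\<lambda>i j k l. T i j k l * tr (\<lambda>m. ?D i j (A k (A l m))))"
      by (rule sum4_T_antisym') (simp add: A_simps inner_diff_left sum_subtractf)
    then show ?thesis by (simp only: sum4_T_tr3)
  qed
  have CD: "sum4 (\<lambda>i j k l. T i j k l * tr (\<lambda>m. ?C i j (?D k l m))) = 0"
  proof -
    have "tr (\<lambda>m. ?C i j (?D k l m)) = tr (\<lambda>m. ?D k l (?C i j m))" for i j k l
      by (rule trace_commute) (rule linearI; simp add: A_simps algebra_simps)+
    then show ?thesis
      using sum4_T_swap_pairs[of "\<lambda>i j k l. tr (\<lambda>m. ?D i j (?C k l m))"] DC by simp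
  qed
  have DD: "sum4 (\<lambda>i j k l. T i j k l * tr (\<lambda>m. ?D i j (?D k l m))) = 0"
  proof (rule sum4_T_br_br[where K = "\<lambda>x y. tr (\<lambda>m. A x (A y m))"])
    show "linear (\<lambda>x. tr (\<lambda>m. A x (A y m)))" for y
      by (rule linearI) (simp_all add: A_simps inner_simps sum.distrib sum_distrib_left)
    show "tr (\<lambda>m. A x (A y m)) = tr (\<lambda>m. A y (A x m))" for x y
      by (rule trace_commute[OF linear_A(1) linear_A(1)])
  qed
  have "tr (\<lambda>m. curv i j (curv k l m)) = tr (\<lambda>m. ?C i j (?C k l m)) - tr (\<lambda>m. ?D i j (?C k l m))
      - tr (\<lambda>m. ?C i j (?D k l m)) + tr (\<lambda>m. ?D i j (?D k l m))" for i j k l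
    by (simp add: curv_eq A_simps inner_simps sum_subtractf sum.distrib)
  then have "sum4 (\<lambda>i j k l. T i j k l * tr (\<lambda>m. curv i j (curv k l m)))
     = sum4 (\<lambda>i j k l. T i j k l * tr (\<lambda>m. ?C i j (?C k l m)))
     - sum4 (\<lambda>i j k l. T i j k l * tr (\<lambda>m. ?D i j (?C k l m)))
     - sum4 (\<lambda>i j k l. T i j k l * tr (\<lambda>m. ?C i j (?D k l m)))
     + sum4 (\<lambda>i j k l. T i j k l * tr (\<lambda>m. ?D i j (?D k l m)))"
    by (simp only: right_diff_distrib distrib_left sum_subtractf sum.distrib)
  then have zero: "sum4 (\<lambda>i j k l. T i j k l * tr (\<lambda>m. curv i j (curv k l m))) = 0"
    by (simp only: CC DC CD DD)
  \<comment> \<open>The instanton equation collapses the sum over \<open>k\<close> and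
    \<open>l\<close>; skewness of the curvature turns the remaining trace into a squared
    norm.\<close>
  have inst: "(\<Sum>k\<in>Basis. \<Sum>l\<in>Basis. T i j k l * tr (\<lambda>m. curv i j (curv k l m)))
     = 2 * (\<Sum>m\<in>Basis. curv i j m \<bullet> curv i j m)" for i j
  proof -
    have "T i j k l * tr (\<lambda>m. curv i j (curv k l m))
       = (\<Sum>m\<in>Basis. - (T i j k l * (curv k l m \<bullet> curv i j m)))" for k l
      by (simp only: curv_trace) (simp add: sum_distrib_left sum_negf inner_commute)
    then have "(\<Sum>k\<in>Basis. \<Sum>l\<in>Basis. T i j k l * tr (\<lambda>m. curv i j (curv k l m)))
      = (\<Sum>k\<in>Basis. \<Sum>l\<in>Basis. \<Sum>m\<in>Basis. - (T i j k l * (curv k l m \<bullet> curv i j m)))"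
      by simp
    also have "\<dots> = (\<Sum>k\<in>Basis. \<Sum>m\<in>Basis. \<Sum>l\<in>Basis. - (T i j k l * (curv k l m \<bullet> curv i j m)))"
      by (rule sum.cong[OF refl], rule sum.swap)
    also have "\<dots> = (\<Sum>m\<in>Basis. \<Sum>k\<in>Basis. \<Sum>l\<in>Basis. - (T i j k l * (curv k l m \<bullet> curv i j m)))"
      by (rule sum.swap)
    also have "\<dots> = (\<Sum>m\<in>Basis. - (- 2 * (curv i j m \<bullet> curv i j m)))"
      by (simp only: sum_negf instanton')
    finally show ?thesis by (simp add: sum_distrib_left)
  qed
  have "(\<Sum>i\<in>Basis. \<Sum>j\<in>Basis. \<Sum>m\<in>Basis. curv i j m \<bullet> curv i j m) = 0"
    using zero by (simp only: inst flip: sum_distrib_left)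
  then have c0: "curv i j m = 0" if "i \<in> Basis" "j \<in> Basis" "m \<in> Basis" for i j m
    using that by (simp add: sum_nonneg_eq_0_iff sum_nonneg)
  have "curv i j = (\<lambda>z. 0)" if "i \<in> Basis" "j \<in> Basis" for i j
    by (rule linear_eq_stdbasis[OF linear_curv(1)]) (simp_all add: c0 that linear_zero)
  then have "curv i y z = 0" if "i \<in> Basis" for i y z
    using linear_eq_stdbasis[OF linear_curv(2)[of i z], of "\<lambda>_. 0"] that
    by (simp add: linear_zero fun_eq_iff)
  then show ?thesis
    using linear_eq_stdbasis[OF linear_curv(3)[of y z], of "\<lambda>_. 0"]
    by (simp add: linear_zero fun_eq_iff)
qed

end

section \<open>Flat metric Lie algebras\<close>

text \<open>Gram-Schmidt for an arbitrary form positive on the span. It serves both the trace form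
  on \<open>supp\<close> and the bilinear form of a definite 3-form.\<close>

lemma exists_orthonormal_set:
  fixes g :: "'a::real_vector \<Rightarrow> 'a \<Rightarrow> real"
  assumes "finite B" and "bilinear g" and sym: "\<And>x y. g x y = g y x"
    and pos: "\<And>x. x \<in> span B \<Longrightarrow> x \<noteq> 0 \<Longrightarrow> g x x > 0"
  shows "\<exists>F. finite F \<and> span F = span B \<and> (\<forall>x\<in>F. \<forall>y\<in>F. g x y = (if x = y then 1 else 0))"
  using assms(1) pos
proof (induction B)
  case empty
  show ?case by (rule exI[of _ "{}"]) simp
next
  case (insert b B)
  note g_simps = bilinear_lsub[OF assms(2)] bilinear_rsub[OF assms(2)] bilinear_lmul[OF assms(2)]
    bilinear_rmul[OF assms(2)]
  have "span B \<subseteq> span (insert b B)" by (rule span_mono) auto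
  then have "\<exists>F. finite F \<and> span F = span B \<and> (\<forall>x\<in>F. \<forall>y\<in>F. g x y = (if x = y then 1 else 0))"
    by (intro insert.IH insert.prems) auto
  then obtain F where F: "finite F" "span F = span B"
    and on: "\<forall>x\<in>F. \<forall>y\<in>F. g x y = (if x = y then 1 else 0)"
    by (elim exE conjE)
  note F = F on[rule_format]
  define u where "u = b - (\<Sum>f\<in>F. g b f *\<^sub>R f)"
  have uF: "g u f = 0" if "f \<in> F" for f
  proof -
    have "linear (\<lambda>x. g x f)" using assms(2) by (simp add: bilinear_def)
    then have "g (\<Sum>h\<in>F. g b h *\<^sub>R h) f = (\<Sum>h\<in>F. g b h * g h f)"
      by (simp add: linear_sum[of "\<lambda>x. g x f"] linear_scale[of "\<lambda>x. g x f"])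
    also have "\<dots> = (\<Sum>h\<in>F. if h = f then g b h else 0)"
      by (rule sum.cong) (auto simp: F(3) that)
    also have "\<dots> = g b f" using that F(1) by simp
    finally show ?thesis by (simp add: u_def g_simps)
  qed
  have s: "(\<Sum>f\<in>F. g b f *\<^sub>R f) \<in> span F"
    by (intro span_sum span_scale span_base)
  have "span (insert u F) = span (insert b F)"
    by (rule eq_span_insert_eq) (use s in \<open>simp add: u_def span_neg\<close>)
  then have span_u: "span (insert u F) = span (insert b B)"
    using F(2) by (simp add: span_insert)
  show ?case
  proof (cases "u = 0")
    case True
    then have "span F = span (insert b B)" using span_u by simp
    then show ?thesis using F by blast
  next
    case False
    have "u \<in> span (insert b B)" unfolding span_u[symmetric] by (rule span_base) simp
    then have p: "g u u > 0" using False by (rule insert.prems)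
    define c where "c = 1 / sqrt (g u u)"
    have c: "c \<noteq> 0" "c * c * g u u = 1"
      using p by (simp_all add: c_def)
    have "u \<notin> F" using uF[of u] p by auto
    have cu: "g (c *\<^sub>R u) f = 0" "g f (c *\<^sub>R u) = 0" if "f \<in> F" for f
      using uF[OF that] sym[of f u] by (simp_all add: g_simps)
    have "c *\<^sub>R u \<notin> F" using cu(1)[of "c *\<^sub>R u"] c(2) by (auto simp: g_simps)
    moreover have "g (c *\<^sub>R u) (c *\<^sub>R u) = 1" using c(2) by (simp add: g_simps)
    ultimately have "\<forall>x\<in>insert (c *\<^sub>R u) F. \<forall>y\<in>insert (c *\<^sub>R u) F. g x y = (if x = y then 1 else 0)"
      using cu F(3) by auto
    moreover have "span (insert (c *\<^sub>R u) F) = span (insert u F)"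
    proof -
      have "u = (1 / c) *\<^sub>R (c *\<^sub>R u)" using c(1) by simp
      then have "u \<in> span (insert (c *\<^sub>R u) F)"
        by (metis span_scale span_base insertI1)
      then show ?thesis
        unfolding span_eq by (auto intro: span_base span_scale)
    qed
    ultimately show ?thesis using F(1) span_u by (intro exI[of _ "insert (c *\<^sub>R u) F"]) auto
  qed
qed


context metric_connection
begin

section \<open>The kernel of a flat connection and its orthogonal complement\<close>

definition ker :: "'v set" where "ker = {x. \<forall>y. A x y = 0}"

definition supp :: "'v set" where "supp = {x. \<forall>y\<in>ker. x \<bullet> y = 0}"

lemma subspace_ker: "subspace ker"
  by (auto simp: ker_def subspace_def A_simps)

lemma subspace_supp: "subspace supp"
  by (auto simp: supp_def subspace_def inner_simps)

lemma ker_supp: "x \<in> ker \<Longrightarrow> x \<in> supp \<Longrightarrow> x = 0"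
  using inner_eq_zero_iff by (auto simp: supp_def)

lemma ker_supp_decomp: "\<exists>y\<in>supp. x - y \<in> ker"
proof -
  obtain y z where yz: "y \<in> span ker" "\<And>w. w \<in> span ker \<Longrightarrow> orthogonal z w" "x = y + z"
    using orthogonal_subspace_decomp_exists[of ker x] by blast
  then have "z \<in> supp" "x - z \<in> ker"
    using subspace_ker by (auto simp: supp_def orthogonal_def span_eq_iff[THEN iffD2])
  then show ?thesis by blast
qed

context
  assumes flat: "\<And>x y z. curv x y z = 0"
begin

lemma A_br: "A (br x y) z = A x (A y z) - A y (A x z)"
  using flat[of x y z] by (simp add: curv_def algebra_simps)

text \<open>For \<open>y\<close> in the kernel, \<open>br x y = A x y\<close>, and flatness makes
  \<open>A (br x y)\<close> the commutator of \<open>A x\<close> with zero.\<close>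

lemma A_ker: "y \<in> ker \<Longrightarrow> A x y \<in> ker"
  using A_br[of x y] by (simp add: ker_def torsion_free A_simps)

lemma A_supp: "y \<in> supp \<Longrightarrow> A x y \<in> supp"
  using A_ker by (auto simp: supp_def skew)

text \<open>The Casimir operator of the invariant inner product \<open>-tr (A x \<circ> A y)\<close> on \<open>supp\<close>
  trivialises the cocycle \<open>x \<mapsto> x\<close>.\<close>

lemma A_supp_supp:
  assumes "x \<in> supp" and "y \<in> supp"
  shows "A x y = 0"
proof -
  define K where "K x y = (\<Sum>m\<in>Basis. A x m \<bullet> A y m)" for x y
  have bil: "bilinear K"
    unfolding bilinear_def K_def
    by (intro conjI allI linearI) (simp_all add: A_simps inner_simps sum.distrib sum_distrib_left)
  have sym: "K x y = K y x" for x y by (simp add: K_def inner_commute)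
  have inv: "K (br x y) z = - K y (br x z)" for x y z
  proof -
    have "(\<Sum>m\<in>Basis. A y (A x m) \<bullet> A z m) = (\<Sum>m\<in>Basis. A y m \<bullet> A z (- A x m))"
      by (rule sum_Basis_adjoint[where B = "\<lambda>p q. A y p \<bullet> A z q"])
         (auto intro!: linearI simp: A_simps inner_simps skew)
    then show ?thesis
      by (simp add: K_def A_br A_simps inner_simps sum_subtractf sum_negf skew[of x])
  qed
  have pos: "K x x > 0" if "x \<in> supp" "x \<noteq> 0" for x
  proof (rule ccontr)
    assume "\<not> K x x > 0"
    then have "K x x = 0" by (simp add: K_def sum_nonneg order_antisym)
    then have "\<forall>m\<in>Basis. A x m = 0" by (simp add: K_def sum_nonneg_eq_0_iff)
    then have "A x = (\<lambda>_. 0)"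
      by (intro linear_eq_stdbasis[OF linear_A(1)]) (auto simp: linear_zero)
    then have "x \<in> ker" by (simp add: ker_def)
    then show False using ker_supp that by blast
  qed
  obtain B where B: "B \<subseteq> supp" "independent B" "span B = supp"
    using maximal_independent_subset[of supp] subspace_supp
    by (metis span_minimal subset_antisym)
  have "finite B" using B(2) independent_bound by blast
  then obtain F where F: "finite F" "span F = supp"
    "\<And>x y. x \<in> F \<Longrightarrow> y \<in> F \<Longrightarrow> K x y = (if x = y then 1 else 0)"
    using exists_orthonormal_set[OF _ bil sym] pos B(3) by metis
  have Fs: "f \<in> supp" if "f \<in> F" for f using F(2) that span_base by blast
  have expand: "v = (\<Sum>f\<in>F. K v f *\<^sub>R f)" if "v \<in> supp" for v
    using that unfolding F(2)[symmetric]
  proof (induction rule: span_induct_alt)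
    case base
    then show ?case by (simp add: bilinear_lzero[OF bil])
  next
    case (step c h v)
    have "(\<Sum>f\<in>F. K h f *\<^sub>R f) = (\<Sum>f\<in>F. if h = f then f else 0)"
      by (rule sum.cong) (auto simp: F(3) step(1))
    also have "\<dots> = h" using F(1) step(1) by simp
    finally show ?case using step(2)
      by (simp add: bilinear_ladd[OF bil] bilinear_lmul[OF bil] scaleR_add_left sum.distrib
          flip: scaleR_scaleR scaleR_sum_right)
  qed
  have br_supp: "br x y \<in> supp" if "x \<in> supp" "y \<in> supp" for x y
    using that A_supp subspace_supp by (simp add: torsion_free subspace_diff)
  define w where "w = (\<Sum>f\<in>F. A f f)"
  have w: "w \<in> supp"
    unfolding w_def using subspace_supp A_supp Fs by (intro subspace_sum) auto
  have casimir: "A x w = (\<Sum>f\<in>F. A f (A f x))" if x: "x \<in> supp" for x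
  proof -
    have e: "br x f = (\<Sum>h\<in>F. K (br x f) h *\<^sub>R h)" if "f \<in> F" for f
      by (rule expand) (simp add: br_supp Fs that x)
    have "(\<Sum>f\<in>F. A (br x f) f) = (\<Sum>f\<in>F. \<Sum>h\<in>F. K (br x f) h *\<^sub>R A h f)"
    proof (rule sum.cong[OF refl])
      fix f assume "f \<in> F"
      then show "A (br x f) f = (\<Sum>h\<in>F. K (br x f) h *\<^sub>R A h f)"
        by (subst e) (simp_all add: linear_sum[OF linear_A(2)] A_simps)
    qed
    also have "\<dots> = (\<Sum>f\<in>F. \<Sum>h\<in>F. K (br x h) f *\<^sub>R A f h)"
      by (rule sum.swap)
    \<comment> \<open>Invariance of \<open>K\<close> makes the structure constants K([x,f],h) skew
      in \<open>f\<close> and \<open>h\<close>, so the two sums containing a bracket cancel.\<close>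
    also have "\<dots> = - (\<Sum>f\<in>F. \<Sum>h\<in>F. K (br x f) h *\<^sub>R A f h)"
    proof -
      have "K (br x h) f = - K (br x f) h" for f h
        using inv[of x h f] sym[of h "br x f"] by simp
      then have "(\<Sum>f\<in>F. \<Sum>h\<in>F. K (br x h) f *\<^sub>R A f h) = (\<Sum>f\<in>F. \<Sum>h\<in>F. - (K (br x f) h *\<^sub>R A f h))"
        by (intro sum.cong[OF refl]) (metis scaleR_minus_left)
      then show ?thesis by (simp only: sum_negf)
    qed
    also have "(\<Sum>f\<in>F. \<Sum>h\<in>F. K (br x f) h *\<^sub>R A f h) = (\<Sum>f\<in>F. A f (br x f))"
    proof (rule sum.cong[OF refl])
      fix f assume "f \<in> F"
      then show "(\<Sum>h\<in>F. K (br x f) h *\<^sub>R A f h) = A f (br x f)"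
        by (subst (2) e) (simp_all add: linear_sum[OF linear_A(1)] A_simps)
    qed
    finally have z: "(\<Sum>f\<in>F. A (br x f) f) + (\<Sum>f\<in>F. A f (br x f)) = 0" by simp
    have "A x (A f f) = A f (A f x) + A f (br x f) + A (br x f) f" for f
      using A_br[of x f f] by (simp add: torsion_free A_simps)
    then have "A x w = (\<Sum>f\<in>F. A f (A f x)) + (\<Sum>f\<in>F. A f (br x f)) + (\<Sum>f\<in>F. A (br x f) f)"
      by (simp add: w_def linear_sum[OF linear_A(1)] sum.distrib)
    then show ?thesis using z by (simp add: algebra_simps)
  qed
  \<comment> \<open>The Casimir operator is a sum of squares of skew maps, so its quadratic form at
    \<open>x\<close> is minus the sum of the squared norms of the \<open>A f x\<close>.\<close>
  have vanish: "A f x = 0" if "A x w \<bullet> x = 0" "x \<in> supp" "f \<in> F" for f x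
  proof -
    have "(\<Sum>f\<in>F. A f x \<bullet> A f x) = 0"
      using that(1) by (simp add: casimir[OF that(2)] inner_sum_left skew sum_negf)
    then show ?thesis using F(1) that(3) by (simp add: sum_nonneg_eq_0_iff)
  qed
  have all: "A x v = 0" if "x \<in> supp" "\<And>f. f \<in> F \<Longrightarrow> A f v = 0" for x v
    by (subst expand[OF that(1)]) (simp add: linear_sum[OF linear_A(2)] A_simps that(2))
  \<comment> \<open>Taking \<open>x = w\<close> first, where skewness gives
    \<open>A w w \<bullet> w = 0\<close>, yields \<open>A f w = 0\<close> on \<open>F\<close> and
    hence \<open>A x w = 0\<close> on \<open>supp\<close>. After that \<open>vanish\<close> applies
    to every vector of \<open>supp\<close>.\<close>
  have "A x w = 0" if "x \<in> supp" for x
    using all[OF that, of w] vanish[of w] w by simp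
  then show ?thesis
    using all vanish assms by (metis inner_zero_left)
qed

end

end

section \<open>The cross product on seven-dimensional space\<close>

lemma exhaust_7:
  fixes x :: 7
  shows "x = 1 \<or> x = 2 \<or> x = 3 \<or> x = 4 \<or> x = 5 \<or> x = 6 \<or> x = 7"
proof (induct x)
  case (of_int z)
  then have "z = 0 \<or> z = 1 \<or> z = 2 \<or> z = 3 \<or> z = 4 \<or> z = 5 \<or> z = 6" by (simp, arith)
  then show ?case by auto
qed

lemma forall_7: "(\<forall>i::7. P i) \<longleftrightarrow> P 1 \<and> P 2 \<and> P 3 \<and> P 4 \<and> P 5 \<and> P 6 \<and> P 7"
  by (metis exhaust_7)

lemma UNIV_7: "UNIV = {1, 2, 3, 4, 5, 6, 7 :: 7}"
  using exhaust_7 by blast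

abbreviation ax :: "7 \<Rightarrow> real^7" where
  "ax k \<equiv> axis k 1"

lemma sum_7: "sum f (UNIV :: 7 set) = f 1 + f 2 + f 3 + f 4 + f 5 + f 6 + f 7"
  unfolding UNIV_7 by (simp add: ac_simps)

lemma inner_7: "(x :: real^7) \<bullet> y = x $ 1 * y $ 1 + x $ 2 * y $ 2 + x $ 3 * y $ 3 + x $ 4 * y $ 4
    + x $ 5 * y $ 5 + x $ 6 * y $ 6 + x $ 7 * y $ 7"
  by (simp add: inner_vec_def sum_7)

lemma vec_eq_7: "(x :: real^7) = y \<longleftrightarrow> x $ 1 = y $ 1 \<and> x $ 2 = y $ 2 \<and> x $ 3 = y $ 3
    \<and> x $ 4 = y $ 4 \<and> x $ 5 = y $ 5 \<and> x $ 6 = y $ 6 \<and> x $ 7 = y $ 7"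
  by (simp add: vec_eq_iff forall_7)

text \<open>The cross product of the 3-form
  \<open>e\<^bsup>123\<^esup> + e\<^bsup>145\<^esup> + e\<^bsup>167\<^esup> + e\<^bsup>246\<^esup> - e\<^bsup>257\<^esup> - e\<^bsup>347\<^esup> - e\<^bsup>356\<^esup>\<close>. In the index type,
  \<open>7 = 0\<close>.\<close>

definition cross7 :: "real^7 \<Rightarrow> real^7 \<Rightarrow> real^7" where
  "cross7 x y = (\<chi> m.
     if m = 1 then (x $ 2 * y $ 3 - x $ 3 * y $ 2) + (x $ 4 * y $ 5 - x $ 5 * y $ 4)
         + (x $ 6 * y $ 7 - x $ 7 * y $ 6)
     else if m = 2 then (x $ 3 * y $ 1 - x $ 1 * y $ 3) + (x $ 4 * y $ 6 - x $ 6 * y $ 4)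
         + (x $ 7 * y $ 5 - x $ 5 * y $ 7)
     else if m = 3 then (x $ 1 * y $ 2 - x $ 2 * y $ 1) + (x $ 7 * y $ 4 - x $ 4 * y $ 7)
         + (x $ 6 * y $ 5 - x $ 5 * y $ 6)
     else if m = 4 then (x $ 5 * y $ 1 - x $ 1 * y $ 5) + (x $ 6 * y $ 2 - x $ 2 * y $ 6)
         + (x $ 3 * y $ 7 - x $ 7 * y $ 3)
     else if m = 5 then (x $ 1 * y $ 4 - x $ 4 * y $ 1) + (x $ 2 * y $ 7 - x $ 7 * y $ 2)
         + (x $ 3 * y $ 6 - x $ 6 * y $ 3)
     else if m = 6 then (x $ 7 * y $ 1 - x $ 1 * y $ 7) + (x $ 2 * y $ 4 - x $ 4 * y $ 2)
         + (x $ 5 * y $ 3 - x $ 3 * y $ 5)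
     else (x $ 1 * y $ 6 - x $ 6 * y $ 1) + (x $ 5 * y $ 2 - x $ 2 * y $ 5)
         + (x $ 4 * y $ 3 - x $ 3 * y $ 4))"

lemma cross7_nth [simp]:
  "cross7 x y $ 1 = (x $ 2 * y $ 3 - x $ 3 * y $ 2) + (x $ 4 * y $ 5 - x $ 5 * y $ 4)
      + (x $ 6 * y $ 7 - x $ 7 * y $ 6)"
  "cross7 x y $ 2 = (x $ 3 * y $ 1 - x $ 1 * y $ 3) + (x $ 4 * y $ 6 - x $ 6 * y $ 4)
      + (x $ 7 * y $ 5 - x $ 5 * y $ 7)"
  "cross7 x y $ 3 = (x $ 1 * y $ 2 - x $ 2 * y $ 1) + (x $ 7 * y $ 4 - x $ 4 * y $ 7)
      + (x $ 6 * y $ 5 - x $ 5 * y $ 6)"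
  "cross7 x y $ 4 = (x $ 5 * y $ 1 - x $ 1 * y $ 5) + (x $ 6 * y $ 2 - x $ 2 * y $ 6)
      + (x $ 3 * y $ 7 - x $ 7 * y $ 3)"
  "cross7 x y $ 5 = (x $ 1 * y $ 4 - x $ 4 * y $ 1) + (x $ 2 * y $ 7 - x $ 7 * y $ 2)
      + (x $ 3 * y $ 6 - x $ 6 * y $ 3)"
  "cross7 x y $ 6 = (x $ 7 * y $ 1 - x $ 1 * y $ 7) + (x $ 2 * y $ 4 - x $ 4 * y $ 2)
      + (x $ 5 * y $ 3 - x $ 3 * y $ 5)"
  "cross7 x y $ 7 = (x $ 1 * y $ 6 - x $ 6 * y $ 1) + (x $ 5 * y $ 2 - x $ 2 * y $ 5)
      + (x $ 4 * y $ 3 - x $ 3 * y $ 4)"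
  by (simp_all add: cross7_def)

lemma bilinear_cross7: "bilinear cross7"
  unfolding bilinear_def by (intro conjI allI linearI) (simp_all add: vec_eq_7 algebra_simps)

lemmas cross7_simps = bilinear_ladd[OF bilinear_cross7] bilinear_radd[OF bilinear_cross7]
  bilinear_lsub[OF bilinear_cross7] bilinear_rsub[OF bilinear_cross7]
  bilinear_lmul[OF bilinear_cross7] bilinear_rmul[OF bilinear_cross7]
  bilinear_lneg[OF bilinear_cross7] bilinear_rneg[OF bilinear_cross7]
  bilinear_lzero[OF bilinear_cross7] bilinear_rzero[OF bilinear_cross7]

lemma cross7_swap: "cross7 y x = - cross7 x y"
  by (simp add: vec_eq_7 algebra_simps)

lemma cross7_skew: "cross7 x y \<bullet> z = - (y \<bullet> cross7 x z)"
  by (simp add: inner_7 algebra_simps)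

lemma cross7_self [simp]: "cross7 x x = 0"
  by (simp add: vec_eq_7)

lemma cross7_cross7: "cross7 x (cross7 x y) = (x \<bullet> y) *\<^sub>R x - (x \<bullet> x) *\<^sub>R y"
  by (simp add: vec_eq_7 inner_7) (intro conjI; algebra)

text \<open>Polarisation of \<open>cross7_cross7\<close>; for products of three vectors it stands in
  for associativity.\<close>

lemma cross7_anticommute:
  "cross7 x (cross7 z y) + cross7 z (cross7 x y) = (x \<bullet> y) *\<^sub>R z + (z \<bullet> y) *\<^sub>R x - (2 * (x \<bullet> z))
      *\<^sub>R y"
  using cross7_cross7[of "x + z" y] cross7_cross7[of x y] cross7_cross7[of z y]
  by (simp add: cross7_simps inner_simps inner_commute algebra_simps)

section \<open>Orthonormal frames adapted to the cross product\<close>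

lemma orthonormal_7_eq_0:
  fixes e :: "7 \<Rightarrow> real^7"
  assumes e: "\<And>i j. e i \<bullet> e j = (if i = j then 1 else 0)" and x: "\<And>i. x \<bullet> e i = 0"
  shows "x = 0"
proof -
  have "inj e"
    using e by (metis injI zero_neq_one)
  then have "card (range e) = 7" by (simp add: card_image)
  have "pairwise orthogonal (range e)"
    using e by (auto simp: pairwise_def orthogonal_def)
  moreover have "0 \<notin> range e"
    using e by (metis imageE inner_zero_left zero_neq_one)
  ultimately have "independent (range e)"
    by (intro pairwise_orthogonal_independent)
  with \<open>card (range e) = 7\<close> have "UNIV \<subseteq> span (range e)"
    by (subst card_eq_dim[symmetric]) simp_all
  then have "orthogonal x x"
    by (intro orthogonal_to_span[of x "range e"]) (auto simp: orthogonal_def x inner_commute)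
  then show ?thesis by (simp add: orthogonal_def)
qed

lemma exists_unit_orthogonal:
  fixes S :: "(real^7) set"
  assumes "finite S" and "card S < 7"
  obtains v where "v \<bullet> v = 1" and "\<And>x. x \<in> S \<Longrightarrow> v \<bullet> x = 0"
proof -
  have "dim S < DIM(real^7)" using dim_le_card'[OF assms(1)] assms(2) by simp
  then obtain w where w: "w \<noteq> 0" "\<And>x. x \<in> span S \<Longrightarrow> orthogonal w x"
    by (metis orthogonal_to_subspace_exists span_mono)
  show ?thesis
  proof
    show "(w /\<^sub>R norm w) \<bullet> (w /\<^sub>R norm w) = 1"
      using w(1) by (simp add: dot_square_norm power2_eq_square)
    show "(w /\<^sub>R norm w) \<bullet> x = 0" if "x \<in> S" for x
      using w(2)[OF span_base[OF that]] by (simp add: orthogonal_def)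
  qed
qed

text \<open>Cayley triples of the octonions: \<open>e1\<close>, \<open>e2\<close> and their product
  are the imaginary units of a quaternion subalgebra, whose orthogonal complement is its product
  with \<open>v\<close>. A derivation is determined by its values on such a triple.\<close>

locale associative_frame =
  fixes e1 e2 v :: "real^7"
  assumes unit: "e1 \<bullet> e1 = 1" "e2 \<bullet> e2 = 1" "v \<bullet> v = 1"
    and orth: "e1 \<bullet> e2 = 0" "v \<bullet> e1 = 0" "v \<bullet> e2 = 0" "v \<bullet> cross7 e1 e2 = 0"
begin

abbreviation "e3 \<equiv> cross7 e1 e2"

lemma orth': "e2 \<bullet> e1 = 0" "e1 \<bullet> v = 0" "e2 \<bullet> v = 0" "e3 \<bullet> v = 0"
  using orth by (simp_all add: inner_commute)

lemma e3: "e3 \<bullet> e1 = 0" "e3 \<bullet> e2 = 0" "e1 \<bullet> e3 = 0" "e2 \<bullet> e3 = 0" "e3 \<bullet> e3 = 1"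
proof -
  show "e3 \<bullet> e1 = 0" by (simp add: cross7_skew)
  then show "e1 \<bullet> e3 = 0" by (simp add: inner_commute)
  show "e3 \<bullet> e2 = 0" by (simp add: cross7_swap[of e1 e2] cross7_skew[of e2 e1])
  then show "e2 \<bullet> e3 = 0" by (simp add: inner_commute)
  show "e3 \<bullet> e3 = 1"
    by (simp add: cross7_skew[of e1 e2 e3] cross7_cross7 inner_diff_right unit orth)
qed

lemma cross_e13: "cross7 e1 e3 = - e2"
  by (simp add: cross7_cross7 unit orth)

lemma cross_e23: "cross7 e2 e3 = e1"
  using cross7_cross7[of e2 e1] by (simp add: cross7_swap[of e1 e2] cross7_simps unit orth')

lemma cross_cross:
  "cross7 e1 (cross7 e1 v) = - v" "cross7 e2 (cross7 e2 v) = - v" "cross7 e3 (cross7 e3 v) = - v"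
  "cross7 e1 (cross7 e2 v) = - cross7 e3 v" "cross7 e2 (cross7 e1 v) = cross7 e3 v"
  "cross7 e1 (cross7 e3 v) = cross7 e2 v" "cross7 e3 (cross7 e1 v) = - cross7 e2 v"
  "cross7 e2 (cross7 e3 v) = - cross7 e1 v" "cross7 e3 (cross7 e2 v) = cross7 e1 v"
proof -
  show "cross7 e1 (cross7 e1 v) = - v" "cross7 e2 (cross7 e2 v) = - v" "cross7 e3 (cross7 e3 v) =
      - v"
    by (simp_all add: cross7_cross7 unit orth orth' e3)
  \<comment> \<open>Two anticommutations give a(bv) = -(ab)v. This sign is the failure of
    associativity, and it reverses the quaternion multiplication on the four-space.\<close>
  have *: "cross7 a (cross7 b v) = - cross7 (cross7 a b) v" if "a \<bullet> b = 0" "a \<bullet> v = 0" "b \<bullet> v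
      = 0" "v \<bullet> a = 0" for a b
    using cross7_anticommute[of a b v] cross7_anticommute[of a v b] that
    by (simp add: cross7_swap[of v b] cross7_swap[of v "cross7 a b"] cross7_simps inner_commute)
      (metis minus_minus)
  show "cross7 e1 (cross7 e2 v) = - cross7 e3 v"
    by (rule *) (simp_all add: orth orth' e3)
  show "cross7 e2 (cross7 e1 v) = cross7 e3 v"
    by (subst *) (simp_all add: orth orth' e3 cross7_swap[of e2 e1] cross7_simps)
  show "cross7 e1 (cross7 e3 v) = cross7 e2 v"
    by (subst *) (simp_all add: orth orth' e3 cross_e13 cross7_simps)
  show "cross7 e3 (cross7 e1 v) = - cross7 e2 v"
    by (subst *) (simp_all add: orth orth' e3 cross7_swap[of e3 e1] cross_e13 cross7_simps)
  show "cross7 e2 (cross7 e3 v) = - cross7 e1 v"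
    by (subst *) (simp_all add: orth orth' e3 cross_e23)
  show "cross7 e3 (cross7 e2 v) = cross7 e1 v"
    by (subst *) (simp_all add: orth orth' e3 cross7_swap[of e3 e2] cross_e23 cross7_simps)
qed

definition frame :: "7 \<Rightarrow> real^7" where
  "frame i = (if i = 1 then e1 else if i = 2 then e2 else if i = 3 then e3 else if i = 4 then v
     else if i = 5 then cross7 e1 v else if i = 6 then cross7 e2 v else cross7 e3 v)"

lemma frame_orthonormal: "frame i \<bullet> frame j = (if i = j then 1 else 0)"
proof -
  have v: "cross7 a v \<bullet> v = 0" for a
    using cross7_skew[of a v v] by (simp add: inner_commute)
  have c: "cross7 a v \<bullet> b = - (v \<bullet> cross7 a b)" for a b
    by (rule cross7_skew)
  have v': "v \<bullet> cross7 a v = 0" for a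
    using v by (simp add: inner_commute)
  have l: "cross7 e1 v \<bullet> e1 = 0" "cross7 e1 v \<bullet> e2 = 0" "cross7 e1 v \<bullet> e3 = 0"
    "cross7 e2 v \<bullet> e1 = 0" "cross7 e2 v \<bullet> e2 = 0" "cross7 e2 v \<bullet> e3 = 0"
    "cross7 e3 v \<bullet> e1 = 0" "cross7 e3 v \<bullet> e2 = 0" "cross7 e3 v \<bullet> e3 = 0"
    by (simp_all add: c cross_e13 cross_e23 cross7_swap[of e2 e1] cross7_swap[of e3 e1]
        cross7_swap[of e3 e2] orth)
  have m: "cross7 e1 v \<bullet> cross7 e1 v = 1" "cross7 e1 v \<bullet> cross7 e2 v = 0" "cross7 e1 v \<bullet> cross7 e3
      v = 0"
    "cross7 e2 v \<bullet> cross7 e1 v = 0" "cross7 e2 v \<bullet> cross7 e2 v = 1" "cross7 e2 v \<bullet> cross7 e3 v = 0"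
    "cross7 e3 v \<bullet> cross7 e1 v = 0" "cross7 e3 v \<bullet> cross7 e2 v = 0" "cross7 e3 v \<bullet> cross7 e3 v = 1"
    by (simp_all only: c cross_cross) (simp_all add: v' unit)
  have l': "e1 \<bullet> cross7 e1 v = 0" "e2 \<bullet> cross7 e1 v = 0" "e3 \<bullet> cross7 e1 v = 0"
    "e1 \<bullet> cross7 e2 v = 0" "e2 \<bullet> cross7 e2 v = 0" "e3 \<bullet> cross7 e2 v = 0"
    "e1 \<bullet> cross7 e3 v = 0" "e2 \<bullet> cross7 e3 v = 0" "e3 \<bullet> cross7 e3 v = 0"
    using l by (simp_all add: inner_commute)
  have "\<forall>i j. frame i \<bullet> frame j = (if i = j then 1 else 0)"
    unfolding forall_7 by (simp add: frame_def unit orth orth' e3 v v' l l' m)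
  then show ?thesis by blast
qed

lemma frame_eq_0:
  assumes "x \<bullet> e1 = 0" "x \<bullet> e2 = 0" "x \<bullet> e3 = 0" "x \<bullet> v = 0"
    "x \<bullet> cross7 e1 v = 0" "x \<bullet> cross7 e2 v = 0" "x \<bullet> cross7 e3 v = 0"
  shows "x = 0"
  by (rule orthonormal_7_eq_0[OF frame_orthonormal]) (simp add: frame_def assms)

lemma frame_expand:
  assumes "x \<bullet> e1 = 0" "x \<bullet> e2 = 0" "x \<bullet> e3 = 0" "x \<bullet> v = 0"
  shows "x = (x \<bullet> cross7 e1 v) *\<^sub>R cross7 e1 v + (x \<bullet> cross7 e2 v) *\<^sub>R cross7 e2 v
     + (x \<bullet> cross7 e3 v) *\<^sub>R cross7 e3 v" (is "x = ?y")
proof -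
  have f: "frame 5 = cross7 e1 v" "frame 6 = cross7 e2 v" "frame 7 = cross7 e3 v"
    by (simp_all add: frame_def)
  have "\<forall>i. (x - ?y) \<bullet> frame i = 0"
    unfolding f[symmetric] forall_7 inner_diff_left inner_add_left inner_scaleR_left
        frame_orthonormal
    by (simp add: frame_def assms)
  then have "x - ?y = 0"
    by (intro orthonormal_7_eq_0[OF frame_orthonormal]) blast
  then show ?thesis by simp
qed

end


section \<open>Flat connections by derivations of the cross product\<close>

locale flat_G2_connection = metric_connection br A for br A :: "real^7 \<Rightarrow> real^7 \<Rightarrow> real^7" +
  assumes flat: "curv x y z = 0"
    and derivation: "A v (cross7 x y) = cross7 (A v x) y + cross7 x (A v y)"
begin

lemmas A_supp_supp' = A_supp_supp[OF flat]

text \<open>Let \<open>s\<close> be the \<open>supp\<close>-component of \<open>z\<close>. On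
  \<open>ker\<close>, \<open>A s y = A z y = A y z = 0\<close>; on \<open>supp\<close> it vanishes
  by \<open>A_supp_supp\<close>. So \<open>A z = 0\<close>, and centrality exchanges the two
  arguments.\<close>

lemma A_center: "z \<in> lie_center br \<Longrightarrow> A x z = 0"
proof -
  assume z: "z \<in> lie_center br"
  then have "A z y = A y z" for y
    using torsion_free[of z y] by (simp add: lie_center_def)
  obtain s where s: "s \<in> supp" "z - s \<in> ker" using ker_supp_decomp by blast
  have "A s y = 0" if "y \<in> ker" for y
    using that s(2) torsion_free[of z y] z by (simp add: ker_def lie_center_def A_simps)
  moreover have "A s y = 0" if "y \<in> supp" for y
    using that s(1) by (rule A_supp_supp'[rotated])
  ultimately have "A s y = 0" for y
    using ker_supp_decomp[of y] by (metis A_simps(4) right_minus_eq)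
  then have "A z x = 0"
    using s(2) by (simp add: ker_def A_simps)
  then show "A x z = 0" using \<open>A z x = A x z\<close> by simp
qed

text \<open>The derivation rule carries the value at \<open>v\<close> to the products of
  \<open>v\<close> with \<open>e1\<close>, \<open>e2\<close>, \<open>e3\<close>. The parameters
  \<open>a\<close>, \<open>b\<close>, \<open>c\<close> are the coordinates of an imaginary
  quaternion.\<close>

lemma A_determined:
  assumes fr: "associative_frame e1 e2 v"
    and k: "A y e1 = 0" "A y e2 = 0"
    and abc: "a = A y v \<bullet> cross7 e1 v" "b = A y v \<bullet> cross7 e2 v" "c = A y v \<bullet> cross7 (cross7 e1
        e2) v"
  defines "e3 \<equiv> cross7 e1 e2"
  shows "A y e3 = 0"
    and "A y v = a *\<^sub>R cross7 e1 v + b *\<^sub>R cross7 e2 v + c *\<^sub>R cross7 e3 v"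
    and "A y (cross7 e1 v) = - a *\<^sub>R v + c *\<^sub>R cross7 e2 v - b *\<^sub>R cross7 e3 v"
    and "A y (cross7 e2 v) = - b *\<^sub>R v - c *\<^sub>R cross7 e1 v + a *\<^sub>R cross7 e3 v"
    and "A y (cross7 e3 v) = - c *\<^sub>R v + b *\<^sub>R cross7 e1 v - a *\<^sub>R cross7 e2 v"
proof -
  interpret associative_frame e1 e2 v by (rule fr)
  show k3: "A y e3 = 0" by (simp add: e3_def derivation k cross7_simps)
  show v: "A y v = a *\<^sub>R cross7 e1 v + b *\<^sub>R cross7 e2 v + c *\<^sub>R cross7 e3 v"
    unfolding abc e3_def
    by (rule frame_expand) (simp_all add: skew k k3[unfolded e3_def])
  show "A y (cross7 e1 v) = - a *\<^sub>R v + c *\<^sub>R cross7 e2 v - b *\<^sub>R cross7 e3 v"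
    "A y (cross7 e2 v) = - b *\<^sub>R v - c *\<^sub>R cross7 e1 v + a *\<^sub>R cross7 e3 v"
    "A y (cross7 e3 v) = - c *\<^sub>R v + b *\<^sub>R cross7 e1 v - a *\<^sub>R cross7 e2 v"
    by (simp_all add: derivation k k3 v cross7_simps cross_cross[folded e3_def])
qed

lemma A_eq_0_frame:
  assumes fr: "associative_frame e1 e2 v"
    and "A y e1 = 0" "A y e2 = 0" "A y v = 0"
  shows "A y x = 0"
proof -
  interpret associative_frame e1 e2 v by (rule fr)
  note d = A_determined[OF fr assms(2,3) refl refl refl]
  show ?thesis
    by (rule frame_eq_0) (simp_all add: skew assms d)
qed

end

context flat_G2_connection
begin

text \<open>An imaginary quaternion of unit norm squares to -1; the norm is read off from its value
  at \<open>v\<close>.\<close>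

lemma A_square:
  assumes fr: "associative_frame e1 e2 v"
    and k: "A y e1 = 0" "A y e2 = 0"
    and nv: "A y v \<bullet> A y v = 1"
    and w: "w \<bullet> e1 = 0" "w \<bullet> e2 = 0" "w \<bullet> cross7 e1 e2 = 0"
  shows "A y (A y w) = - w"
proof -
  interpret associative_frame e1 e2 v by (rule fr)
  define a b c where abc: "a = A y v \<bullet> cross7 e1 v" "b = A y v \<bullet> cross7 e2 v" "c
      = A y v \<bullet> cross7 e3 v"
  note d = A_determined[OF fr k abc]
  have "A y v \<bullet> A y v = a * a + b * b + c * c"
    by (subst (2) d(2)) (simp add: inner_add_right abc)
  then have n: "a * a + b * b + c * c = 1" using nv by simp
  have sc: "(a * a) *\<^sub>R u + ((b * b) *\<^sub>R u + (c * c) *\<^sub>R u) = u" for u :: "real^7"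
    using n by (simp add: add.assoc flip: scaleR_add_left)
  have "A y (A y v) = - ((a * a) *\<^sub>R v + ((b * b) *\<^sub>R v + (c * c) *\<^sub>R v))"
    "A y (A y (cross7 e1 v)) = - ((a * a) *\<^sub>R cross7 e1 v + ((b * b) *\<^sub>R cross7 e1 v
        + (c * c) *\<^sub>R cross7 e1 v))"
    "A y (A y (cross7 e2 v)) = - ((a * a) *\<^sub>R cross7 e2 v + ((b * b) *\<^sub>R cross7 e2 v
        + (c * c) *\<^sub>R cross7 e2 v))"
    "A y (A y (cross7 e3 v)) = - ((a * a) *\<^sub>R cross7 e3 v + ((b * b) *\<^sub>R cross7 e3 v
        + (c * c) *\<^sub>R cross7 e3 v))"
    by (simp_all add: d(2-5) A_simps algebra_simps)
  then have s: "A y (A y v) = - v" "A y (A y (cross7 e1 v)) = - cross7 e1 v"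
    "A y (A y (cross7 e2 v)) = - cross7 e2 v" "A y (A y (cross7 e3 v)) = - cross7 e3 v"
    by (simp_all only: sc)
  have "A y (A y w) + w = 0"
    by (rule frame_eq_0) (simp_all add: inner_add_left skew k d(1) w s)
  then show ?thesis by (simp add: eq_neg_iff_add_eq_0)
qed

theorem nonabelian_with_center:
  assumes z: "z \<in> lie_center br" "z \<noteq> 0" and na: "\<not> lie_abelian br"
  shows "lie_isomorphic br s7_bracket"
proof -
  obtain x0 where x0: "x0 \<in> supp" "x0 \<noteq> 0"
  proof -
    have "\<exists>x\<in>supp. x \<noteq> 0"
    proof (rule ccontr)
      assume "\<not> ?thesis"
      then have "x \<in> ker" for x using ker_supp_decomp[of x] by (metis diff_zero)
      then have "lie_abelian br" by (simp add: lie_abelian_def torsion_free ker_def)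
      then show False using na by simp
    qed
    then show ?thesis using that by blast
  qed
  have Az: "A x z = 0" for x using z(1) by (rule A_center)
  have "z \<in> ker"
    using z(1) Az torsion_free[of z] by (simp add: ker_def lie_center_def)
  then have x0z: "x0 \<bullet> z = 0" using x0(1) by (simp add: supp_def)
  \<comment> \<open>Every \<open>A y\<close> with \<open>y\<close> in \<open>supp\<close>
    annihilates both directions: \<open>x0\<close> because \<open>supp\<close> acts trivially on
    itself, \<open>z\<close> because it is central.\<close>
  define e1 where "e1 = x0 /\<^sub>R norm x0"
  define e2 where "e2 = z /\<^sub>R norm z"
  have "card {e1, e2, cross7 e1 e2} < 7"
    using card_length[of "[e1, e2, cross7 e1 e2]"] by simp
  then obtain v where v: "v \<bullet> v = 1" "\<And>x. x \<in> {e1, e2, cross7 e1 e2} \<Longrightarrow> v \<bullet> x = 0"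
    using exists_unit_orthogonal[of "{e1, e2, cross7 e1 e2}"] by auto
  have fr: "associative_frame e1 e2 v"
  proof
    show "e1 \<bullet> e1 = 1" "e2 \<bullet> e2 = 1"
      using x0(2) z(2) by (simp_all add: e1_def e2_def dot_square_norm power2_eq_square)
    show "e1 \<bullet> e2 = 0" by (simp add: e1_def e2_def x0z)
  qed (simp_all add: v)
  interpret associative_frame e1 e2 v by (rule fr)
  have k: "A y e1 = 0" "A y e2 = 0" if "y \<in> supp" for y
    using A_supp_supp'[OF that x0(1)] Az by (simp_all add: e1_def e2_def A_simps)
  \<comment> \<open>A derivation that kills \<open>e1\<close>, \<open>e2\<close> and
    \<open>v\<close> is zero, so evaluation at \<open>v\<close> is injective on
    \<open>supp\<close>.\<close>
  have inj: "y = 0" if "y \<in> supp" "A y v = 0" for y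
    by (rule ker_supp) (use A_eq_0_frame[OF fr k[OF that(1)] that(2)] that(1) in \<open>simp_all add:
        ker_def\<close>)
  define n where "n = sqrt (A x0 v \<bullet> A x0 v)"
  have "A x0 v \<noteq> 0" using inj[OF x0(1)] x0(2) by blast
  then have n: "n > 0" by (simp add: n_def)
  \<comment> \<open>The scale at which \<open>A x1\<close> is a unit quaternion, hence a complex
    structure on the complement of \<open>e1\<close>, \<open>e2\<close>, \<open>e3\<close>.\<close>
  define x1 where "x1 = x0 /\<^sub>R n"
  have x1: "x1 \<in> supp" "x1 \<noteq> 0"
    using x0 n subspace_supp by (simp_all add: x1_def subspace_scale)
  have unit1: "A x1 v \<bullet> A x1 v = 1"
    using n by (simp add: x1_def A_simps n_def field_simps)
  let ?B = "A x1"
  have BB: "?B (?B w) = - w" if "w \<bullet> e1 = 0" "w \<bullet> e2 = 0" "w \<bullet> e3 = 0" for w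
    by (rule A_square[OF fr k[OF x1(1)] unit1 that])
  have Bk: "?B e1 = 0" "?B e2 = 0" "?B e3 = 0"
    using k[OF x1(1)] by (simp_all add: derivation cross7_simps)
  have line: "\<exists>t. y = t *\<^sub>R x1" if y: "y \<in> supp" for y
  proof -
    define a b c where abc: "a = ?B v \<bullet> cross7 e1 v" "b = ?B v \<bullet> cross7 e2 v" "c
        = ?B v \<bullet> cross7 e3 v"
    define a' b' c' where abc': "a' = A y v \<bullet> cross7 e1 v" "b' = A y v \<bullet> cross7 e2 v" "c'
        = A y v \<bullet> cross7 e3 v"
    note d = A_determined[OF fr k[OF x1(1)] abc]
    note d' = A_determined[OF fr k[OF y] abc']
    have "br x1 y = 0" using A_supp_supp' x1(1) y by (simp add: torsion_free)
    then have "A x1 (A y v) - A y (A x1 v) = 0"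
      using A_br[OF flat, of x1 y v] by (simp add: A_simps)
    \<comment> \<open>The commutator of two imaginary quaternions is, up to sign, twice the cross
      product of their coefficient vectors; its vanishing makes these vectors parallel.\<close>
    moreover have "A x1 (A y v) - A y (A x1 v) = ((b * c' - c * b') + (b * c' - c * b')) *\<^sub>R
        cross7 e1 v
      + ((c * a' - a * c') + (c * a' - a * c')) *\<^sub>R cross7 e2 v + ((a * b' - b * a')
          + (a * b' - b * a')) *\<^sub>R cross7 e3 v"
      by (simp add: d d' A_simps) (simp add: vec_eq_iff algebra_simps)
    ultimately have zero: "((b * c' - c * b') + (b * c' - c * b')) *\<^sub>R cross7 e1 v
      + ((c * a' - a * c') + (c * a' - a * c')) *\<^sub>R cross7 e2 v + ((a * b' - b * a')
          + (a * b' - b * a')) *\<^sub>R cross7 e3 v = 0"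
      (is "?s = 0")
      by simp
    have f: "frame 5 = cross7 e1 v" "frame 6 = cross7 e2 v" "frame 7 = cross7 e3 v"
      by (simp_all add: frame_def)
    have "\<forall>i. ?s \<bullet> frame i = 0" using zero by simp
    then have p: "b * c' = c * b'" "c * a' = a * c'" "a * b' = b * a'"
      unfolding f[symmetric] forall_7 inner_add_left inner_scaleR_left frame_orthonormal
      by (simp_all add: mult.commute)
    have nn: "a * a + b * b + c * c = 1"
      using unit1 by (subst (asm) (2) d(2)) (simp add: inner_add_right abc)
    \<comment> \<open>As (a,b,c) is a unit vector, the inner product with it is the factor of
      proportionality.\<close>
    define t where "t = a * a' + b * b' + c * c'"
    have "t * a = a'" "t * b = b'" "t * c = c'"
      using p nn unfolding t_def by algebra+
    then have "A (y - t *\<^sub>R x1) v = 0"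
      by (simp add: A_simps d(2) d'(2) scaleR_add_right)
    moreover have "y - t *\<^sub>R x1 \<in> supp"
      using y x1(1) subspace_supp by (simp add: subspace_diff subspace_scale)
    ultimately have "y - t *\<^sub>R x1 = 0" by (rule inj[rotated])
    then show ?thesis by auto
  qed
  define \<alpha> where "\<alpha> x = (x \<bullet> x1) / (x1 \<bullet> x1)" for x
  have A_eq: "A x y = \<alpha> x *\<^sub>R ?B y" for x y
  proof -
    obtain t where t: "x - t *\<^sub>R x1 \<in> ker" using ker_supp_decomp[of x] line by blast
    then have "(x - t *\<^sub>R x1) \<bullet> x1 = 0" using x1(1) unfolding supp_def by (subst inner_commute)
        blast
    then have "t = \<alpha> x" using x1(2) by (simp add: \<alpha>_def inner_diff_left)
    then show ?thesis using t by (simp add: ker_def A_simps)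
  qed
  have br_eq: "br x y = \<alpha> x *\<^sub>R ?B y - \<alpha> y *\<^sub>R ?B x" for x y
    by (simp add: torsion_free A_eq[of x] A_eq[of y])
  \<comment> \<open>A second complex line in the four-space: \<open>v\<close>, \<open>?B v\<close>,
    \<open>w\<close>, \<open>?B w\<close> will be an orthonormal basis of it.\<close>
  have "card {e1, e2, e3, v, ?B v} \<le> 5"
    using card_length[of "[e1, e2, e3, v, ?B v]"] by simp
  then obtain w where w: "w \<bullet> w = 1" "\<And>x. x \<in> {e1, e2, e3, v, ?B v} \<Longrightarrow> w \<bullet> x = 0"
    using exists_unit_orthogonal[of "{e1, e2, e3, v, ?B v}"] by auto
  have wc: "w \<bullet> e1 = 0" "w \<bullet> e2 = 0" "w \<bullet> e3 = 0" "w \<bullet> v = 0" "w \<bullet> ?B v = 0"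
    using w(2) by simp_all
  have BBv: "?B (?B v) = - v" and BBw: "?B (?B w) = - w"
    by (rule BB; simp add: orth wc)+
  define g :: "7 \<Rightarrow> real^7" where
    "g i = (if i = 1 then v else if i = 2 then ?B v else if i = 3 then w else if i = 4 then ?B w
       else if i = 5 then e1 else if i = 6 then e2 else e3)" for i
  have g: "g i \<bullet> g j = (if i = j then 1 else 0)" for i j
  proof -
    have s: "?B x \<bullet> y = - (x \<bullet> ?B y)" for x y by (rule skew)
    have s': "x \<bullet> ?B y = - (?B x \<bullet> y)" for x y by (simp add: skew)
    have l: "v \<bullet> ?B v = 0" "w \<bullet> ?B w = 0" "v \<bullet> ?B w = 0"
      using A_self_orth[of x1 v] A_self_orth[of x1 w] wc(5) s'[of v w] by (simp_all add:
          inner_commute)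
    have l': "e1 \<bullet> ?B x = 0" "e2 \<bullet> ?B x = 0" "e3 \<bullet> ?B x = 0" for x
      by (simp_all only: s' Bk inner_zero_left minus_zero)
    have c: "v \<bullet> w = 0" "e1 \<bullet> w = 0" "e2 \<bullet> w = 0" "e3 \<bullet> w = 0"
      using wc by (simp_all add: inner_commute)
    have "\<forall>i j. g i \<bullet> g j = (if i = j then 1 else 0)"
      unfolding forall_7
      by (simp add: g_def unit orth orth' e3 w(1) wc l l' s c BBv BBw Bk)
    then show ?thesis by blast
  qed
  \<comment> \<open>The sign of the fifth coordinate comes from \<open>s7_bracket\<close>: skewness
    gives \<open>?B y \<bullet> v = - (y \<bullet> ?B v)\<close>, whereas the first bracket
    coordinate contains \<open>x $ 5 * y $ 2\<close> with a plus sign.\<close>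
  define f :: "real^7 \<Rightarrow> real^7" where
    "f y = (\<chi> i. if i = 1 then y \<bullet> v else if i = 2 then y \<bullet> ?B v else if i = 3 then y \<bullet> w
       else if i = 4 then y \<bullet> ?B w else if i = 5 then - \<alpha> y else if i = 6 then y \<bullet> e2 else y \<bullet>
           e3)" for y
  have f_nth: "f y $ 1 = y \<bullet> v" "f y $ 2 = y \<bullet> ?B v" "f y $ 3 = y \<bullet> w" "f y $ 4 = y \<bullet> ?B w"
     "f y $ 5 = - \<alpha> y" "f y $ 6 = y \<bullet> e2" "f y $ 7 = y \<bullet> e3" for y
    by (simp_all add: f_def)
  have lin: "linear f"
    by (rule linearI) (simp_all add: vec_eq_7 f_nth inner_simps \<alpha>_def add_divide_distrib)
  have "x1 = (norm x0 / n) *\<^sub>R e1" using x0(2) by (simp add: x1_def e1_def divide_inverse)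
  then obtain r where r: "x1 = r *\<^sub>R e1" by blast
  have "inj f"
    unfolding linear_injective_0[OF lin]
  proof (intro allI impI)
    fix y assume "f y = 0"
    then have 0: "y \<bullet> v = 0" "y \<bullet> ?B v = 0" "y \<bullet> w = 0" "y \<bullet> ?B w = 0" "\<alpha> y = 0" "y \<bullet> e2
        = 0" "y \<bullet> e3 = 0"
      by (simp_all add: vec_eq_7 f_nth)
    moreover have "y \<bullet> e1 = 0" using 0(5) x1(2) by (auto simp: \<alpha>_def r)
    ultimately have "\<forall>i. y \<bullet> g i = 0" unfolding forall_7 by (simp add: g_def)
    then show "y = 0" using orthonormal_7_eq_0[OF g] by blast
  qed
  then have "bij f"
    using linear_injective_imp_surjective[OF lin] by (simp add: bij_def)
  moreover have "f (br x y) = s7_bracket (f x) (f y)" for x y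
  proof -
    have B1: "?B x1 = 0" by (rule A_supp_supp'[OF x1(1) x1(1)])
    show ?thesis
      by (simp add: vec_eq_7 f_nth s7_bracket_nth)
         (simp add: br_eq inner_diff_left skew BBv BBw Bk B1 \<alpha>_def algebra_simps)
  qed
  ultimately show ?thesis using lin by (auto simp: lie_isomorphic_def)
qed

end

section \<open>The torsion-free equations\<close>

text \<open>Contracting two copies of the standard 3-form over one index gives metric terms plus the
  dual 4-form. That identity is used as the definition here; \<open>hodge_sum_std_eq\<close>
  confirms that the result is the Hodge dual.\<close>

definition psi0 :: "real^7 \<Rightarrow> real^7 \<Rightarrow> real^7 \<Rightarrow> real^7 \<Rightarrow> real" where
  "psi0 x y z w = cross7 x y \<bullet> cross7 z w - (x \<bullet> z) * (y \<bullet> w) + (x \<bullet> w) * (y \<bullet> z)"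

lemma psi0_swap12: "psi0 y x z w = - psi0 x y z w"
  by (simp add: psi0_def cross7_swap[of y x] algebra_simps)

lemma psi0_swap34: "psi0 x y w z = - psi0 x y z w"
  by (simp add: psi0_def cross7_swap[of w z] algebra_simps)

text \<open>This is \<open>cross7_anticommute\<close> paired with \<open>y\<close>. Together with
  the swaps inside each pair it makes \<open>psi0\<close> alternating.\<close>

lemma psi0_swap13: "psi0 z y x w = - psi0 x y z w"
  using arg_cong[OF cross7_anticommute[of x z w], of "\<lambda>u. y \<bullet> u"] cross7_skew[of x y "cross7 z w"]
    cross7_skew[of z y "cross7 x w"]
  by (simp add: psi0_def inner_simps inner_commute algebra_simps)

lemma psi0_swap23: "psi0 x z y w = - psi0 x y z w"
  using psi0_swap12[of x z y w] psi0_swap13[of z x y w] psi0_swap12[of y x z w] by simp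

lemma linear_psi0: "linear (\<lambda>x. psi0 x y z w)"
  by (rule linearI) (simp_all add: psi0_def cross7_simps inner_simps algebra_simps)

lemma sum_Basis_7:
  fixes f :: "real^7 \<Rightarrow> 'b::comm_monoid_add"
  shows "(\<Sum>i\<in>Basis. f i) = (\<Sum>k\<in>UNIV. f (axis k 1))"
proof -
  have B: "(Basis :: (real^7) set) = (\<lambda>k. axis k 1) ` UNIV"
    by (auto simp: Basis_vec_def)
  have "inj (\<lambda>k. axis k 1 :: real^7)"
    by (simp add: inj_on_def axis_eq_axis)
  then show ?thesis
    unfolding B by (simp only: sum.reindex o_def)
qed

text \<open>Skew maps whose matrix \<open>r i j = R e\<^sub>i \<bullet> e\<^sub>j\<close> satisfies the seven equations below form the
  Lie algebra \<open>g\<^sub>2\<close>; equivalently they are derivations of the cross product, or orthogonal to all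
  2-forms \<open>\<iota>\<^sub>w \<phi>\<close>.\<close>

definition g2_matrix :: "(7 \<Rightarrow> 7 \<Rightarrow> real) \<Rightarrow> bool" where
  "g2_matrix r \<longleftrightarrow> (\<forall>i j. r j i = - r i j) \<and>
     r 2 3 + r 4 5 + r 6 7 = 0 \<and>
     - r 1 3 + r 4 6 - r 5 7 = 0 \<and>
     r 1 2 - r 4 7 - r 5 6 = 0 \<and>
     - r 1 5 - r 2 6 + r 3 7 = 0 \<and>
     r 1 4 + r 2 7 + r 3 6 = 0 \<and>
     - r 1 7 + r 2 4 - r 3 5 = 0 \<and>
     r 1 6 - r 2 5 - r 3 4 = 0"

lemma skew_diagonal:
  fixes r :: "'i \<Rightarrow> 'i \<Rightarrow> real"
  assumes "\<And>i j. r j i = - r i j"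
  shows "r i i = 0"
  using assms[of i i] by simp

lemma skew_matrix_simps:
  fixes r :: "7 \<Rightarrow> 7 \<Rightarrow> real"
  assumes "\<And>i j. r j i = - r i j"
  shows
    "r 1 1 = 0" "r 2 1 = - r 1 2" "r 2 2 = 0" "r 3 1 = - r 1 3" "r 3 2 = - r 2 3" "r 3 3 = 0"
    "r 4 1 = - r 1 4" "r 4 2 = - r 2 4" "r 4 3 = - r 3 4" "r 4 4 = 0" "r 5 1 = - r 1 5"
    "r 5 2 = - r 2 5" "r 5 3 = - r 3 5" "r 5 4 = - r 4 5" "r 5 5 = 0" "r 6 1 = - r 1 6"
    "r 6 2 = - r 2 6" "r 6 3 = - r 3 6" "r 6 4 = - r 4 6" "r 6 5 = - r 5 6" "r 6 6 = 0"
    "r 7 1 = - r 1 7" "r 7 2 = - r 2 7" "r 7 3 = - r 3 7" "r 7 4 = - r 4 7" "r 7 5 = - r 5 7"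
    "r 7 6 = - r 6 7" "r 7 7 = 0"
  by (rule assms | rule skew_diagonal[OF assms])+

lemma linear_nth_matrix:
  fixes R :: "real^7 \<Rightarrow> real^7"
  assumes "linear R"
  shows "R x $ k = (\<Sum>j\<in>UNIV. x $ j * (R (axis j 1) $ k))"
  by (subst linear_sum_Basis[OF assms]) (simp add: sum_Basis_7 inner_axis)

lemma g2_matrix_imp_derivation:
  fixes R :: "real^7 \<Rightarrow> real^7"
  assumes lin: "linear R" and g2: "g2_matrix (\<lambda>i j. R (axis i 1) $ j)"
  shows "R (cross7 u v) = cross7 (R u) v + cross7 u (R v)"
proof -
  define r where "r i j = R (axis i 1) $ j" for i j
  have g2': "g2_matrix r" using g2 by (simp add: r_def[abs_def])
  have "\<And>i j. r j i = - r i j" using g2' unfolding g2_matrix_def by blast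
  note s = skew_matrix_simps[of r, OF this]
  \<comment> \<open>The seven equations are solved for seven of the 21 entries; the other 14
    parametrise g2.\<close>
  have e: "r 6 7 = - r 2 3 - r 4 5" "r 5 7 = r 4 6 - r 1 3" "r 5 6 = r 1 2 - r 4 7"
    "r 3 7 = r 1 5 + r 2 6" "r 3 6 = - r 1 4 - r 2 7" "r 3 5 = r 2 4 - r 1 7" "r 3 4
        = r 1 6 - r 2 5"
    using g2' unfolding g2_matrix_def by linarith+
  have n: "R x $ k = (\<Sum>j\<in>UNIV. x $ j * r j k)" for x k
    unfolding r_def by (rule linear_nth_matrix[OF lin])
  show ?thesis
    by (simp add: vec_eq_7 n sum_7 s e) (simp add: algebra_simps)
qed

lemma derivation_imp_g2_matrix:
  fixes R :: "real^7 \<Rightarrow> real^7"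
  assumes lin: "linear R" and skew: "\<And>x y. R x \<bullet> y = - (x \<bullet> R y)"
    and der: "\<And>u v. R (cross7 u v) = cross7 (R u) v + cross7 u (R v)"
  shows "g2_matrix (\<lambda>i j. R (axis i 1) $ j)"
proof -
  define r where "r i j = R (axis i 1) $ j" for i j
  have sk: "r j i = - r i j" for i j
    using skew[of "axis i 1" "axis j 1"] by (simp add: r_def inner_axis inner_axis')
  note s = skew_matrix_simps[of r, OF sk]
  have n: "R x $ k = (\<Sum>j\<in>UNIV. x $ j * r j k)" for x k
    unfolding r_def by (rule linear_nth_matrix[OF lin])
  have d: "R (cross7 u v) $ k = cross7 (R u) v $ k + cross7 u (R v) $ k" for u v k
    by (simp add: der)
  show ?thesis
    unfolding g2_matrix_def r_def[symmetric]
  proof (intro conjI allI)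
    show "r j i = - r i j" for i j by (rule sk)
  qed (use
    d[of "ax 2" "ax 4" 7]
    d[of "ax 1" "ax 4" 7]
    d[of "ax 1" "ax 4" 6]
    d[of "ax 1" "ax 2" 7]
    d[of "ax 1" "ax 2" 6]
    d[of "ax 1" "ax 2" 5]
    d[of "ax 1" "ax 2" 4]
    in \<open>simp_all add: n sum_7 axis_def s\<close>)
qed

text \<open>The components of this vector are twice the left-hand sides of the seven equations: it
  contracts \<open>R\<close> with the 3-form.\<close>

lemma g2_matrix_sum_cross7:
  fixes R :: "real^7 \<Rightarrow> real^7"
  assumes g2: "g2_matrix (\<lambda>i j. R (axis i 1) $ j)"
  shows "(\<Sum>i\<in>Basis. cross7 i (R i)) = 0"
proof -
  define r where "r i j = R (axis i 1) $ j" for i j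
  have g2': "g2_matrix r" using g2 by (simp add: r_def[abs_def])
  have "\<And>i j. r j i = - r i j" using g2' unfolding g2_matrix_def by blast
  note s = skew_matrix_simps[of r, OF this]
  show ?thesis
    using g2'[unfolded g2_matrix_def, THEN conjunct2]
    by (simp add: vec_eq_7 sum_Basis_7 sum_7 r_def[symmetric]) (simp add: axis_def s; linarith)
qed

section \<open>Vanishing of the intrinsic torsion\<close>

lemma axis_nth: "axis i x $ j = (if i = j then x else 0)"
  by (simp add: axis_def)

lemma psi0_axis:
  "psi0 v (ax 1) (ax 2) (ax 3) = 0"
  "psi0 v (ax 1) (ax 2) (ax 4) = v $ 7"
  "psi0 v (ax 1) (ax 2) (ax 5) = v $ 6"
  "psi0 v (ax 1) (ax 2) (ax 6) = - v $ 5"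
  "psi0 v (ax 1) (ax 2) (ax 7) = - v $ 4"
  "psi0 v (ax 1) (ax 3) (ax 4) = v $ 6"
  "psi0 v (ax 1) (ax 3) (ax 5) = - v $ 7"
  "psi0 v (ax 1) (ax 3) (ax 6) = - v $ 4"
  "psi0 v (ax 1) (ax 3) (ax 7) = v $ 5"
  "psi0 v (ax 1) (ax 4) (ax 5) = 0"
  "psi0 v (ax 1) (ax 4) (ax 6) = v $ 3"
  "psi0 v (ax 1) (ax 4) (ax 7) = v $ 2"
  "psi0 v (ax 1) (ax 5) (ax 6) = v $ 2"
  "psi0 v (ax 1) (ax 5) (ax 7) = - v $ 3"
  "psi0 v (ax 1) (ax 6) (ax 7) = 0"
  "psi0 v (ax 2) (ax 3) (ax 4) = - v $ 5"
  "psi0 v (ax 2) (ax 3) (ax 5) = v $ 4"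
  "psi0 v (ax 2) (ax 3) (ax 6) = - v $ 7"
  "psi0 v (ax 2) (ax 3) (ax 7) = v $ 6"
  "psi0 v (ax 2) (ax 4) (ax 5) = - v $ 3"
  "psi0 v (ax 2) (ax 4) (ax 6) = 0"
  "psi0 v (ax 2) (ax 4) (ax 7) = - v $ 1"
  "psi0 v (ax 2) (ax 5) (ax 6) = - v $ 1"
  "psi0 v (ax 2) (ax 5) (ax 7) = 0"
  "psi0 v (ax 2) (ax 6) (ax 7) = - v $ 3"
  "psi0 v (ax 3) (ax 4) (ax 5) = v $ 2"
  "psi0 v (ax 3) (ax 4) (ax 6) = - v $ 1"
  "psi0 v (ax 3) (ax 4) (ax 7) = 0"
  "psi0 v (ax 3) (ax 5) (ax 6) = 0"
  "psi0 v (ax 3) (ax 5) (ax 7) = v $ 1"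
  "psi0 v (ax 3) (ax 6) (ax 7) = v $ 2"
  "psi0 v (ax 4) (ax 5) (ax 6) = - v $ 7"
  "psi0 v (ax 4) (ax 5) (ax 7) = v $ 6"
  "psi0 v (ax 4) (ax 6) (ax 7) = - v $ 5"
  "psi0 v (ax 5) (ax 6) (ax 7) = v $ 4"
  by (simp_all add: psi0_def inner_7 axis_nth)

text \<open>The two axioms are closedness of the standard 3-form and of its dual, evaluated on
  vectors in the shape of \<open>ce_d_4\<close> and \<open>ce_d_5\<close>.\<close>

locale torsion_free_connection = metric_connection br A for br A :: "real^7 \<Rightarrow> real^7 \<Rightarrow> real^7" +
  assumes dphi: "- (cross7 (br x y) z \<bullet> w) + cross7 (br x z) y \<bullet> w - cross7 (br x w) y \<bullet> z
      - cross7 (br y z) x \<bullet> w + cross7 (br y w) x \<bullet> z - cross7 (br z w) x \<bullet> y = 0"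
    and dpsi: "- psi0 (br x y) z w u + psi0 (br x z) y w u - psi0 (br x w) y z u
        + psi0 (br x u) y z w
      - psi0 (br y z) x w u + psi0 (br y w) x z u - psi0 (br y u) x z w
      - psi0 (br z w) x y u + psi0 (br z u) x y w - psi0 (br w u) x y z = 0"
begin

lemma A_matrix_skew: "A x (axis j 1) $ i = - A x (axis i 1) $ j"
  using skew[of x "axis i 1" "axis j 1"] by (simp add: inner_axis inner_axis')

lemmas A_skew_simps = skew_matrix_simps[of "\<lambda>i j. A x (axis i 1) $ j" for x, OF A_matrix_skew]

lemmas dphi_ax = dphi[of "axis i 1" "axis j 1" "axis k 1" "axis l 1" for i j k l]

lemmas dpsi_ax = dpsi[of "axis i 1" "axis j 1" "axis k 1" "axis l 1" "axis m 1" for i j k l m]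

lemmas row_simps = inner_axis axis_nth psi0_axis torsion_free A_skew_simps

text \<open>The linear combinations were found by Gaussian elimination: the 56 equations \<open>d\<phi> = 0\<close>,
  \<open>d*\<phi> = 0\<close> are equivalent to the 49 equations \<open>A x \<in> g\<^sub>2\<close>, \<open>x\<close> in the standard basis.\<close>

lemma g2_row_1: "g2_matrix (\<lambda>i j. A (ax 1) (axis i 1) $ j)"
  unfolding g2_matrix_def
proof (intro conjI allI, goal_cases)
  case 1 show ?case by (rule A_matrix_skew)
next
  \<comment> \<open>Read the torsion as a 7 by 7 matrix, operators against equations. Its symmetric
    part is controlled by the 3-form alone, so diagonal entries such as this one use only
    \<open>dphi\<close>; off-diagonal entries also need the skew part and therefore
    \<open>dpsi\<close>.\<close>
  case 2 show ?case
    using dphi_ax[of 1 2 4 7] dphi_ax[of 1 2 5 6] dphi_ax[of 1 3 4 6] dphi_ax[of 1 3 5 7]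
      dphi_ax[of 2 3 4 5] dphi_ax[of 2 3 6 7] dphi_ax[of 4 5 6 7]
    by (simp add: row_simps; linarith)
next
  case 3 show ?case
    using dphi_ax[of 2 3 4 6] dphi_ax[of 2 3 5 7] dpsi_ax[of 1 2 3 4 7] dpsi_ax[of 1 2 3 5 6]
    by (simp add: row_simps; linarith)
next
  case 4 show ?case
    using dphi_ax[of 2 3 4 7] dphi_ax[of 2 3 5 6] dpsi_ax[of 1 2 3 4 6] dpsi_ax[of 1 2 3 5 7]
    by (simp add: row_simps; linarith)
next
  case 5 show ?case
    using dphi_ax[of 2 4 5 6] dphi_ax[of 3 4 5 7] dpsi_ax[of 1 2 4 5 7] dpsi_ax[of 1 3 4 5 6]
    by (simp add: row_simps; linarith)
next
  case 6 show ?case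
    using dphi_ax[of 2 4 5 7] dphi_ax[of 3 4 5 6] dpsi_ax[of 1 2 4 5 6] dpsi_ax[of 1 3 4 5 7]
    by (simp add: row_simps; linarith)
next
  case 7 show ?case
    using dphi_ax[of 2 4 6 7] dphi_ax[of 3 5 6 7] dpsi_ax[of 1 2 5 6 7] dpsi_ax[of 1 3 4 6 7]
    by (simp add: row_simps; linarith)
next
  case 8 show ?case
    using dphi_ax[of 2 5 6 7] dphi_ax[of 3 4 6 7] dpsi_ax[of 1 2 4 6 7] dpsi_ax[of 1 3 5 6 7]
    by (simp add: row_simps; linarith)
qed

lemma g2_row_2: "g2_matrix (\<lambda>i j. A (ax 2) (axis i 1) $ j)"
  unfolding g2_matrix_def
proof (intro conjI allI, goal_cases)
  case 1 show ?case by (rule A_matrix_skew)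
next
  case 2 show ?case
    using dphi_ax[of 1 3 4 5] dphi_ax[of 1 3 6 7] dpsi_ax[of 1 2 3 4 7] dpsi_ax[of 1 2 3 5 6]
    by (simp add: row_simps; linarith)
next
  case 3 show ?case
    using dphi_ax[of 1 2 4 7] dphi_ax[of 1 2 5 6] dphi_ax[of 1 3 4 6] dphi_ax[of 1 3 5 7]
      dphi_ax[of 2 3 4 5] dphi_ax[of 2 3 6 7] dphi_ax[of 4 5 6 7]
    by (simp add: row_simps; linarith)
next
  case 4 show ?case
    using dphi_ax[of 1 3 4 7] dphi_ax[of 1 3 5 6] dpsi_ax[of 1 2 3 4 5] dpsi_ax[of 1 2 3 6 7]
    by (simp add: row_simps; linarith)
next
  case 5 show ?case
    using dphi_ax[of 1 2 3 6] dphi_ax[of 2 5 6 7] dpsi_ax[of 1 3 5 6 7]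
    by (simp add: row_simps; linarith)
next
  case 6 show ?case
    using dphi_ax[of 1 2 3 7] dphi_ax[of 2 4 6 7] dpsi_ax[of 1 3 4 6 7]
    by (simp add: row_simps; linarith)
next
  case 7 show ?case
    using dphi_ax[of 1 2 3 4] dphi_ax[of 2 4 5 7] dpsi_ax[of 1 3 4 5 7]
    by (simp add: row_simps; linarith)
next
  case 8 show ?case
    using dphi_ax[of 1 2 3 5] dphi_ax[of 2 4 5 6] dpsi_ax[of 1 3 4 5 6]
    by (simp add: row_simps; linarith)
qed

lemma g2_row_3: "g2_matrix (\<lambda>i j. A (ax 3) (axis i 1) $ j)"
  unfolding g2_matrix_def
proof (intro conjI allI, goal_cases)
  case 1 show ?case by (rule A_matrix_skew)
next
  case 2 show ?case
    using dphi_ax[of 1 2 4 5] dphi_ax[of 1 2 6 7] dpsi_ax[of 1 2 3 4 6] dpsi_ax[of 1 2 3 5 7]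
    by (simp add: row_simps; linarith)
next
  case 3 show ?case
    using dphi_ax[of 1 2 4 6] dphi_ax[of 1 2 5 7] dpsi_ax[of 1 2 3 4 5] dpsi_ax[of 1 2 3 6 7]
    by (simp add: row_simps; linarith)
next
  case 4 show ?case
    using dphi_ax[of 1 2 4 7] dphi_ax[of 1 2 5 6] dphi_ax[of 1 3 4 6] dphi_ax[of 1 3 5 7]
      dphi_ax[of 2 3 4 5] dphi_ax[of 2 3 6 7] dphi_ax[of 4 5 6 7]
    by (simp add: row_simps; linarith)
next
  case 5 show ?case
    using dphi_ax[of 1 2 3 7] dphi_ax[of 3 5 6 7] dpsi_ax[of 1 2 5 6 7]
    by (simp add: row_simps; linarith)
next
  case 6 show ?case
    using dphi_ax[of 1 2 3 6] dphi_ax[of 3 4 6 7] dpsi_ax[of 1 2 4 6 7]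
    by (simp add: row_simps; linarith)
next
  case 7 show ?case
    using dphi_ax[of 1 2 3 5] dphi_ax[of 3 4 5 7] dpsi_ax[of 1 2 4 5 7]
    by (simp add: row_simps; linarith)
next
  case 8 show ?case
    using dphi_ax[of 1 2 3 4] dphi_ax[of 3 4 5 6] dpsi_ax[of 1 2 4 5 6]
    by (simp add: row_simps; linarith)
qed

lemma g2_row_4: "g2_matrix (\<lambda>i j. A (ax 4) (axis i 1) $ j)"
  unfolding g2_matrix_def
proof (intro conjI allI, goal_cases)
  case 1 show ?case by (rule A_matrix_skew)
next
  case 2 show ?case
    using dphi_ax[of 1 2 3 5] dphi_ax[of 1 5 6 7] dpsi_ax[of 1 2 4 5 7] dpsi_ax[of 1 3 4 5 6]
    by (simp add: row_simps; linarith)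
next
  case 3 show ?case
    using dphi_ax[of 1 4 5 6] dphi_ax[of 3 4 6 7] dpsi_ax[of 1 3 5 6 7]
    by (simp add: row_simps; linarith)
next
  case 4 show ?case
    using dphi_ax[of 1 4 5 7] dphi_ax[of 2 4 6 7] dpsi_ax[of 1 2 5 6 7]
    by (simp add: row_simps; linarith)
next
  case 5 show ?case
    using dphi_ax[of 1 2 4 7] dphi_ax[of 1 2 5 6] dphi_ax[of 1 3 4 6] dphi_ax[of 1 3 5 7]
      dphi_ax[of 2 3 4 5] dphi_ax[of 2 3 6 7] dphi_ax[of 4 5 6 7]
    by (simp add: row_simps; linarith)
next
  case 6 show ?case
    using dphi_ax[of 1 2 4 6] dphi_ax[of 1 3 4 7] dpsi_ax[of 1 2 3 6 7]
    by (simp add: row_simps; linarith)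
next
  case 7 show ?case
    using dphi_ax[of 1 2 4 5] dphi_ax[of 2 3 4 7] dpsi_ax[of 1 2 3 5 7]
    by (simp add: row_simps; linarith)
next
  case 8 show ?case
    using dphi_ax[of 1 3 4 5] dphi_ax[of 2 3 4 6] dpsi_ax[of 1 2 3 5 6]
    by (simp add: row_simps; linarith)
qed

lemma g2_row_5: "g2_matrix (\<lambda>i j. A (ax 5) (axis i 1) $ j)"
  unfolding g2_matrix_def
proof (intro conjI allI, goal_cases)
  case 1 show ?case by (rule A_matrix_skew)
next
  case 2 show ?case
    using dphi_ax[of 1 2 3 4] dphi_ax[of 1 4 6 7] dpsi_ax[of 1 2 4 5 6] dpsi_ax[of 1 3 4 5 7]
    by (simp add: row_simps; linarith)
next
  case 3 show ?case
    using dphi_ax[of 1 4 5 7] dphi_ax[of 3 5 6 7] dpsi_ax[of 1 3 4 6 7]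
    by (simp add: row_simps; linarith)
next
  case 4 show ?case
    using dphi_ax[of 1 4 5 6] dphi_ax[of 2 5 6 7] dpsi_ax[of 1 2 4 6 7]
    by (simp add: row_simps; linarith)
next
  case 5 show ?case
    using dphi_ax[of 1 2 5 7] dphi_ax[of 1 3 5 6] dpsi_ax[of 1 2 3 6 7]
    by (simp add: row_simps; linarith)
next
  case 6 show ?case
    using dphi_ax[of 1 2 4 7] dphi_ax[of 1 2 5 6] dphi_ax[of 1 3 4 6] dphi_ax[of 1 3 5 7]
      dphi_ax[of 2 3 4 5] dphi_ax[of 2 3 6 7] dphi_ax[of 4 5 6 7]
    by (simp add: row_simps; linarith)
next
  case 7 show ?case
    using dphi_ax[of 1 3 4 5] dphi_ax[of 2 3 5 7] dpsi_ax[of 1 2 3 4 7]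
    by (simp add: row_simps; linarith)
next
  case 8 show ?case
    using dphi_ax[of 1 2 4 5] dphi_ax[of 2 3 5 6] dpsi_ax[of 1 2 3 4 6]
    by (simp add: row_simps; linarith)
qed

lemma g2_row_6: "g2_matrix (\<lambda>i j. A (ax 6) (axis i 1) $ j)"
  unfolding g2_matrix_def
proof (intro conjI allI, goal_cases)
  case 1 show ?case by (rule A_matrix_skew)
next
  case 2 show ?case
    using dphi_ax[of 1 2 3 7] dphi_ax[of 1 4 5 7] dpsi_ax[of 1 2 5 6 7] dpsi_ax[of 1 3 4 6 7]
    by (simp add: row_simps; linarith)
next
  case 3 show ?case
    using dphi_ax[of 1 4 6 7] dphi_ax[of 3 4 5 6] dpsi_ax[of 1 3 4 5 7]
    by (simp add: row_simps; linarith)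
next
  case 4 show ?case
    using dphi_ax[of 1 5 6 7] dphi_ax[of 2 4 5 6] dpsi_ax[of 1 2 4 5 7]
    by (simp add: row_simps; linarith)
next
  case 5 show ?case
    using dphi_ax[of 1 2 6 7] dphi_ax[of 2 3 5 6] dpsi_ax[of 1 2 3 5 7]
    by (simp add: row_simps; linarith)
next
  case 6 show ?case
    using dphi_ax[of 1 3 6 7] dphi_ax[of 2 3 4 6] dpsi_ax[of 1 2 3 4 7]
    by (simp add: row_simps; linarith)
next
  case 7 show ?case
    using dphi_ax[of 1 2 4 7] dphi_ax[of 1 2 5 6] dphi_ax[of 1 3 4 6] dphi_ax[of 1 3 5 7]
      dphi_ax[of 2 3 4 5] dphi_ax[of 2 3 6 7] dphi_ax[of 4 5 6 7]
    by (simp add: row_simps; linarith)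
next
  case 8 show ?case
    using dphi_ax[of 1 2 4 6] dphi_ax[of 1 3 5 6] dpsi_ax[of 1 2 3 4 5]
    by (simp add: row_simps; linarith)
qed

lemma g2_row_7: "g2_matrix (\<lambda>i j. A (ax 7) (axis i 1) $ j)"
  unfolding g2_matrix_def
proof (intro conjI allI, goal_cases)
  case 1 show ?case by (rule A_matrix_skew)
next
  case 2 show ?case
    using dphi_ax[of 1 2 3 6] dphi_ax[of 1 4 5 6] dpsi_ax[of 1 2 4 6 7] dpsi_ax[of 1 3 5 6 7]
    by (simp add: row_simps; linarith)
next
  case 3 show ?case
    using dphi_ax[of 1 5 6 7] dphi_ax[of 3 4 5 7] dpsi_ax[of 1 3 4 5 6]
    by (simp add: row_simps; linarith)
next
  case 4 show ?case
    using dphi_ax[of 1 4 6 7] dphi_ax[of 2 4 5 7] dpsi_ax[of 1 2 4 5 6]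
    by (simp add: row_simps; linarith)
next
  case 5 show ?case
    using dphi_ax[of 1 3 6 7] dphi_ax[of 2 3 5 7] dpsi_ax[of 1 2 3 5 6]
    by (simp add: row_simps; linarith)
next
  case 6 show ?case
    using dphi_ax[of 1 2 6 7] dphi_ax[of 2 3 4 7] dpsi_ax[of 1 2 3 4 6]
    by (simp add: row_simps; linarith)
next
  case 7 show ?case
    using dphi_ax[of 1 2 5 7] dphi_ax[of 1 3 4 7] dpsi_ax[of 1 2 3 4 5]
    by (simp add: row_simps; linarith)
next
  case 8 show ?case
    using dphi_ax[of 1 2 4 7] dphi_ax[of 1 2 5 6] dphi_ax[of 1 3 4 6] dphi_ax[of 1 3 5 7]
      dphi_ax[of 2 3 4 5] dphi_ax[of 2 3 6 7] dphi_ax[of 4 5 6 7]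
    by (simp add: row_simps; linarith)
qed

end

lemma g2_matrixD:
  assumes "g2_matrix r"
  shows "r 2 3 + r 4 5 + r 6 7 = 0"
    and "- r 1 3 + r 4 6 - r 5 7 = 0"
    and "r 1 2 - r 4 7 - r 5 6 = 0"
    and "- r 1 5 - r 2 6 + r 3 7 = 0"
    and "r 1 4 + r 2 7 + r 3 6 = 0"
    and "- r 1 7 + r 2 4 - r 3 5 = 0"
    and "r 1 6 - r 2 5 - r 3 4 = 0"
  using assms[unfolded g2_matrix_def, THEN conjunct2] by (simp_all only: simp_thms)

lemma g2_matrix_add:
  assumes "g2_matrix r" and "g2_matrix s"
  shows "g2_matrix (\<lambda>i j. r i j + s i j)"
  unfolding g2_matrix_def
proof (intro conjI allI, goal_cases)
  case (1 i j) show ?case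
    using assms unfolding g2_matrix_def by (metis minus_add_distrib)
next
  case 2 show ?case
    using g2_matrixD(1)[OF assms(1)] g2_matrixD(1)[OF assms(2)] by linarith
next
  case 3 show ?case
    using g2_matrixD(2)[OF assms(1)] g2_matrixD(2)[OF assms(2)] by linarith
next
  case 4 show ?case
    using g2_matrixD(3)[OF assms(1)] g2_matrixD(3)[OF assms(2)] by linarith
next
  case 5 show ?case
    using g2_matrixD(4)[OF assms(1)] g2_matrixD(4)[OF assms(2)] by linarith
next
  case 6 show ?case
    using g2_matrixD(5)[OF assms(1)] g2_matrixD(5)[OF assms(2)] by linarith
next
  case 7 show ?case
    using g2_matrixD(6)[OF assms(1)] g2_matrixD(6)[OF assms(2)] by linarith
next
  case 8 show ?case
    using g2_matrixD(7)[OF assms(1)] g2_matrixD(7)[OF assms(2)] by linarith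
qed

lemma g2_matrix_scale:
  assumes "g2_matrix r"
  shows "g2_matrix (\<lambda>i j. c * r i j)"
  unfolding g2_matrix_def
proof (intro conjI allI, goal_cases)
  case (1 i j) show ?case
    using assms unfolding g2_matrix_def by (metis mult_minus_right)
next
  case 2 show ?case using g2_matrixD(1)[OF assms] by algebra
next
  case 3 show ?case using g2_matrixD(2)[OF assms] by algebra
next
  case 4 show ?case using g2_matrixD(3)[OF assms] by algebra
next
  case 5 show ?case using g2_matrixD(4)[OF assms] by algebra
next
  case 6 show ?case using g2_matrixD(5)[OF assms] by algebra
next
  case 7 show ?case using g2_matrixD(6)[OF assms] by algebra
next
  case 8 show ?case using g2_matrixD(7)[OF assms] by algebra
qed

context torsion_free_connection
begin

lemma A_g2: "g2_matrix (\<lambda>i j. A x (axis i 1) $ j)"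
proof -
  have eqs: "subspace {x. g2_matrix (\<lambda>i j. A x (axis i 1) $ j)}"
    unfolding subspace_def Ball_def mem_Collect_eq
  proof (intro conjI ballI allI impI)
    show "g2_matrix (\<lambda>i j. A 0 (axis i 1) $ j)" by (simp add: A_simps g2_matrix_def)
    show "g2_matrix (\<lambda>i j. A (x + y) (axis i 1) $ j)"
      if "g2_matrix (\<lambda>i j. A x (axis i 1) $ j)" "g2_matrix (\<lambda>i j. A y (axis i 1) $ j)" for x y
      using g2_matrix_add[OF that] by (simp add: A_simps)
    show "g2_matrix (\<lambda>i j. A (c *\<^sub>R x) (axis i 1) $ j)"
      if "g2_matrix (\<lambda>i j. A x (axis i 1) $ j)" for c x
      using g2_matrix_scale[OF that, of c] by (simp add: A_simps)
  qed
  have "axis k 1 \<in> {x. g2_matrix (\<lambda>i j. A x (axis i 1) $ j)}" for k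
  proof -
    have "\<forall>k. g2_matrix (\<lambda>i j. A (axis k 1) (axis i 1) $ j)"
      unfolding forall_7
      by (intro conjI g2_row_1 g2_row_2 g2_row_3 g2_row_4 g2_row_5 g2_row_6 g2_row_7)
    then show ?thesis by simp
  qed
  then have "span Basis \<subseteq> {x. g2_matrix (\<lambda>i j. A x (axis i 1) $ j)}"
    by (intro span_minimal eqs) (auto simp: Basis_vec_def)
  then show ?thesis using span_Basis by blast
qed

lemma A_derivation: "A v (cross7 x y) = cross7 (A v x) y + cross7 x (A v y)"
  by (rule g2_matrix_imp_derivation[OF linear_A(1) A_g2])

lemma curv_derivation: "curv x y (cross7 u v) = cross7 (curv x y u) v + cross7 u (curv x y v)"
  by (simp add: curv_def A_derivation A_simps cross7_simps)

text \<open>The curvature acts by derivations, so its matrix lies in g2. In the contraction with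
  \<open>psi0\<close> the product of cross products vanishes by \<open>g2_matrix_sum_cross7\<close>,
  and the two metric terms give the factor -2.\<close>

sublocale calibrated_connection br A psi0
proof (rule calibrated_connection.intro, rule metric_connection_axioms,
    rule calibrated_connection_axioms.intro)
  fix v x y z w :: "real^7"
  show "linear (\<lambda>x. psi0 x y z w)" by (rule linear_psi0)
  show "psi0 y x z w = - psi0 x y z w" by (rule psi0_swap12)
  show "psi0 x z y w = - psi0 x y z w" by (rule psi0_swap23)
  show "psi0 x y w z = - psi0 x y z w" by (rule psi0_swap34)
  show "psi0 (A v x) y z w + psi0 x (A v y) z w + psi0 x y (A v z) w + psi0 x y z (A v w) = 0"
    using arg_cong[OF A_derivation[of v x y], of "\<lambda>u. u \<bullet> cross7 z w"]
      arg_cong[OF A_derivation[of v z w], of "\<lambda>u. cross7 x y \<bullet> u"]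
    by (simp add: psi0_def inner_add_left inner_add_right skew algebra_simps)
  have "(\<Sum>k\<in>Basis. \<Sum>l\<in>Basis. psi0 x y k l * (curv z w k \<bullet> l)) = (\<Sum>k\<in>Basis. psi0 x y k (curv z w k))"
  proof (rule sum.cong[OF refl])
    fix k
    have "linear (psi0 x y k)"
      by (rule linearI) (simp_all add: psi0_def cross7_simps inner_simps algebra_simps)
    then show "(\<Sum>l\<in>Basis. psi0 x y k l * (curv z w k \<bullet> l)) = psi0 x y k (curv z w k)"
      by (subst (2) linear_sum_Basis) (simp_all add: mult.commute)
  qed
  also have "\<dots> = cross7 x y \<bullet> (\<Sum>k\<in>Basis. cross7 k (curv z w k))
      - (\<Sum>k\<in>Basis. (x \<bullet> k) * (y \<bullet> curv z w k)) + (\<Sum>k\<in>Basis. (x \<bullet> curv z w k) * (y \<bullet> k))"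
    by (simp add: psi0_def inner_sum_right sum.distrib sum_subtractf)
  also have "(\<Sum>k\<in>Basis. cross7 k (curv z w k)) = 0"
    by (rule g2_matrix_sum_cross7, rule derivation_imp_g2_matrix[OF linear_curv(1)])
       (rule curv_skew curv_derivation)+
  also have "(\<Sum>k\<in>Basis. (x \<bullet> k) * (y \<bullet> curv z w k)) = y \<bullet> curv z w x"
    by (subst linear_sum_Basis[OF linear_curv(1), of _ _ x]) (simp add: inner_sum_right)
  also have "(\<Sum>k\<in>Basis. (x \<bullet> curv z w k) * (y \<bullet> k)) = x \<bullet> curv z w y"
    by (subst linear_sum_Basis[OF linear_curv(1), of _ _ y]) (simp add: inner_sum_right
        mult.commute)
  finally show "(\<Sum>k\<in>Basis. \<Sum>l\<in>Basis. psi0 x y k l * (curv z w k \<bullet> l)) = - 2 * (curv z w x \<bullet> y)"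
    using curv_skew[of z w x y] by (simp add: inner_commute)
qed

sublocale flat_G2_connection br A
  by unfold_locales (rule flat, rule A_derivation)

end

text \<open>Koszul's formula for a left-invariant metric, where derivatives of inner products drop
  out.\<close>

definition levi_civita :: "('v::euclidean_space \<Rightarrow> 'v \<Rightarrow> 'v) \<Rightarrow> 'v \<Rightarrow> 'v \<Rightarrow> 'v" where
  "levi_civita br x y = (\<Sum>k\<in>Basis. ((br x y \<bullet> k - br y k \<bullet> x + br k x \<bullet> y) / 2) *\<^sub>R k)"

lemma metric_connection_levi_civita:
  assumes lie: "lie_algebra br"
  shows "metric_connection br (levi_civita br)"
proof -
  have bil: "bilinear br" using lie by (simp add: lie_algebra_def)
  note s = bilinear_ladd[OF bil] bilinear_radd[OF bil] bilinear_lmul[OF bil] bilinear_rmul[OF bil]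
  have sw: "br y x = - br x y" for x y
  proof -
    have "br (x + y) (x + y) = 0" "br x x = 0" "br y y = 0" using lie by (simp_all add:
        lie_algebra_def)
    then show ?thesis by (simp add: s eq_neg_iff_add_eq_0)
  qed
  have inner: "levi_civita br x y \<bullet> z = (br x y \<bullet> z - br y z \<bullet> x + br z x \<bullet> y) / 2" for x y z
  proof -
    have "linear (\<lambda>z. (br x y \<bullet> z - br y z \<bullet> x + br z x \<bullet> y) / 2)"
      by (rule linearI) (simp_all add: s inner_simps field_simps)
    from linear_sum_Basis[OF this, of z] show ?thesis
      by (simp only: levi_civita_def inner_sum_left inner_scaleR_left real_scaleR_def
          inner_commute[of z] mult.commute)
  qed
  show ?thesis
  proof
    show "lie_algebra br" by (rule lie)
    show "bilinear (levi_civita br)"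
      unfolding bilinear_def
      by (intro conjI allI linearI; rule vector_eq_ldot[THEN iffD1], intro allI)
         (simp_all add: inner_commute[of _ "levi_civita br _ _"] inner inner_simps s field_simps)
    show "levi_civita br x y \<bullet> z = - (y \<bullet> levi_civita br x z)" for x y z
      unfolding inner_commute[of y] inner sw[of z y] sw[of y x] sw[of z x] inner_minus_left
      by (simp add: field_simps)
    show "br x y = levi_civita br x y - levi_civita br y x" for x y
    proof (rule vector_eq_rdot[THEN iffD1], intro allI)
      fix z
      show "br x y \<bullet> z = (levi_civita br x y - levi_civita br y x) \<bullet> z"
        unfolding inner_diff_left inner sw[of y x] sw[of z x] sw[of z y] inner_minus_left
        by (simp add: field_simps)
    qed
  qed
qed

theorem standard_torsion_free_with_center:
  fixes br :: "real^7 \<Rightarrow> real^7 \<Rightarrow> real^7"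
  assumes lie: "lie_algebra br" and "lie_center br \<noteq> {0}"
    and dphi: "\<And>x y z w. - (cross7 (br x y) z \<bullet> w) + cross7 (br x z) y \<bullet> w - cross7 (br x w) y \<bullet> z
      - cross7 (br y z) x \<bullet> w + cross7 (br y w) x \<bullet> z - cross7 (br z w) x \<bullet> y = 0"
    and dpsi: "\<And>x y z w u. - psi0 (br x y) z w u + psi0 (br x z) y w u - psi0 (br x w) y z u
      + psi0 (br x u) y z w - psi0 (br y z) x w u + psi0 (br y w) x z u - psi0 (br y u) x z w
      - psi0 (br z w) x y u + psi0 (br z u) x y w - psi0 (br w u) x y z = 0"
  shows "lie_abelian br \<or> lie_isomorphic br s7_bracket"
proof -
  interpret metric_connection br "levi_civita br"
    by (rule metric_connection_levi_civita[OF lie])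
  interpret torsion_free_connection br "levi_civita br"
    by unfold_locales (rule dphi, rule dpsi)
  have "0 \<in> lie_center br"
    using bilinear_lzero[OF bilinear_br] by (simp add: lie_center_def)
  then show ?thesis using assms(2) nonabelian_with_center by blast
qed

section \<open>Exterior forms and wedge products\<close>

definition homogeneous :: "nat \<Rightarrow> 'a form \<Rightarrow> bool" where
  "homogeneous k \<alpha> \<longleftrightarrow> (\<forall>xs. length xs \<noteq> k \<longrightarrow> \<alpha> xs = 0)"

lemma forms_homogeneous: "\<alpha> \<in> forms k \<Longrightarrow> homogeneous k \<alpha>"
  by (simp add: forms_def homogeneous_def)

lemma forms_linear: "\<alpha> \<in> forms k \<Longrightarrow> linear (\<lambda>v. \<alpha> (xs @ v # ys))"
  by (simp add: forms_def)

lemma forms_not_distinct: "\<alpha> \<in> forms k \<Longrightarrow> \<not> distinct xs \<Longrightarrow> \<alpha> xs = 0"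
  by (simp add: forms_def)

lemma swap_adjacent:
  fixes f :: "'a::real_vector form"
  assumes lin: "\<And>xs ys. linear (\<lambda>v. f (xs @ v # ys))"
    and adj: "\<And>xs x ys. f (xs @ x # x # ys) = 0"
  shows "f (xs @ y # x # ys) = - f (xs @ x # y # ys)"
proof -
  have l1: "f (xs @ (x + y) # z # ys) = f (xs @ x # z # ys) + f (xs @ y # z # ys)" for z
    using linear_add[OF lin[of xs "z # ys"]] .
  have l2: "f (xs @ z # (x + y) # ys) = f (xs @ z # x # ys) + f (xs @ z # y # ys)" for z
    using linear_add[OF lin[of "xs @ [z]" ys]] by simp
  show ?thesis
    using adj[of xs "x + y" ys] adj[of xs x ys] adj[of xs y ys] by (simp add: l1 l2)
qed

lemma forms_swap: "\<alpha> \<in> forms k \<Longrightarrow> \<alpha> (xs @ y # x # ys) = - \<alpha> (xs @ x # y # ys)"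
  by (rule swap_adjacent[OF forms_linear forms_not_distinct]) auto

text \<open>Only adjacent repetitions have to be checked: transposing neighbours changes the sign
  alone and brings any two equal arguments together.\<close>

lemma forms_intro:
  assumes hom: "homogeneous k f"
    and lin: "\<And>xs ys. linear (\<lambda>v. f (xs @ v # ys))"
    and adj: "\<And>xs x ys. f (xs @ x # x # ys) = 0"
  shows "f \<in> forms k"
proof -
  have "f (as @ x # bs @ x # cs) = 0" for as bs cs x
  proof (induction bs arbitrary: as)
    case Nil
    then show ?case using adj by simp
  next
    case (Cons b bs)
    show ?case
      using Cons[of "as @ [b]"] swap_adjacent[OF lin adj, of as b x "bs @ x # cs"] by simp
  qed
  moreover have "\<exists>as x bs cs. xs = as @ x # bs @ x # cs" if "\<not> distinct xs" for xs :: "'a list"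
    using not_distinct_decomp[OF that] by auto
  ultimately have "f xs = 0" if "\<not> distinct xs" for xs
    using that by metis
  then show ?thesis
    using hom lin by (simp add: forms_def homogeneous_def)
qed

lemma forms_zero: "(\<lambda>_. 0) \<in> forms k"
  by (simp add: forms_def linear_zero)

lemma forms_diff:
  assumes "\<alpha> \<in> forms k" "\<beta> \<in> forms k"
  shows "(\<lambda>xs. \<alpha> xs - \<beta> xs) \<in> forms k"
  using assms by (auto simp: forms_def intro: linear_compose_sub)

lemma forms_scale: "\<alpha> \<in> forms k \<Longrightarrow> (\<lambda>xs. c * \<alpha> xs) \<in> forms k"
  using linear_compose_scale_right[where c = c and 'b = real] by (auto simp: forms_def)

lemma forms_compose_linear:
  fixes f :: "'a::real_vector \<Rightarrow> 'b::real_vector"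
  assumes "\<alpha> \<in> forms k" and "linear f"
  shows "(\<lambda>xs. \<alpha> (map f xs)) \<in> forms k"
proof (rule forms_intro)
  show "homogeneous k (\<lambda>xs. \<alpha> (map f xs))"
    using forms_homogeneous[OF assms(1)] by (simp add: homogeneous_def)
  show "linear (\<lambda>v. \<alpha> (map f (xs @ v # ys)))" for xs ys
    using linear_compose[OF assms(2) forms_linear[OF assms(1), of "map f xs" "map f ys"]]
    by (simp add: o_def)
  show "\<alpha> (map f (xs @ x # x # ys)) = 0" for xs x ys
    by (rule forms_not_distinct[OF assms(1)]) simp
qed

lemma contract_forms: "\<alpha> \<in> forms k \<Longrightarrow> contract v \<alpha> \<in> forms (k - 1)"
  unfolding forms_def contract_def
proof (safe, goal_cases)
  case (1 xs)
  then show ?case by (cases k) auto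
next
  case (2 xs ys)
  from 2(2) have "linear (\<lambda>w. \<alpha> ((v # xs) @ w # ys))" by blast
  then show ?case by simp
next
  case (3 xs)
  then show ?case by simp
qed

lemma contract_homogeneous: "homogeneous (Suc k) \<alpha> \<Longrightarrow> homogeneous k (contract v \<alpha>)"
  by (simp add: homogeneous_def contract_def)

section \<open>The wedge product as a recursion on its arguments\<close>

lemma sum_Pow_Suc:
  fixes f :: "nat set \<Rightarrow> 'b::comm_monoid_add"
  shows "(\<Sum>S\<in>Pow {..<Suc n}. f S) = (\<Sum>S\<in>Pow {..<n}. f (insert 0 (Suc ` S)) + f (Suc ` S))"
proof -
  have "Pow {..<Suc n} = (\<lambda>S. insert 0 (Suc ` S)) ` Pow {..<n} \<union> (\<lambda>S. Suc ` S) ` Pow {..<n}"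
    by (simp add: lessThan_Suc_eq_insert_0 Pow_insert image_Pow_surj[OF refl, of Suc, symmetric]
        image_image Un_commute)
  moreover have "inj_on (\<lambda>S. insert 0 (Suc ` S)) (Pow {..<n})" "inj_on (\<lambda>S. Suc ` S) (Pow {..<n})"
    by (auto simp: inj_on_def inj_image_eq_iff insert_ident)
  moreover have "(\<lambda>S. insert 0 (Suc ` S)) ` Pow {..<n} \<inter> (\<lambda>S. Suc ` S) ` Pow {..<n} = {}"
    by auto
  ultimately show ?thesis
    by (simp add: sum.union_disjoint sum.reindex sum.distrib)
qed

lemma shuffle_sign_insert_0: "shuffle_sign (Suc n) (insert 0 (Suc ` S)) = shuffle_sign n S"
proof -
  have "{(i, j). i \<in> insert 0 (Suc ` S) \<and> j < Suc n \<and> j \<notin> insert 0 (Suc ` S) \<and> j < i}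
      = map_prod Suc Suc ` {(i, j). i \<in> S \<and> j < n \<and> j \<notin> S \<and> j < i}"
    by (auto simp: image_iff less_Suc_eq_0_disj)
  then show ?thesis
    by (simp add: shuffle_sign_def card_image inj_on_def)
qed

lemma shuffle_sign_Suc:
  assumes "S \<subseteq> {..<n}"
  shows "shuffle_sign (Suc n) (Suc ` S) = (-1) ^ card S * shuffle_sign n S"
proof -
  have fin: "finite S" using assms finite_subset by blast
  have eq: "{(i, j). i \<in> Suc ` S \<and> j < Suc n \<and> j \<notin> Suc ` S \<and> j < i}
      = (\<lambda>i. (Suc i, 0)) ` S \<union> map_prod Suc Suc ` {(i, j). i \<in> S \<and> j < n \<and> j \<notin> S \<and> j < i}"
    by (auto simp: image_iff less_Suc_eq_0_disj)
  have fin2: "finite {(i, j). i \<in> S \<and> j < n \<and> j \<notin> S \<and> j < i}"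
    by (rule finite_subset[of _ "S \<times> {..<n}"]) (use fin in auto)
  show ?thesis
    unfolding shuffle_sign_def eq
    by (subst card_Un_disjoint)
       (use fin fin2 in \<open>auto simp: card_image inj_on_def power_add\<close>)
qed

lemma wedge_Nil [simp]: "wedge \<alpha> \<beta> [] = \<alpha> [] * \<beta> []"
  by (simp add: wedge_def shuffle_sign_def)

lemma wedge_zero [simp]: "wedge (\<lambda>_. 0) \<beta> xs = 0" "wedge \<alpha> (\<lambda>_. 0) xs = 0"
  by (simp_all add: wedge_def)

text \<open>Interior multiplication is an antiderivation: shuffles are split by whether position 0
  goes to \<alpha> or to \<beta>. Inductions on the argument list of a wedge product rest on
  this.\<close>

lemma wedge_Cons:
  assumes "homogeneous p \<alpha>"
  shows "wedge \<alpha> \<beta> (x # xs) = wedge (contract x \<alpha>) \<beta> xs + (-1) ^ p * wedge \<alpha> (contract x \<beta>) xs"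
proof -
  let ?n = "length xs"
  have 1: "nths (x # xs) (insert 0 (Suc ` S)) = x # nths xs S"
    "nths (x # xs) (- insert 0 (Suc ` S)) = nths xs (- S)"
    "nths (x # xs) (Suc ` S) = nths xs S"
    "nths (x # xs) (- (Suc ` S)) = x # nths xs (- S)" for S
    by (auto simp: nths_Cons intro!: arg_cong2[where f = nths])
  \<comment> \<open>Homogeneity leaves only subsets of size \<open>p\<close>, so the sign is the
    same in all terms.\<close>
  have "(-1) ^ card S * (shuffle_sign ?n S * \<alpha> (nths xs S) * \<beta> (x # nths xs (- S)))
     = (-1) ^ p * (shuffle_sign ?n S * \<alpha> (nths xs S) * \<beta> (x # nths xs (- S)))"
    if "S \<in> Pow {..<?n}" for S
  proof (cases "card S = p")
    case False
    have "length (nths xs S) = card S"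
      using that by (auto simp: length_nths intro!: arg_cong[where f = card])
    then show ?thesis using assms False by (simp add: homogeneous_def)
  qed simp
  note 2 = this
  have "wedge \<alpha> \<beta> (x # xs) = (\<Sum>S\<in>Pow {..<?n}.
      shuffle_sign ?n S * \<alpha> (x # nths xs S) * \<beta> (nths xs (- S))
      + (-1) ^ card S * (shuffle_sign ?n S * \<alpha> (nths xs S) * \<beta> (x # nths xs (- S))))"
    unfolding wedge_def list.size add_Suc_right add_0_right sum_Pow_Suc
    by (rule sum.cong) (auto simp: 1 shuffle_sign_insert_0 shuffle_sign_Suc Pow_iff)
  also have "\<dots> = (\<Sum>S\<in>Pow {..<?n}.
      shuffle_sign ?n S * \<alpha> (x # nths xs S) * \<beta> (nths xs (- S))
      + (-1) ^ p * (shuffle_sign ?n S * \<alpha> (nths xs S) * \<beta> (x # nths xs (- S))))"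
    by (rule sum.cong[OF refl]) (simp only: 2)
  also have "\<dots> = wedge (contract x \<alpha>) \<beta> xs + (-1) ^ p * wedge \<alpha> (contract x \<beta>) xs"
    by (simp add: wedge_def contract_def sum.distrib sum_distrib_left)
  finally show ?thesis .
qed

lemma wedge_homogeneous:
  assumes "homogeneous p \<alpha>" "homogeneous q \<beta>"
  shows "homogeneous (p + q) (wedge \<alpha> \<beta>)"
proof -
  have "\<alpha> (nths xs S) * \<beta> (nths xs (- S)) = 0"
    if "length xs \<noteq> p + q" for xs S
  proof -
    have "length xs = length (nths xs S) + length (nths xs (- S))"
    proof -
      have "{i. i < length xs} = {i. i < length xs \<and> i \<in> S} \<union> {i. i < length xs \<and> i \<in> - S}" by auto
      then have "card {i. i < length xs}
        = card ({i. i < length xs \<and> i \<in> S} \<union> {i. i < length xs \<and> i \<in> - S})" by (rule arg_cong)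
      also have "\<dots> = card {i. i < length xs \<and> i \<in> S} + card {i. i < length xs \<and> i \<in> - S}"
        by (rule card_Un_disjoint) auto
      finally have "card {i. i < length xs}
        = card {i. i < length xs \<and> i \<in> S} + card {i. i < length xs \<and> i \<in> - S}" .
      then show ?thesis by (simp add: length_nths)
    qed
    then show ?thesis using that assms by (auto simp: homogeneous_def)
  qed
  then show ?thesis by (auto simp: homogeneous_def wedge_def mult.assoc intro!: sum.neutral)
qed

lemma wedge_linear:
  assumes "\<alpha> \<in> forms p" "\<beta> \<in> forms q"
  shows "linear (\<lambda>v. wedge \<alpha> \<beta> (xs @ v # ys))"
  using assms
proof (induction xs arbitrary: \<alpha> \<beta> p q)
  case Nil
  have a: "linear (\<lambda>v. \<alpha> (v # zs))" "linear (\<lambda>v. \<beta> (v # zs))" for zs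
    using forms_linear[OF Nil(1), of "[]"] forms_linear[OF Nil(2), of "[]"] by simp_all
  have "linear (\<lambda>v. shuffle_sign (length ys) S * \<alpha> (v # nths ys S) * \<beta> (nths ys (- S)))"
    "linear (\<lambda>v. shuffle_sign (length ys) S * \<alpha> (nths ys S) * \<beta> (v # nths ys (- S)))" for S
    by (rule linearI; simp add: linear_add[OF a(1)] linear_add[OF a(2)] linear_scale[OF a(1)]
        linear_scale[OF a(2)] algebra_simps)+
  then have "linear (\<lambda>v. wedge (contract v \<alpha>) \<beta> ys)" "linear (\<lambda>v. wedge \<alpha> (contract v \<beta>) ys)"
    unfolding wedge_def contract_def by (auto intro!: linear_compose_sum)
  then have "linear (\<lambda>v. wedge (contract v \<alpha>) \<beta> ys + (-1) ^ p * wedge \<alpha> (contract v \<beta>) ys)"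
    using linear_compose_scale_right[where 'b = real] by (intro linear_compose_add) auto
  then show ?case by (simp add: wedge_Cons[OF forms_homogeneous[OF Nil(1)]])
next
  case (Cons x xs)
  note h = forms_homogeneous[OF Cons.prems(1)]
  have "linear (\<lambda>v. wedge (contract x \<alpha>) \<beta> (xs @ v # ys))"
    "linear (\<lambda>v. wedge \<alpha> (contract x \<beta>) (xs @ v # ys))"
    using Cons.IH Cons.prems contract_forms by blast+
  then show ?case
    using linear_compose_scale_right[where 'b = real]
    by (auto simp: wedge_Cons[OF h] intro!: linear_compose_add)
qed

text \<open>Contracting twice with one vector kills \<alpha> and \<beta>. The two mixed terms
  cancel, because the first contraction lowers the degree of \<alpha> and so flips the sign.\<close>

lemma wedge_adjacent:
  assumes "\<alpha> \<in> forms p" "\<beta> \<in> forms q"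
  shows "wedge \<alpha> \<beta> (xs @ x # x # ys) = 0"
  using assms
proof (induction xs arbitrary: \<alpha> \<beta> p q)
  case Nil
  have z: "contract x (contract x \<alpha>) = (\<lambda>_. 0)" "contract x (contract x \<beta>) = (\<lambda>_. 0)"
    using Nil by (auto simp: contract_def intro!: ext forms_not_distinct)
  show ?case
  proof (cases p)
    case 0
    then have "contract x \<alpha> = (\<lambda>_. 0)"
      using Nil(1) by (auto simp: forms_def contract_def)
    then show ?thesis
      using 0 by (simp add: wedge_Cons[OF forms_homogeneous[OF Nil(1)]] z)
  next
    case (Suc p')
    have "homogeneous p' (contract x \<alpha>)"
      using forms_homogeneous[OF Nil(1)] Suc by (simp add: contract_homogeneous)
    then show ?thesis
      using Suc by (simp add: wedge_Cons[OF forms_homogeneous[OF Nil(1)]] wedge_Cons z)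
  qed
next
  case (Cons y xs)
  note h = forms_homogeneous[OF Cons.prems(1)]
  have "wedge (contract y \<alpha>) \<beta> (xs @ x # x # ys) = 0" "wedge \<alpha> (contract y \<beta>) (xs @ x # x # ys) = 0"
    using Cons.IH Cons.prems contract_forms by blast+
  then show ?case by (simp add: wedge_Cons[OF h])
qed

lemma wedge_forms:
  assumes "\<alpha> \<in> forms p" "\<beta> \<in> forms q"
  shows "wedge \<alpha> \<beta> \<in> forms (p + q)"
  by (rule forms_intro[OF wedge_homogeneous[OF assms[THEN forms_homogeneous]]
        wedge_linear[OF assms] wedge_adjacent[OF assms]])

lemma wedge_map: "wedge \<alpha> \<beta> (map f xs) = wedge (\<lambda>xs. \<alpha> (map f xs)) (\<lambda>xs. \<beta> (map f xs)) xs"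
  by (simp add: wedge_def nths_map)

text \<open>The wedge product unfolded along the list of arguments, in a form that the simplifier can
  evaluate.\<close>

fun shuffles_sum :: "nat \<Rightarrow> nat \<Rightarrow> 'a form \<Rightarrow> 'a form \<Rightarrow> 'a form" where
  "shuffles_sum 0 q \<alpha> \<beta> xs = \<alpha> [] * \<beta> xs"
| "shuffles_sum (Suc p) 0 \<alpha> \<beta> xs = \<alpha> xs * \<beta> []"
| "shuffles_sum (Suc p) (Suc q) \<alpha> \<beta> [] = 0"
| "shuffles_sum (Suc p) (Suc q) \<alpha> \<beta> (x # xs) = shuffles_sum p (Suc q) (contract x \<alpha>) \<beta> xs
     + (-1) ^ Suc p * shuffles_sum (Suc p) q \<alpha> (contract x \<beta>) xs"

lemma wedge_eq_shuffles_sum: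
  assumes "homogeneous p \<alpha>" "homogeneous q \<beta>" "length xs = p + q"
  shows "wedge \<alpha> \<beta> xs = shuffles_sum p q \<alpha> \<beta> xs"
  using assms
proof (induction p q \<alpha> \<beta> xs rule: shuffles_sum.induct)
  case (1 q \<alpha> \<beta> xs)
  have c: "contract x \<alpha> = (\<lambda>_. 0)" for x
    using 1(1) by (auto simp: homogeneous_def contract_def)
  show ?case
    by (induction xs arbitrary: \<beta>) (simp_all add: wedge_Cons[OF 1(1)] c, simp add: contract_def)
next
  case (2 p \<alpha> \<beta> xs)
  have c: "contract x \<beta> = (\<lambda>_. 0)" for x
    using 2(2) by (auto simp: homogeneous_def contract_def)
  have "wedge \<alpha> \<beta> xs = \<alpha> xs * \<beta> []" if "homogeneous k \<alpha>" "length xs = k" for k \<alpha>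
    using that
  proof (induction xs arbitrary: \<alpha> k)
    case (Cons x xs)
    then show ?case
      by (simp add: wedge_Cons[OF Cons(2)] c Cons.IH[of "length xs"] contract_homogeneous)
         (simp add: contract_def)
  qed simp
  then show ?case using 2 by simp
next
  case (4 p q \<alpha> \<beta> x xs)
  then show ?case
    by (simp add: wedge_Cons[OF 4(3)] contract_homogeneous)
qed simp

section \<open>Forms determined by their values on increasing tuples\<close>

text \<open>Only vanishing is transported, so the sign of the permutation need not be
  tracked.\<close>

lemma forms_perm_eq_0:
  assumes f: "\<alpha> \<in> forms k"
  shows "mset xs = mset ys \<Longrightarrow> \<alpha> (us @ ys) = 0 \<Longrightarrow> \<alpha> (us @ xs) = 0"
proof (induction xs arbitrary: us ys)
  case (Cons x xs)
  then have "x \<in> set ys" by (metis list.set_intros(1) set_mset_mset)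
  then obtain as bs where ys: "ys = as @ x # bs" by (meson split_list)
  have "\<alpha> (us @ x # as @ bs) = 0" if "\<alpha> (us @ as @ x # bs) = 0" for us
    using that
  proof (induction as arbitrary: us)
    case (Cons a as)
    then have "\<alpha> ((us @ [a]) @ x # as @ bs) = 0" by (intro Cons.IH) simp
    then show ?case using forms_swap[OF f, of us a x "as @ bs"] by simp
  qed simp
  then have "\<alpha> ((us @ [x]) @ as @ bs) = 0" using Cons.prems(2) ys by simp
  moreover have "mset xs = mset (as @ bs)" using Cons.prems(1) ys by simp
  ultimately have "\<alpha> ((us @ [x]) @ xs) = 0" using Cons.IH by blast
  then show ?case by simp
qed simp

lemma filter_in_subseqs: "filter P bs \<in> set (subseqs bs)"
  by (induction bs) (auto simp: Let_def)

text \<open>\<open>subseqs bs\<close> lists the increasing tuples, so an identity of forms becomes a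
  finite evaluation by the simplifier.\<close>

lemma forms_eqI:
  assumes f: "\<alpha> \<in> forms k" "\<beta> \<in> forms k" and bs: "distinct bs" "span (set bs) = UNIV"
    and eq: "\<And>ys. ys \<in> set (subseqs bs) \<Longrightarrow> length ys = k \<Longrightarrow> \<alpha> ys = \<beta> ys"
  shows "\<alpha> = \<beta>"
proof -
  define \<delta> where "\<delta> = (\<lambda>xs. \<alpha> xs - \<beta> xs)"
  have \<delta>: "\<delta> \<in> forms k" unfolding \<delta>_def using f by (rule forms_diff)
  have base: "\<delta> ys = 0" if "set ys \<subseteq> set bs" for ys
  proof (cases "distinct ys \<and> length ys = k")
    case True
    let ?zs = "filter (\<lambda>b. b \<in> set ys) bs"
    have "mset ys = mset ?zs"
      using True bs(1) that by (intro set_eq_iff_mset_eq_distinct[THEN iffD1]) auto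
    then have "length ?zs = k" using True mset_eq_length by fastforce
    then have "\<delta> ?zs = 0"
      using eq[OF filter_in_subseqs] unfolding \<delta>_def by simp
    then show ?thesis using forms_perm_eq_0[OF \<delta> \<open>mset ys = mset ?zs\<close>, of "[]"] by simp
  next
    case False
    then show ?thesis
      using forms_not_distinct[OF \<delta>] forms_homogeneous[OF \<delta>] by (auto simp: homogeneous_def)
  qed
  \<comment> \<open>Arguments are reduced to basis vectors one at a time from the right, while the
    prefix \<open>xs\<close> is arbitrary.\<close>
  have "\<delta> (xs @ ys) = 0" if "set ys \<subseteq> set bs" for xs ys
    using that
  proof (induction xs arbitrary: ys rule: rev_induct)
    case Nil
    then show ?case using base by simp
  next
    case (snoc v xs)
    have "\<delta> (xs @ b # ys) = 0" if "b \<in> set bs" for b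
      using snoc.IH[of "b # ys"] snoc.prems that by simp
    moreover have "v \<in> span (set bs)" using bs(2) by simp
    ultimately have "\<delta> (xs @ v # ys) = 0"
      using linear_eq_0_on_span[OF forms_linear[OF \<delta>, of xs ys]] by blast
    then show ?case by simp
  qed
  from this[of "[]"] have "\<delta> xs = 0" for xs by simp
  then show ?thesis by (auto simp: \<delta>_def)
qed

section \<open>Metric, volume form and Hodge dual of the standard form\<close>

lemma wedge_2_2:
  assumes "homogeneous 2 \<alpha>" "homogeneous 2 \<beta>"
  shows "wedge \<alpha> \<beta> [x, y, z, w] = \<alpha> [x, y] * \<beta> [z, w] - \<alpha> [x, z] * \<beta> [y, w] + \<alpha> [x, w] * \<beta> [y, z]
    + \<alpha> [y, z] * \<beta> [x, w] - \<alpha> [y, w] * \<beta> [x, z] + \<alpha> [z, w] * \<beta> [x, y]"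
  by (subst wedge_eq_shuffles_sum[OF assms])
     (simp_all add: numeral_eq_Suc contract_def)

lemma contract_homogeneous_2: "\<phi> \<in> forms 3 \<Longrightarrow> homogeneous 2 (contract v \<phi>)"
  using forms_homogeneous[of \<phi> 3] by (simp add: homogeneous_def contract_def)

lemma wedge_4_3:
  assumes "homogeneous 4 \<alpha>" "homogeneous 3 \<beta>"
  shows "wedge \<alpha> \<beta> [x1, x2, x3, x4, x5, x6, x7] =
      \<alpha> [x1, x2, x3, x4] * \<beta> [x5, x6, x7]
      - \<alpha> [x1, x2, x3, x5] * \<beta> [x4, x6, x7]
      + \<alpha> [x1, x2, x3, x6] * \<beta> [x4, x5, x7]
      - \<alpha> [x1, x2, x3, x7] * \<beta> [x4, x5, x6]
      + \<alpha> [x1, x2, x4, x5] * \<beta> [x3, x6, x7]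
      - \<alpha> [x1, x2, x4, x6] * \<beta> [x3, x5, x7]
      + \<alpha> [x1, x2, x4, x7] * \<beta> [x3, x5, x6]
      + \<alpha> [x1, x2, x5, x6] * \<beta> [x3, x4, x7]
      - \<alpha> [x1, x2, x5, x7] * \<beta> [x3, x4, x6]
      + \<alpha> [x1, x2, x6, x7] * \<beta> [x3, x4, x5]
      - \<alpha> [x1, x3, x4, x5] * \<beta> [x2, x6, x7]
      + \<alpha> [x1, x3, x4, x6] * \<beta> [x2, x5, x7]
      - \<alpha> [x1, x3, x4, x7] * \<beta> [x2, x5, x6]
      - \<alpha> [x1, x3, x5, x6] * \<beta> [x2, x4, x7]
      + \<alpha> [x1, x3, x5, x7] * \<beta> [x2, x4, x6]
      - \<alpha> [x1, x3, x6, x7] * \<beta> [x2, x4, x5]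
      + \<alpha> [x1, x4, x5, x6] * \<beta> [x2, x3, x7]
      - \<alpha> [x1, x4, x5, x7] * \<beta> [x2, x3, x6]
      + \<alpha> [x1, x4, x6, x7] * \<beta> [x2, x3, x5]
      - \<alpha> [x1, x5, x6, x7] * \<beta> [x2, x3, x4]
      + \<alpha> [x2, x3, x4, x5] * \<beta> [x1, x6, x7]
      - \<alpha> [x2, x3, x4, x6] * \<beta> [x1, x5, x7]
      + \<alpha> [x2, x3, x4, x7] * \<beta> [x1, x5, x6]
      + \<alpha> [x2, x3, x5, x6] * \<beta> [x1, x4, x7]
      - \<alpha> [x2, x3, x5, x7] * \<beta> [x1, x4, x6]
      + \<alpha> [x2, x3, x6, x7] * \<beta> [x1, x4, x5]
      - \<alpha> [x2, x4, x5, x6] * \<beta> [x1, x3, x7]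
      + \<alpha> [x2, x4, x5, x7] * \<beta> [x1, x3, x6]
      - \<alpha> [x2, x4, x6, x7] * \<beta> [x1, x3, x5]
      + \<alpha> [x2, x5, x6, x7] * \<beta> [x1, x3, x4]
      + \<alpha> [x3, x4, x5, x6] * \<beta> [x1, x2, x7]
      - \<alpha> [x3, x4, x5, x7] * \<beta> [x1, x2, x6]
      + \<alpha> [x3, x4, x6, x7] * \<beta> [x1, x2, x5]
      - \<alpha> [x3, x5, x6, x7] * \<beta> [x1, x2, x4]
      + \<alpha> [x4, x5, x6, x7] * \<beta> [x1, x2, x3]"
  by (subst wedge_eq_shuffles_sum[OF assms])
     (simp_all add: numeral_eq_Suc contract_def)

lemma wedge_contract_homogeneous:
  assumes "\<phi> \<in> forms 3"
  shows "homogeneous 4 (wedge (contract v \<phi>) (contract w \<phi>))"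
  using wedge_homogeneous[OF contract_homogeneous_2 contract_homogeneous_2, OF assms assms, of v w]
  by simp

lemma wedge_contract:
  assumes "\<phi> \<in> forms 3"
  shows "wedge (contract v \<phi>) (contract w \<phi>) [x, y, z, u] =
    \<phi> [v, x, y] * \<phi> [w, z, u] - \<phi> [v, x, z] * \<phi> [w, y, u] + \<phi> [v, x, u] * \<phi> [w, y, z]
    + \<phi> [v, y, z] * \<phi> [w, x, u] - \<phi> [v, y, u] * \<phi> [w, x, z] + \<phi> [v, z, u] * \<phi> [w, x, y]"
  using wedge_2_2[OF contract_homogeneous_2[OF assms, of v] contract_homogeneous_2[OF assms, of w]]
  by (simp add: contract_def)

lemma G2_b_apply:
  "G2_b \<phi> v w xs = 1/6 * wedge (wedge (contract v \<phi>) (contract w \<phi>)) \<phi> xs"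
  by (simp add: G2_b_def)

context
  fixes \<phi> :: "'a::real_vector form"
  assumes \<phi>: "\<phi> \<in> forms 3"
begin

lemmas G2_b_expand =
  G2_b_apply[of \<phi> v w "[x1, x2, x3, x4, x5, x6, x7]" for v w x1 x2 x3 x4 x5 x6 x7,
    unfolded wedge_4_3[OF wedge_contract_homogeneous[OF \<phi>] forms_homogeneous[OF \<phi>]]]

end

lemmas G2_b_simps = G2_b_expand wedge_contract


lemma G2_b_forms:
  assumes "\<phi> \<in> forms 3"
  shows "G2_b \<phi> v w \<in> forms 7"
proof -
  have "contract u \<phi> \<in> forms 2" for u using contract_forms[OF assms, of u] by simp
  then have "wedge (wedge (contract v \<phi>) (contract w \<phi>)) \<phi> \<in> forms (2 + 2 + 3)"
    using assms by (intro wedge_forms)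
  from forms_scale[OF this, of "1/6"] show ?thesis by (simp add: G2_b_def[abs_def])
qed

section \<open>The standard 3-form and its dual 4-form\<close>

lemma split_list_3:
  assumes "length (xs @ v # ys) = 3"
  obtains b c where "xs = []" "ys = [b, c]" | a c where "xs = [a]" "ys = [c]"
    | a b where "xs = [a, b]" "ys = []"
  using assms
  by (cases xs; cases "tl xs"; cases "tl (tl xs)"; cases ys; cases "tl ys"; cases "tl (tl ys)") auto

lemma split_list_4:
  assumes "length (xs @ v # ys) = 4"
  obtains b c d where "xs = []" "ys = [b, c, d]" | a c d where "xs = [a]" "ys = [c, d]"
    | a b d where "xs = [a, b]" "ys = [d]" | a b c where "xs = [a, b, c]" "ys = []"
proof (cases xs)
  case Nil
  then have "length ys = 3" using assms by simp
  then show ?thesis using Nil that(1) by (auto simp: numeral_eq_Suc length_Suc_conv)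
next
  case (Cons a as)
  then have "length (as @ v # ys) = 3" using assms by simp
  then show ?thesis by (rule split_list_3) (use Cons that in auto)
qed

fun phi0 :: "(real^7) form" where
  "phi0 [x, y, z] = cross7 x y \<bullet> z"
| "phi0 _ = 0"

fun psi_form :: "(real^7) form" where
  "psi_form [x, y, z, w] = psi0 x y z w"
| "psi_form _ = 0"

lemma phi0_homogeneous: "length xs \<noteq> 3 \<Longrightarrow> phi0 xs = 0"
  by (induction xs rule: phi0.induct) auto

lemma psi_form_homogeneous: "length xs \<noteq> 4 \<Longrightarrow> psi_form xs = 0"
  by (induction xs rule: psi_form.induct) auto

lemma cross7_orth: "cross7 y x \<bullet> x = 0" "cross7 x y \<bullet> x = 0"
  using cross7_skew[of y x x] cross7_skew[of x y x] by (simp_all add: inner_commute)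

lemma phi0_forms: "phi0 \<in> forms 3"
proof (rule forms_intro)
  show "homogeneous 3 phi0" by (simp add: homogeneous_def phi0_homogeneous)
  show "linear (\<lambda>v. phi0 (xs @ v # ys))" for xs ys
  \<comment> \<open>The length does not depend on the middle vector, so \<open>undefined\<close>
    holds its place.\<close>
  proof (cases "length (xs @ undefined # ys) = 3")
    case True
    then show ?thesis
      by (rule split_list_3) (auto intro!: linearI simp: cross7_simps inner_simps)
  next
    case False
    then have "(\<lambda>v. phi0 (xs @ v # ys)) = (\<lambda>_. 0)" by (intro ext phi0_homogeneous) simp
    then show ?thesis by (simp only: linear_zero)
  qed
  show "phi0 (xs @ x # x # ys) = 0" for xs x ys
  proof (cases "length (xs @ x # x # ys) = 3")
    case True
    then show ?thesis
      by (rule split_list_3) (auto simp: cross7_orth)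
  qed (rule phi0_homogeneous)
qed

lemma psi0_repeat: "psi0 x x z w = 0" "psi0 x y y w = 0" "psi0 x y z z = 0"
  using psi0_swap12[of x x z w] psi0_swap23[of x y y w] psi0_swap34[of x y z z] by simp_all

lemma psi_form_forms: "psi_form \<in> forms 4"
proof (rule forms_intro)
  show "homogeneous 4 psi_form" by (simp add: homogeneous_def psi_form_homogeneous)
  show "linear (\<lambda>v. psi_form (xs @ v # ys))" for xs ys
  proof (cases "length (xs @ undefined # ys) = 4")
    case True
    then show ?thesis
      by (rule split_list_4)
         (auto intro!: linearI simp: psi0_def cross7_simps inner_simps algebra_simps)
  next
    case False
    then have "(\<lambda>v. psi_form (xs @ v # ys)) = (\<lambda>_. 0)" by (intro ext psi_form_homogeneous) simp
    then show ?thesis by (simp only: linear_zero)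
  qed
  show "psi_form (xs @ x # x # ys) = 0" for xs x ys
  proof (cases "length (xs @ x # x # ys) = 4")
    case True
    then show ?thesis
      by (rule split_list_4) (auto simp: psi0_repeat)
  qed (rule psi_form_homogeneous)
qed

definition std :: "(real^7) list" where
  "std = [ax 1, ax 2, ax 3, ax 4, ax 5, ax 6, ax 7]"

lemma set_std: "set std = Basis"
  unfolding std_def by (auto simp: Basis_vec_def UNIV_7)

lemma std_basis: "distinct std" "span (set std) = UNIV"
  by (simp add: std_def axis_eq_axis) (simp add: set_std)

lemma subseqs_same_length:
  "ys \<in> set (subseqs xs) \<Longrightarrow> length ys \<le> length xs \<and> (length ys = length xs \<longrightarrow> ys = xs)"
  by (induction xs arbitrary: ys) (fastforce simp: Let_def)+

lemma forms_7_eqI: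
  assumes "\<alpha> \<in> forms 7" "\<beta> \<in> forms 7" "\<alpha> std = \<beta> std"
  shows "\<alpha> = \<beta>"
proof (rule forms_eqI[OF assms(1,2) std_basis])
  fix ys :: "(real^7) list"
  assume "ys \<in> set (subseqs std)" "length ys = 7"
  then have "ys = std" using subseqs_same_length[of ys std] by (simp add: std_def)
  then show "\<alpha> ys = \<beta> ys" using assms(3) by simp
qed

text \<open>In this form membership in \<open>forms 7\<close> is inherited from
  \<open>G2_b_forms\<close>, and the value 1 on \<open>std\<close> comes from
  \<open>G2_b_phi0_std\<close>.\<close>

definition vol7 :: "(real^7) form" where
  "vol7 = G2_b phi0 (ax 1) (ax 1)"

lemma vol7_forms: "vol7 \<in> forms 7"
  unfolding vol7_def by (rule G2_b_forms[OF phi0_forms])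

lemma phi0_axis:
  "phi0 [v, ax 1, ax 2] = v $ 3"
  "phi0 [v, ax 1, ax 3] = - v $ 2"
  "phi0 [v, ax 1, ax 4] = v $ 5"
  "phi0 [v, ax 1, ax 5] = - v $ 4"
  "phi0 [v, ax 1, ax 6] = v $ 7"
  "phi0 [v, ax 1, ax 7] = - v $ 6"
  "phi0 [v, ax 2, ax 3] = v $ 1"
  "phi0 [v, ax 2, ax 4] = v $ 6"
  "phi0 [v, ax 2, ax 5] = - v $ 7"
  "phi0 [v, ax 2, ax 6] = - v $ 4"
  "phi0 [v, ax 2, ax 7] = v $ 5"
  "phi0 [v, ax 3, ax 4] = - v $ 7"
  "phi0 [v, ax 3, ax 5] = - v $ 6"
  "phi0 [v, ax 3, ax 6] = v $ 5"
  "phi0 [v, ax 3, ax 7] = v $ 4"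
  "phi0 [v, ax 4, ax 5] = v $ 1"
  "phi0 [v, ax 4, ax 6] = v $ 2"
  "phi0 [v, ax 4, ax 7] = - v $ 3"
  "phi0 [v, ax 5, ax 6] = - v $ 3"
  "phi0 [v, ax 5, ax 7] = - v $ 2"
  "phi0 [v, ax 6, ax 7] = v $ 1"
  by (simp_all add: inner_axis axis_nth)

lemma G2_b_phi0_std: "G2_b phi0 v w std = v \<bullet> w"
  unfolding std_def
  by (simp add: G2_b_simps[OF phi0_forms] phi0_axis axis_nth inner_7 del: phi0.simps)

lemma vol7_std: "vol7 std = 1"
  by (simp add: vol7_def G2_b_phi0_std inner_axis)

lemma G2_b_phi0: "G2_b phi0 v w xs = (v \<bullet> w) * vol7 xs"
proof -
  have "G2_b phi0 v w = (\<lambda>xs. (v \<bullet> w) * vol7 xs)"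
    by (rule forms_7_eqI)
       (simp_all add: G2_b_forms phi0_forms forms_scale vol7_forms G2_b_phi0_std vol7_std)
  then show ?thesis by simp
qed

section \<open>Gram determinants and the volume form\<close>

lemma idx7_less: "idx7 i < 7" and of_nat_idx7: "of_nat (idx7 i) = i"
  and idx7_of_nat: "n < 7 \<Longrightarrow> idx7 (of_nat n) = n"
proof -
  have "inj_on (of_nat :: nat \<Rightarrow> 7) {..<7}"
  proof (rule inj_onI)
    fix a b :: nat
    assume ab: "a \<in> {..<7}" "b \<in> {..<7}" and e: "(of_nat a :: 7) = of_nat b"
    have 7: "x = 0 \<or> x = 1 \<or> x = 2 \<or> x = 3 \<or> x = 4 \<or> x = 5 \<or> x = 6" if "x \<in> {..<7}" for x :: nat
      using that by auto
    show "a = b" using 7[OF ab(1)] 7[OF ab(2)] e by (elim disjE) simp_all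
  qed
  moreover have "(of_nat :: nat \<Rightarrow> 7) ` {..<7} = UNIV"
  proof -
    have "x \<in> of_nat ` {..<7}" for x :: 7
    proof -
      have seven: "(7 :: 7) = 0" by simp
      have m: "of_nat n \<in> (of_nat :: nat \<Rightarrow> 7) ` {..<7}" if "n < 7" for n
        using that by blast
      show ?thesis
        using exhaust_7[of x] m[of 0] m[of 1] m[of 2] m[of 3] m[of 4] m[of 5] m[of 6] seven by auto
    qed
    then show ?thesis by blast
  qed
  ultimately have b: "bij_betw (of_nat :: nat \<Rightarrow> 7) {..<7} UNIV" by (simp add: bij_betw_def)
  show "idx7 i < 7"
    using bij_betw_apply[OF bij_betw_the_inv_into[OF b], of i] by (simp add: idx7_def)
  show "of_nat (idx7 i) = i"
    using f_the_inv_into_f_bij_betw[OF b, of i] by (simp add: idx7_def)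
  show "n < 7 \<Longrightarrow> idx7 (of_nat n) = n"
    using the_inv_into_f_f[OF bij_betw_imp_inj_on[OF b], of n] by (simp add: idx7_def)
qed

definition rows :: "(real^7) list \<Rightarrow> real^7^7" where
  "rows xs = (\<chi> i. xs ! idx7 i)"

definition det_form :: "(real^7) form" where
  "det_form xs = (if length xs = 7 then det (rows xs) else 0)"

lemma det_form_forms: "det_form \<in> forms 7"
proof (rule forms_intro)
  show "homogeneous 7 det_form" by (simp add: homogeneous_def det_form_def)
  show "linear (\<lambda>v. det_form (xs @ v # ys))" for xs ys
  proof (cases "length (xs @ undefined # ys) = 7")
    case True
    let ?k = "of_nat (length xs) :: 7"
    have k: "idx7 i = length xs \<longleftrightarrow> i = ?k" for i
      using True idx7_of_nat[of "length xs"] of_nat_idx7[of i] by auto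
    have r: "rows (xs @ v # ys) = (\<chi> i. if i = ?k then v else (xs @ 0 # ys) ! idx7 i)" for v
      by (auto simp: rows_def vec_eq_iff k[symmetric] nth_append nth_Cons')
    show ?thesis
      by (rule linearI)
         (use True in \<open>simp_all add: det_form_def r det_row_add det_row_mul flip:
             scalar_mult_eq_scaleR\<close>)
  next
    case False
    then show ?thesis by (simp add: det_form_def linear_zero)
  qed
  show "det_form (xs @ x # x # ys) = 0" for xs x ys
  proof (cases "length (xs @ x # x # ys) = 7")
    case True
    obtain i j :: 7 where l: "idx7 i = length xs" "idx7 j = Suc (length xs)"
      using True idx7_of_nat[of "length xs"] idx7_of_nat[of "Suc (length xs)"] by auto
    then have "i \<noteq> j" by (metis n_not_Suc_n)
    moreover have "row i (rows (xs @ x # x # ys)) = row j (rows (xs @ x # x # ys))"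
      by (simp add: row_def rows_def l nth_append)
    ultimately have "det (rows (xs @ x # x # ys)) = 0" by (rule det_identical_rows)
    then show ?thesis by (simp add: det_form_def)
  qed (simp add: det_form_def)
qed

lemma det_gram:
  assumes "length xs = 7"
  shows "det (\<chi> i j. xs ! idx7 i \<bullet> xs ! idx7 j) = (det_form xs)\<^sup>2"
proof -
  have "(\<chi> i j. xs ! idx7 i \<bullet> xs ! idx7 j) = rows xs ** transpose (rows xs)"
    by (simp add: matrix_matrix_mult_def transpose_def rows_def inner_vec_def vec_eq_iff)
  then show ?thesis
    using assms by (simp add: det_mul det_transpose det_form_def power2_eq_square)
qed

lemma std_nth: "n < 7 \<Longrightarrow> m < 7 \<Longrightarrow> std ! n \<bullet> std ! m = (if n = m then 1 else 0)"
proof -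
  have on: "x \<bullet> y = (if x = y then 1 else 0)" if "x \<in> set std" "y \<in> set std" for x y
    using that by (simp add: set_std inner_Basis)
  show "n < 7 \<Longrightarrow> m < 7 \<Longrightarrow> ?thesis"
    using std_basis(1) by (subst on) (simp_all add: nth_eq_iff_index_eq std_def[THEN
        arg_cong[where f = length], simplified])
qed

text \<open>\<open>det_form\<close> is a multiple of \<open>vol7\<close>, and the square of the
  factor is the Gram determinant of \<open>std\<close>. Squaring avoids the sign of the permutation
  by which \<open>idx7\<close> orders the rows.\<close>

lemma vol7_square:
  assumes "length xs = 7"
  shows "(vol7 xs)\<^sup>2 = det (\<chi> i j. xs ! idx7 i \<bullet> xs ! idx7 j)"
proof -
  have len: "length std = 7" by (simp add: std_def)
  have inj: "idx7 i = idx7 j \<longleftrightarrow> i = j" for i j by (metis of_nat_idx7)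
  have "(\<chi> i j. std ! idx7 i \<bullet> std ! idx7 j) = mat 1"
    by (simp add: std_nth idx7_less mat_def inj)
  then have s: "(det_form std)\<^sup>2 = 1" using det_gram[OF len] by simp
  have "det_form = (\<lambda>xs. det_form std * vol7 xs)"
    by (rule forms_7_eqI) (simp_all add: det_form_forms forms_scale vol7_forms vol7_std)
  then have "det_form xs = det_form std * vol7 xs" by metis
  then show ?thesis using s det_gram[OF assms] by (simp add: power_mult_distrib)
qed

lemma det_scale_7:
  fixes M :: "real^7^7"
  shows "det (\<chi> i j. M $ i $ j * c) = c ^ 7 * det M"
proof -
  have "det (\<chi> i. c *s M $ i) = prod (\<lambda>i. c) (UNIV :: 7 set) * det M"
    using det_rows_mul[of "\<lambda>_. c" "\<lambda>i::7. M $ i"] by simp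
  moreover have "(\<chi> i j. M $ i $ j * c) = (\<chi> i. c *s M $ i)"
    by (simp add: vec_eq_iff mult.commute)
  ultimately show ?thesis by simp
qed

text \<open>The matrix of the bilinear form is \<open>vol7 xs\<close> times the Gram matrix. Seven
  rows contribute the seventh power and the Gram determinant two more, which the ninth root
  undoes.\<close>

lemma G2_vol_phi0: "G2_vol phi0 = vol7"
proof
  fix xs
  show "G2_vol phi0 xs = vol7 xs"
  proof (cases "length xs = 7")
    case True
    have "det (\<chi> i j. G2_b phi0 (xs ! idx7 i) (xs ! idx7 j) xs)
      = vol7 xs ^ 7 * det (\<chi> i j. xs ! idx7 i \<bullet> xs ! idx7 j)"
      using det_scale_7[of "\<chi> i j. xs ! idx7 i \<bullet> xs ! idx7 j" "vol7 xs"] by (simp add: G2_b_phi0)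
    also have "\<dots> = vol7 xs ^ 9"
      by (simp flip: vol7_square[OF True] power_add)
    finally show ?thesis
      using True odd_real_root_power_cancel[of 9 "vol7 xs"] by (simp add: G2_vol_def)
  next
    case False
    then show ?thesis
      using forms_homogeneous[OF vol7_forms] by (simp add: G2_vol_def homogeneous_def)
  qed
qed

section \<open>The Hodge dual in an arbitrary orthonormal basis\<close>

lemma sum_Pow_nths_Cons:
  "(\<Sum>S\<in>Pow {..<Suc (length es)}. F (nths (x # es) S))
    = (\<Sum>S\<in>Pow {..<length es}. F (x # nths es S)) + (\<Sum>S\<in>Pow {..<length es}. F (nths es S))"
proof -
  have "nths (x # es) (insert 0 (Suc ` S)) = x # nths es S" "nths (x # es) (Suc ` S)
      = nths es S" for S
    by (auto simp: nths_Cons intro!: arg_cong2[where f = nths])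
  then show ?thesis by (simp only: sum_Pow_Suc sum.distrib)
qed

lemma sum_Pow_nths_subseqs:
  "(\<Sum>S\<in>Pow {..<length es}. F (nths es S)) = (\<Sum>xs\<leftarrow>subseqs es. F xs)"
proof (induction es arbitrary: F)
  case (Cons x es)
  show ?case
    using Cons[of "\<lambda>xs. F (x # xs)"] Cons[of F]
    by (simp add: sum_Pow_nths_Cons Let_def o_def)
qed simp

lemma sum_Pow_nths_0:
  assumes "\<And>xs. xs \<noteq> [] \<Longrightarrow> F xs = 0"
  shows "(\<Sum>S\<in>Pow {..<length es}. F (nths es S)) = F []"
  by (induction es) (simp_all add: sum_Pow_nths_Cons assms)

lemma sum_Pow_nths_1:
  assumes "\<And>xs. length xs \<noteq> 1 \<Longrightarrow> F xs = 0"
  shows "(\<Sum>S\<in>Pow {..<length es}. F (nths es S)) = (\<Sum>a\<leftarrow>es. F [a])"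
proof (induction es)
  case (Cons x es)
  have "(\<Sum>S\<in>Pow {..<length es}. F (x # nths es S)) = F [x]"
    by (rule sum_Pow_nths_0) (simp add: assms)
  then show ?case using Cons by (simp add: sum_Pow_nths_Cons)
qed (simp add: assms)

lemma sum_Pow_nths_2:
  fixes F :: "'a list \<Rightarrow> real"
  assumes h: "\<And>xs. length xs \<noteq> 2 \<Longrightarrow> F xs = 0"
    and s: "\<And>a b. F [b, a] = F [a, b]" and z: "\<And>a. F [a, a] = 0"
  shows "2 * (\<Sum>S\<in>Pow {..<length es}. F (nths es S)) = (\<Sum>a\<leftarrow>es. \<Sum>b\<leftarrow>es. F [a, b])"
proof (induction es)
  case (Cons x es)
  have "(\<Sum>S\<in>Pow {..<length es}. F (x # nths es S)) = (\<Sum>a\<leftarrow>es. F [x, a])"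
    by (rule sum_Pow_nths_1) (simp add: h)
  then show ?case using Cons
    by (simp add: sum_Pow_nths_Cons z sum_list_addf s[of x] distrib_left)
qed (simp add: h)

text \<open>Each subset of size three is met in all 3! orders and repetitions contribute nothing.
  The full sum on the right is a contraction, hence independent of the orthonormal basis.\<close>

lemma sum_Pow_nths_3:
  fixes F :: "'a list \<Rightarrow> real"
  assumes h: "\<And>xs. length xs \<noteq> 3 \<Longrightarrow> F xs = 0"
    and s: "\<And>a b c. F [b, a, c] = F [a, b, c]" "\<And>a b c. F [a, c, b] = F [a, b, c]"
    and z: "\<And>a b. F [a, a, b] = 0"
  shows "6 * (\<Sum>S\<in>Pow {..<length es}. F (nths es S)) = (\<Sum>a\<leftarrow>es. \<Sum>b\<leftarrow>es. \<Sum>c\<leftarrow>es. F [a, b, c])"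
proof (induction es)
  case (Cons x es)
  have z': "F [b, a, a] = 0" "F [a, b, a] = 0" for a b
    using z s by metis+
  have "2 * (\<Sum>S\<in>Pow {..<length es}. F (x # nths es S)) = (\<Sum>a\<leftarrow>es. \<Sum>b\<leftarrow>es. F [x, a, b])"
    by (rule sum_Pow_nths_2) (simp_all add: h s z z')
  moreover have "(\<Sum>a\<leftarrow>es. \<Sum>b\<leftarrow>es. F [a, x, b]) = (\<Sum>a\<leftarrow>es. \<Sum>b\<leftarrow>es. F [x, a, b])"
    by (simp only: s(1)[of _ x])
  moreover have "(\<Sum>a\<leftarrow>es. \<Sum>b\<leftarrow>es. F [a, b, x]) = (\<Sum>a\<leftarrow>es. \<Sum>b\<leftarrow>es. F [x, a, b])"
    by (simp only: s(2)[of _ _ x] s(1)[of _ x])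
  ultimately show ?case using Cons
    by (simp add: sum_Pow_nths_Cons z z' sum_list_addf distrib_left)
qed (simp add: h)

lemma sum_list_orthonormal:
  fixes es :: "(real^7) list" and B :: "real^7 \<Rightarrow> real^7 \<Rightarrow> real"
  assumes len: "length es = 7"
    and on: "\<And>i j. i < 7 \<Longrightarrow> j < 7 \<Longrightarrow> es ! i \<bullet> es ! j = (if i = j then 1 else 0)"
    and l: "\<And>y. linear (\<lambda>x. B x y)" and r: "\<And>x. linear (B x)"
  shows "(\<Sum>a\<leftarrow>es. B a a) = (\<Sum>i\<in>Basis. B i i)"
proof -
  let ?e = "\<lambda>n. es ! n"
  have expand: "v = (\<Sum>n<7. (v \<bullet> ?e n) *\<^sub>R ?e n)" for v
  proof -
    have e: "?e (idx7 i) \<bullet> ?e (idx7 j) = (if i = j then 1 else 0)" for i j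
      using on[OF idx7_less idx7_less, of i j] by (metis of_nat_idx7)
    have "(v - (\<Sum>n<7. (v \<bullet> ?e n) *\<^sub>R ?e n)) \<bullet> ?e (idx7 i) = 0" for i
    proof -
      have "(\<Sum>n<7. (v \<bullet> ?e n) *\<^sub>R ?e n) \<bullet> ?e (idx7 i)
        = (\<Sum>n<7. if n = idx7 i then v \<bullet> ?e n else 0)"
        unfolding inner_sum_left by (rule sum.cong) (simp_all add: on idx7_less)
      then show ?thesis by (simp add: inner_diff_left idx7_less)
    qed
    then have "v - (\<Sum>n<7. (v \<bullet> ?e n) *\<^sub>R ?e n) = 0"
      by (rule orthonormal_7_eq_0[OF e])
    then show ?thesis by simp
  qed
  have "(\<Sum>i\<in>Basis. B i i) = (\<Sum>i\<in>Basis. \<Sum>n<7. (i \<bullet> ?e n) * B i (?e n))"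
  proof (rule sum.cong[OF refl])
    fix i :: "real^7"
    show "B i i = (\<Sum>n<7. (i \<bullet> ?e n) * B i (?e n))"
      by (subst (2) expand[of i]) (simp add: linear_sum[OF r] linear_scale[OF r])
  qed
  also have "\<dots> = (\<Sum>n<7. \<Sum>i\<in>Basis. (?e n \<bullet> i) * B i (?e n))"
    by (subst sum.swap) (simp add: inner_commute)
  also have "\<dots> = (\<Sum>n<7. B (?e n) (?e n))"
    by (rule sum.cong[OF refl]) (subst (2) linear_sum_Basis[OF l], simp)
  also have "\<dots> = (\<Sum>a\<leftarrow>es. B a a)"
    using len by (simp add: sum_list_sum_nth atLeast0LessThan)
  finally show ?thesis by simp
qed

text \<open>The body of \<open>G2_hodge\<close> at \<open>phi0\<close>, with the chosen basis made a
  parameter.\<close>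

definition hodge_sum :: "(real^7) list \<Rightarrow> (real^7) form" where
  "hodge_sum es ys = (\<Sum>S\<in>Pow {..<length es}. phi0 (nths es S) * vol7 (nths es S @ ys))"

lemma hodge_sum_std: "hodge_sum std ys = vol7 ([ax 1, ax 2, ax 3] @ ys)
    + vol7 ([ax 1, ax 4, ax 5] @ ys) + vol7 ([ax 1, ax 6, ax 7] @ ys) + vol7 ([ax 2, ax 4, ax 6] @
        ys) - vol7 ([ax 2, ax 5, ax 7] @ ys) - vol7 ([ax 3, ax 4, ax 7] @ ys) - vol7 ([ax 3, ax 5,
            ax 6] @ ys)"
  unfolding hodge_sum_def sum_Pow_nths_subseqs[where F = "\<lambda>x. phi0 x * vol7 (x @ ys)"] std_def
  by (simp add: Let_def phi0_axis phi0_homogeneous axis_nth del: phi0.simps)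

lemma phi0_axis':
  "phi0 [v, ax 2, ax 1] = - v $ 3"
  "phi0 [v, ax 3, ax 1] = v $ 2"
  "phi0 [v, ax 4, ax 1] = - v $ 5"
  "phi0 [v, ax 5, ax 1] = v $ 4"
  "phi0 [v, ax 6, ax 1] = - v $ 7"
  "phi0 [v, ax 7, ax 1] = v $ 6"
  "phi0 [v, ax 3, ax 2] = - v $ 1"
  "phi0 [v, ax 4, ax 2] = - v $ 6"
  "phi0 [v, ax 5, ax 2] = v $ 7"
  "phi0 [v, ax 6, ax 2] = v $ 4"
  "phi0 [v, ax 7, ax 2] = - v $ 5"
  "phi0 [v, ax 4, ax 3] = v $ 7"
  "phi0 [v, ax 5, ax 3] = v $ 6"
  "phi0 [v, ax 6, ax 3] = - v $ 5"
  "phi0 [v, ax 7, ax 3] = - v $ 4"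
  "phi0 [v, ax 5, ax 4] = - v $ 1"
  "phi0 [v, ax 6, ax 4] = - v $ 2"
  "phi0 [v, ax 7, ax 4] = v $ 3"
  "phi0 [v, ax 6, ax 5] = v $ 3"
  "phi0 [v, ax 7, ax 5] = v $ 2"
  "phi0 [v, ax 7, ax 6] = - v $ 1"
  by (simp_all add: inner_axis axis_nth)

lemma vol7_axis:
  "vol7 [ax 1, ax 2, ax 3, ax 4, ax 5, ax 6, ax 7] = 1"
  "vol7 [ax 1, ax 4, ax 5, ax 2, ax 3, ax 6, ax 7] = 1"
  "vol7 [ax 1, ax 6, ax 7, ax 2, ax 3, ax 4, ax 5] = 1"
  "vol7 [ax 2, ax 4, ax 6, ax 1, ax 3, ax 5, ax 7] = 1"
  "vol7 [ax 2, ax 5, ax 7, ax 1, ax 3, ax 4, ax 6] = 1"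
  "vol7 [ax 3, ax 4, ax 7, ax 1, ax 2, ax 5, ax 6] = 1"
  "vol7 [ax 3, ax 5, ax 6, ax 1, ax 2, ax 4, ax 7] = 1"
  by (simp_all add: vol7_def G2_b_simps[OF phi0_forms] phi0_axis phi0_axis' axis_nth del:
      phi0.simps)

lemma forms_add:
  assumes "\<alpha> \<in> forms k" "\<beta> \<in> forms k"
  shows "(\<lambda>xs. \<alpha> xs + \<beta> xs) \<in> forms k"
  using assms by (auto simp: forms_def intro: linear_compose_add)

lemma length_std: "length std = 7"
  by (simp add: std_def)

lemma vol7_contract_forms: "(\<lambda>ys. vol7 ([a, b, c] @ ys)) \<in> forms 4"
  using contract_forms[OF contract_forms[OF contract_forms[OF vol7_forms, of a], of b], of c]
  by (simp add: contract_def)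

lemma hodge_sum_std_forms: "hodge_sum std \<in> forms 4"
  unfolding hodge_sum_std[abs_def] by (intro forms_add forms_diff vol7_contract_forms)

lemma hodge_sum_std_eq: "hodge_sum std = psi_form"
proof (rule forms_eqI[OF hodge_sum_std_forms psi_form_forms std_basis])
  fix ys :: "(real^7) list"
  assume "ys \<in> set (subseqs std)" "length ys = 4"
  then show "hodge_sum std ys = psi_form ys"
    unfolding hodge_sum_std
    by (auto simp: std_def Let_def vol7_axis psi0_axis axis_nth axis_eq_axis forms_not_distinct[OF
        vol7_forms])
qed

lemma sum_list_Basis_3:
  fixes es :: "(real^7) list"
  assumes len: "length es = 7"
    and on: "\<And>i j. i < 7 \<Longrightarrow> j < 7 \<Longrightarrow> es ! i \<bullet> es ! j = (if i = j then 1 else 0)"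
    and \<alpha>: "\<alpha> \<in> forms k" and \<beta>: "\<beta> \<in> forms l"
  shows "(\<Sum>a\<leftarrow>es. \<Sum>b\<leftarrow>es. \<Sum>c\<leftarrow>es. \<alpha> [a, b, c] * \<beta> ([a, b, c] @ ys))
    = (\<Sum>a\<in>Basis. \<Sum>b\<in>Basis. \<Sum>c\<in>Basis. \<alpha> [a, b, c] * \<beta> ([a, b, c] @ ys))"
proof -
  note s = sum_list_orthonormal[OF len on]
  have a: "linear (\<lambda>x. \<alpha> [x, b, c])" "linear (\<lambda>x. \<alpha> [b, x, c])" "linear (\<lambda>x. \<alpha> [b, c, x])" for b c
    using forms_linear[OF \<alpha>, of "[]"] forms_linear[OF \<alpha>, of "[b]" "[c]"] forms_linear[OF \<alpha>, of
        "[b, c]" "[]"]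
    by simp_all
  have b: "linear (\<lambda>x. \<beta> (x # b # c # ys))" "linear (\<lambda>x. \<beta> (b # x # c # ys))"
    "linear (\<lambda>x. \<beta> (b # c # x # ys))" for b c
    using forms_linear[OF \<beta>, of "[]"] forms_linear[OF \<beta>, of "[b]" "c # ys"] forms_linear[OF \<beta>, of
        "[b, c]" ys]
    by simp_all
  have m: "linear (\<lambda>x. g x * r)" "linear (\<lambda>x. r * g x)" if "linear g" for g :: "real^7 \<Rightarrow> real" and r
    using that by (auto intro!: linearI simp: linear_add linear_scale algebra_simps)
  have 1: "(\<Sum>c\<leftarrow>es. \<alpha> [a, b, c] * \<beta> ([a, b, c] @ ys)) = (\<Sum>c\<in>Basis. \<alpha> [a, b, c] * \<beta> ([a, b, c] @
      ys))" for a b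
    using s[of "\<lambda>x y. \<alpha> [a, b, x] * \<beta> ([a, b, y] @ ys)"] by (simp add: m a b)
  have 2: "(\<Sum>b\<leftarrow>es. \<Sum>c\<in>Basis. \<alpha> [a, b, c] * \<beta> ([a, b, c] @ ys))
    = (\<Sum>b\<in>Basis. \<Sum>c\<in>Basis. \<alpha> [a, b, c] * \<beta> ([a, b, c] @ ys))" for a
    using s[of "\<lambda>x y. \<Sum>c\<in>Basis. \<alpha> [a, x, c] * \<beta> ([a, y, c] @ ys)"]
    by (simp add: m a b linear_compose_sum)
  have 3: "(\<Sum>a\<leftarrow>es. \<Sum>b\<in>Basis. \<Sum>c\<in>Basis. \<alpha> [a, b, c] * \<beta> ([a, b, c] @ ys))
    = (\<Sum>a\<in>Basis. \<Sum>b\<in>Basis. \<Sum>c\<in>Basis. \<alpha> [a, b, c] * \<beta> ([a, b, c] @ ys))"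
    using s[of "\<lambda>x y. \<Sum>b\<in>Basis. \<Sum>c\<in>Basis. \<alpha> [x, b, c] * \<beta> ([y, b, c] @ ys)"]
    by (simp add: m a b linear_compose_sum)
  show ?thesis by (simp only: 1 2 3)
qed

text \<open>\<open>G2_hodge\<close> chooses its basis by \<open>SOME\<close>, so the value must be
  known for every orthonormal basis. Six times the sum is a triple contraction, which
  \<open>std\<close> computes.\<close>

lemma hodge_sum_orthonormal:
  assumes len: "length es = 7"
    and on: "\<And>i j. i < 7 \<Longrightarrow> j < 7 \<Longrightarrow> es ! i \<bullet> es ! j = (if i = j then 1 else 0)"
  shows "hodge_sum es = psi_form"
proof -
  have "hodge_sum es ys = hodge_sum std ys" for ys
  proof -
    let ?F = "\<lambda>xs. phi0 xs * vol7 (xs @ ys)"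
    have h: "?F xs = 0" if "length xs \<noteq> 3" for xs using that by (simp add: phi0_homogeneous)
    have s1: "?F [b, a, c] = ?F [a, b, c]" and s2: "?F [a, c, b] = ?F [a, b, c]" for a b c
      using forms_swap[OF phi0_forms, of "[]" b a "[c]"] forms_swap[OF vol7_forms, of "[]" b a "c
          # ys"]
        forms_swap[OF phi0_forms, of "[a]" c b "[]"] forms_swap[OF vol7_forms, of "[a]" c b ys]
      by simp_all
    have z: "?F [a, a, b] = 0" for a b by simp
    have "6 * hodge_sum fs ys = (\<Sum>a\<leftarrow>fs. \<Sum>b\<leftarrow>fs. \<Sum>c\<leftarrow>fs. ?F [a, b, c])" for fs
      unfolding hodge_sum_def by (rule sum_Pow_nths_3[where F = ?F, OF h s1 s2 z])
    then have "6 * hodge_sum es ys = 6 * hodge_sum std ys"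
      using sum_list_Basis_3[OF len on phi0_forms vol7_forms]
        sum_list_Basis_3[OF _ std_nth phi0_forms vol7_forms]
      by (simp add: std_def)
    then show ?thesis by simp
  qed
  then show ?thesis using hodge_sum_std_eq by auto
qed

section \<open>The differential on short lists and transport along a linear isomorphism\<close>

lemma ce_d_eq: "ce_d br \<alpha> xs = (\<Sum>j<length xs. \<Sum>i<j.
    (-1) ^ (i + j) * \<alpha> (br (xs ! i) (xs ! j) # nths xs (- {i, j})))"
proof -
  have "{(i, j). i < j \<and> j < length xs} = (\<lambda>(j, i). (i, j)) ` (SIGMA j:{..<length xs}. {..<j})"
    by auto
  moreover have "inj_on (\<lambda>(j, i). (i, j)) (SIGMA j:{..<length xs}. {..<j})"
    by (auto simp: inj_on_def)
  ultimately show ?thesis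
    by (simp add: ce_d_def sum.reindex case_prod_unfold sum.Sigma)
qed

lemma ce_d_4:
  "ce_d br \<alpha> [x, y, z, w] = - \<alpha> [br x y, z, w] + \<alpha> [br x z, y, w] - \<alpha> [br x w, y, z]
     - \<alpha> [br y z, x, w] + \<alpha> [br y w, x, z] - \<alpha> [br z w, x, y]"
  by (simp add: ce_d_eq nths_Cons lessThan_Suc)

lemma ce_d_5:
  "ce_d br \<alpha> [x, y, z, w, u] = - \<alpha> [br x y, z, w, u] + \<alpha> [br x z, y, w, u] - \<alpha> [br x w, y, z, u]
     + \<alpha> [br x u, y, z, w] - \<alpha> [br y z, x, w, u] + \<alpha> [br y w, x, z, u] - \<alpha> [br y u, x, z, w]
     - \<alpha> [br z w, x, y, u] + \<alpha> [br z u, x, y, w] - \<alpha> [br w u, x, y, z]"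
  by (simp add: ce_d_eq nths_Cons lessThan_Suc)

text \<open>As \<open>f\<close> is bijective, every list of vectors has the form
  \<open>map f xs\<close>, and identities of forms can be pulled back to the standard model.\<close>

locale G2_coframe =
  fixes f :: "real^7 \<Rightarrow> 'a::real_vector" and \<phi> :: "'a form"
  assumes linear_f: "linear f" and bij_f: "bij f" and phi_f: "\<phi> (map f xs) = phi0 xs"
begin

lemma list_eq: "\<exists>ys. xs = map f ys"
  using bij_f by (intro exI[of _ "map (inv f) xs"]) (simp add: o_def bij_is_surj surj_f_inv_f
      map_idI)

lemma G2_b_f: "G2_b \<phi> (f v) (f w) (map f xs) = G2_b phi0 v w xs"
proof -
  have c: "(\<lambda>xs. contract (f u) \<phi> (map f xs)) = contract u phi0" for u
    using phi_f[of "u # _"] by (simp add: contract_def)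
  have "wedge (wedge (contract (f v) \<phi>) (contract (f w) \<phi>)) \<phi> (map f xs)
    = wedge (wedge (contract v phi0) (contract w phi0)) phi0 xs"
    by (subst wedge_map) (simp add: phi_f wedge_map[of "contract _ _"] c)
  then show ?thesis by (simp add: G2_b_def)
qed

lemma G2_vol_f: "G2_vol \<phi> (map f xs) = vol7 xs"
proof -
  have "G2_vol \<phi> (map f xs) = G2_vol phi0 xs"
  proof (cases "length xs = 7")
    case True
    then have "(\<chi> i j. G2_b \<phi> (map f xs ! idx7 i) (map f xs ! idx7 j) (map f xs))
      = (\<chi> i j. G2_b phi0 (xs ! idx7 i) (xs ! idx7 j) xs)"
      by (simp add: idx7_less G2_b_f)
    then show ?thesis by (simp add: G2_vol_def)
  qed (simp add: G2_vol_def)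
  then show ?thesis by (simp add: G2_vol_phi0)
qed

lemma G2_metric_f: "G2_metric \<phi> (f v) (f w) = v \<bullet> w"
  unfolding G2_metric_def
proof (rule the_equality)
  show "\<forall>xs. G2_b \<phi> (f v) (f w) xs = (v \<bullet> w) * G2_vol \<phi> xs"
    using list_eq by (metis G2_b_f G2_b_phi0 G2_vol_f)
  fix r assume "\<forall>xs. G2_b \<phi> (f v) (f w) xs = r * G2_vol \<phi> xs"
  then have "G2_b \<phi> (f v) (f w) (map f std) = r * G2_vol \<phi> (map f std)" by blast
  then show "r = v \<bullet> w" by (simp add: G2_b_f G2_vol_f G2_b_phi0 vol7_std)
qed

lemma orthonormal_std: "orthonormal_basis (G2_metric \<phi>) (map f std)"
  unfolding orthonormal_basis_def
proof (intro conjI allI impI)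
  have i: "inj f" using bij_f by (rule bij_is_inj)
  show "distinct (map f std)"
    using std_basis(1) inj_on_subset[OF i subset_UNIV] by (simp add: distinct_map)
  have "independent (set std)" by (simp add: set_std independent_Basis)
  then show "independent (set (map f std))"
    using linear_independent_injective_image[OF linear_f, of "set std"] inj_on_subset[OF i
        subset_UNIV]
    by simp
  show "span (set (map f std)) = UNIV"
    using std_basis(2) bij_is_surj[OF bij_f] by (simp add: linear_span_image[OF linear_f])
  show "G2_metric \<phi> (map f std ! i) (map f std ! j) = (if i = j then 1 else 0)"
    if "i < length (map f std)" "j < length (map f std)" for i j
    using that std_nth[of i j] by (simp add: G2_metric_f length_std)
qed

lemma dim_UNIV: "dim (UNIV :: 'a set) = 7"
proof -
  have "dim (f ` UNIV) = dim (UNIV :: (real^7) set)"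
    using linear_f bij_is_inj[OF bij_f] by (intro dim_image_eq) (auto intro: inj_on_subset)
  then show ?thesis using bij_is_surj[OF bij_f] by simp
qed

text \<open>The chosen basis is known only to be orthonormal. The dimension fixes its length, and
  its pullback is an orthonormal list to which \<open>hodge_sum_orthonormal\<close> applies.\<close>

lemma G2_hodge_f: "G2_hodge \<phi> \<phi> (map f ys) = psi_form ys"
proof -
  define es where "es = (SOME es. orthonormal_basis (G2_metric \<phi>) es)"
  have es: "orthonormal_basis (G2_metric \<phi>) es"
    unfolding es_def using orthonormal_std by (rule someI)
  obtain es' where es': "es = map f es'" using list_eq by blast
  have "card (set es) = 7"
    using es dim_UNIV dim_eq_card[of "set es" "UNIV :: 'a set"]
    by (simp add: orthonormal_basis_def)
  then have len: "length es' = 7"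
    using es distinct_card[of es] by (simp add: orthonormal_basis_def es')
  have "es' ! i \<bullet> es' ! j = (if i = j then 1 else 0)" if "i < 7" "j < 7" for i j
    using es that len by (simp add: orthonormal_basis_def es' G2_metric_f)
  then have h: "hodge_sum es' = psi_form" by (rule hodge_sum_orthonormal[OF len])
  have "G2_hodge \<phi> \<phi> (map f ys)
    = (\<Sum>S\<in>Pow {..<length es}. \<phi> (nths es S) * G2_vol \<phi> (nths es S @ map f ys))"
    by (simp add: G2_hodge_def es_def[symmetric])
  also have "\<dots> = hodge_sum es' ys"
    unfolding hodge_sum_def es' by (simp add: nths_map phi_f G2_vol_f flip: map_append)
  finally show ?thesis by (simp add: h)
qed

theorem torsion_free_with_center:
  assumes lie: "lie_algebra br" and center: "lie_center br \<noteq> {0}"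
    and d: "ce_d br \<phi> = (\<lambda>_. 0)" "ce_d br (G2_hodge \<phi> \<phi>) = (\<lambda>_. 0)"
  shows "lie_abelian br \<or> lie_isomorphic br s7_bracket"
proof -
  define g where "g = inv f"
  have fg [simp]: "f (g x) = x" for x using bij_f by (simp add: g_def bij_is_surj surj_f_inv_f)
  have gf [simp]: "g (f x) = x" for x using bij_f by (simp add: g_def bij_is_inj inv_f_f)
  have lin_g: "linear g"
  proof (rule linearI)
    show "g (x + y) = g x + g y" for x y
      using gf[of "g x + g y"] by (simp add: linear_add[OF linear_f])
    show "g (c *\<^sub>R x) = c *\<^sub>R g x" for c x
      using gf[of "c *\<^sub>R g x"] by (simp add: linear_scale[OF linear_f])
  qed
  have bij_g: "bij g" using bij_f by (simp add: g_def bij_imp_bij_inv)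
  define br' where "br' x y = g (br (f x) (f y))" for x y
  have f_br': "f (br' x y) = br (f x) (f y)" for x y by (simp add: br'_def)
  have bil: "bilinear br" using lie by (simp add: lie_algebra_def)
  have lie': "lie_algebra br'"
    unfolding lie_algebra_def
  proof (intro conjI allI)
    show "bilinear br'"
      unfolding bilinear_def br'_def
      by (intro conjI allI linearI)
         (simp_all add: linear_add[OF linear_f] linear_scale[OF linear_f] linear_add[OF lin_g]
           linear_scale[OF lin_g] bilinear_ladd[OF bil] bilinear_radd[OF bil] bilinear_lmul[OF bil]
           bilinear_rmul[OF bil])
    show "br' x x = 0" for x using lie by (simp add: br'_def lie_algebra_def linear_0[OF lin_g])
    show "br' x (br' y z) + br' y (br' z x) + br' z (br' x y) = 0" for x y z
      using lie by (simp add: br'_def lie_algebra_def linear_0[OF lin_g] flip: linear_add[OF lin_g])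
  qed
  have center': "lie_center br' \<noteq> {0}"
  proof -
    have "0 \<in> lie_center br" using bilinear_lzero[OF bil] by (simp add: lie_center_def)
    then obtain z where z: "z \<in> lie_center br" "z \<noteq> 0" using center by blast
    then have "g z \<in> lie_center br'"
      by (simp add: lie_center_def br'_def linear_0[OF lin_g])
    moreover have "g z \<noteq> 0" using z(2) fg[of z] linear_0[OF linear_f] by metis
    ultimately show ?thesis by blast
  qed
  have "lie_abelian br' \<or> lie_isomorphic br' s7_bracket"
  proof (rule standard_torsion_free_with_center[OF lie' center'])
    fix x y z w u
    have "\<phi> [f a, f b, f c] = cross7 a b \<bullet> c" for a b c
      using phi_f[of "[a, b, c]"] by simp
    then show "- (cross7 (br' x y) z \<bullet> w) + cross7 (br' x z) y \<bullet> w - cross7 (br' x w) y \<bullet> z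
      - cross7 (br' y z) x \<bullet> w + cross7 (br' y w) x \<bullet> z - cross7 (br' z w) x \<bullet> y = 0"
      using fun_cong[OF d(1), of "[f x, f y, f z, f w]"] by (simp add: ce_d_4 flip: f_br')
    have "G2_hodge \<phi> \<phi> [f a, f b, f c, f e] = psi0 a b c e" for a b c e
      using G2_hodge_f[of "[a, b, c, e]"] by simp
    then show "- psi0 (br' x y) z w u + psi0 (br' x z) y w u - psi0 (br' x w) y z u
      + psi0 (br' x u) y z w - psi0 (br' y z) x w u + psi0 (br' y w) x z u - psi0 (br' y u) x z w
      - psi0 (br' z w) x y u + psi0 (br' z u) x y w - psi0 (br' w u) x y z = 0"
      using fun_cong[OF d(2), of "[f x, f y, f z, f w, f u]"] by (simp add: ce_d_5 flip: f_br')
  qed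
  then show ?thesis
  proof
    assume "lie_abelian br'"
    then have "br (f (g x)) (f (g y)) = f 0" for x y
      unfolding lie_abelian_def by (metis f_br')
    then show ?thesis by (simp add: lie_abelian_def linear_0[OF linear_f])
  next
    assume "lie_isomorphic br' s7_bracket"
    then obtain h where h: "linear h" "bij h" "\<And>x y. h (br' x y) = s7_bracket (h x) (h y)"
      by (auto simp: lie_isomorphic_def)
    have "linear (h \<circ> g)" by (rule linear_compose[OF lin_g h(1)])
    moreover have "bij (h \<circ> g)" using bij_g h(2) by (rule bij_comp)
    moreover have "(h \<circ> g) (br x y) = s7_bracket ((h \<circ> g) x) ((h \<circ> g) y)" for x y
      using h(3)[of "g x" "g y"] by (simp add: br'_def)
    ultimately show ?thesis unfolding lie_isomorphic_def by blast
  qed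
qed

end

section \<open>Normal form of definite 3-forms\<close>

lemma exists_linear_iso_7:
  assumes "dim (UNIV :: 'a::real_vector set) = 7"
  obtains h :: "real^7 \<Rightarrow> 'a::real_vector" where "linear h" "bij h"
proof -
  obtain B :: "'a set" where B: "independent B" "UNIV \<subseteq> span B" "card B = 7"
    using basis_exists[of "UNIV :: 'a set"] assms by metis
  have "finite B" using B(3) by (metis card.infinite zero_neq_numeral)
  then obtain b where b: "bij_betw b (Basis :: (real^7) set) B"
    using finite_same_card_bij[of "Basis :: (real^7) set" B] B(3) by auto
  obtain g where g: "linear g" "\<forall>x\<in>Basis. g x = b x" "range g = span (b ` (Basis :: (real^7) set))"
    using linear_independent_extend_subspace[OF independent_Basis, of b] by blast
  obtain k :: "'a \<Rightarrow> real^7" where k: "linear k" "\<forall>x\<in>B. k x = inv_into Basis b x"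
    using linear_independent_extend[OF B(1), of "inv_into Basis b"] by blast
  have "k (g x) = x" if "x \<in> Basis" for x
    using g(2) k(2) that b by (simp add: bij_betw_apply bij_betw_inv_into_left)
  then have "k \<circ> g = id"
    by (intro linear_eq_stdbasis[OF linear_compose[OF g(1) k(1)] linear_id]) auto
  then have "inj g" by (metis inj_on_id inj_on_imageI2)
  moreover have "surj g"
    using g(3) b B(2) by (auto simp: bij_betw_def)
  ultimately show ?thesis using that g(1) by (simp add: bij_def)
qed

section \<open>From the rank condition to a definite bilinear form\<close>

definition radical :: "'a::real_vector form \<Rightarrow> 'a \<Rightarrow> 'a set" where
  "radical \<phi> v = {u. \<forall>w. \<phi> [v, u, w] = 0}"

lemma radical_contract:
  fixes v :: "'a::real_vector"
  shows "form_rank (contract v \<phi>) = dim (UNIV :: 'a set) - dim (radical \<phi> v)"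
  by (simp add: form_rank_def radical_def contract_def)

lemma form3_linear:
  assumes "\<phi> \<in> forms 3"
  shows "linear (\<lambda>x. \<phi> [x, y, z])" "linear (\<lambda>x. \<phi> [y, x, z])" "linear (\<lambda>x. \<phi> [y, z, x])"
  using forms_linear[OF assms, of "[]"] forms_linear[OF assms, of "[y]" "[z]"]
    forms_linear[OF assms, of "[y, z]" "[]"] by simp_all

lemma form3_swap:
  assumes "\<phi> \<in> forms 3"
  shows "\<phi> [y, x, z] = - \<phi> [x, y, z]" "\<phi> [x, z, y] = - \<phi> [x, y, z]"
  using forms_swap[OF assms, of "[]" y x "[z]"] forms_swap[OF assms, of "[x]" z y "[]"] by simp_all

lemma form3_repeat:
  assumes "\<phi> \<in> forms 3"
  shows "\<phi> [x, x, z] = 0" "\<phi> [x, z, x] = 0" "\<phi> [z, x, x] = 0"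
  by (rule forms_not_distinct[OF assms]; simp)+

lemma dim_real7: "dim (UNIV :: (real^7) set) = 7"
  by simp

lemma radical_eq_span:
  fixes \<phi> :: "(real^7) form"
  assumes \<phi>: "\<phi> \<in> forms 3" and "form_rank (contract v \<phi>) = 6" and "v \<noteq> 0"
  shows "radical \<phi> v = span {v}"
proof -
  have "dim (radical \<phi> v) = 1"
    using assms(2) by (simp add: radical_contract)
  moreover have "subspace (radical \<phi> v)"
    by (simp add: subspace_def radical_def linear_add[OF form3_linear(2)[OF \<phi>]]
        linear_scale[OF form3_linear(2)[OF \<phi>]] linear_0[OF form3_linear(2)[OF \<phi>]])
  moreover have "span {v} \<subseteq> radical \<phi> v"
    using calculation(2) by (intro span_minimal) (simp_all add: radical_def form3_repeat[OF \<phi>])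
  ultimately show ?thesis
    using assms(3) by (intro subspace_dim_equal[symmetric]) auto
qed

text \<open>One step towards a Darboux basis of the contraction with \<open>v\<close>. If the 2-form
  vanished on the complement \<open>?W\<close> of \<open>X\<close>, then \<open>?W\<close> would lie
  in the radical, the line of \<open>v\<close>, and the dimension would be at most 1 + card
  X.\<close>

lemma symplectic_step:
  fixes \<phi> :: "(real^7) form"
  assumes \<phi>: "\<phi> \<in> forms 3" and rad: "radical \<phi> v = span {v}"
    and X: "finite X" "card X < 6"
    and proj: "\<And>u. \<exists>p\<in>span X. \<forall>x\<in>X. \<phi> [v, x, u - p] = 0"
  obtains y z where "\<phi> [v, y, z] = 1" "\<And>x. x \<in> X \<Longrightarrow> \<phi> [v, x, y] = 0" "\<And>x. x \<in> X \<Longrightarrow> \<phi> [v, x, z] = 0"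
proof -
  note lin = form3_linear[OF \<phi>]
  let ?W = "{u. \<forall>x\<in>X. \<phi> [v, x, u] = 0}"
  have "\<exists>y\<in>?W. \<exists>z\<in>?W. \<phi> [v, y, z] \<noteq> 0"
  proof (rule ccontr)
    assume "\<not> ?thesis"
    then have W0: "\<phi> [v, y, z] = 0" if "y \<in> ?W" "z \<in> ?W" for y z using that by blast
    have "w \<in> span {v}" if w: "w \<in> ?W" for w
    proof -
      have "\<phi> [v, w, u] = 0" for u
      proof -
        obtain p where p: "p \<in> span X" "\<forall>x\<in>X. \<phi> [v, x, u - p] = 0" using proj by blast
        have "\<phi> [v, w, p] = 0"
        proof (rule linear_eq_0_on_span[OF lin(3) _ p(1)])
          show "\<phi> [v, w, x] = 0" if "x \<in> X" for x
            using w that form3_swap(2)[OF \<phi>, of v w x] by simp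
        qed
        moreover have "\<phi> [v, w, u - p] = 0" using W0[OF w] p(2) by blast
        ultimately show ?thesis using linear_diff[OF lin(3)[of v w], of u p] by simp
      qed
      then show ?thesis using rad by (auto simp: radical_def)
    qed
    then have "u \<in> span (insert v X)" for u
    proof -
      obtain p where p: "p \<in> span X" "\<forall>x\<in>X. \<phi> [v, x, u - p] = 0" using proj by blast
      then have "u - p \<in> span {v}" using \<open>\<And>w. w \<in> ?W \<Longrightarrow> w \<in> span {v}\<close> by blast
      then have "u - p \<in> span (insert v X)" "p \<in> span (insert v X)"
        using p(1) by (auto elim: rev_subsetD intro!: span_mono)
      then have "(u - p) + p \<in> span (insert v X)" by (rule span_add)
      then show ?thesis by simp
    qed
    then have "span (insert v X) = UNIV" by blast
    then have "dim (insert v X) = 7" by (metis (no_types) dim_span dim_real7)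
    moreover have "dim (insert v X) \<le> card (insert v X)" using X(1) by (intro dim_le_card') auto
    moreover have "card (insert v X) \<le> Suc (card X)" by (rule card_insert_le_m1) auto
    ultimately show False using X(2) by simp
  qed
  then obtain y z where yz: "y \<in> ?W" "z \<in> ?W" "\<phi> [v, y, z] \<noteq> 0" by blast
  show ?thesis
  proof
    show "\<phi> [v, y, z /\<^sub>R \<phi> [v, y, z]] = 1"
      using yz(3) by (simp add: linear_scale[OF lin(3)])
    show "\<phi> [v, x, y] = 0" "\<phi> [v, x, z /\<^sub>R \<phi> [v, y, z]] = 0" if "x \<in> X" for x
      using that yz(1,2) by (simp_all add: linear_scale[OF lin(3)])
  qed
qed

text \<open>Contracting b(v,v) with \<open>v\<close> leaves one sixth of the cube of the 2-form
  \<omega> obtained from \<phi>. The cube is 6 on a Darboux basis of \<omega>, so \<open>v\<close>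
  followed by that basis gives 1.\<close>

lemma G2_b_nonzero:
  fixes \<phi> :: "(real^7) form"
  assumes \<phi>: "\<phi> \<in> forms 3" and "form_rank (contract v \<phi>) = 6" and "v \<noteq> 0"
  shows "G2_b \<phi> v v std \<noteq> 0"
proof
  assume 0: "G2_b \<phi> v v std = 0"
  note lin = form3_linear(3)[OF \<phi>, of v]
  note rep = form3_repeat[OF \<phi>]
  note rad = radical_eq_span[OF assms]
  obtain x1 x2 where 1: "\<phi> [v, x1, x2] = 1"
    by (rule symplectic_step[OF \<phi> rad, of "{}"]) auto
  have "\<exists>p\<in>span {x1, x2}. \<forall>x\<in>{x1, x2}. \<phi> [v, x, u - p] = 0" for u
  proof (intro bexI ballI)
    \<comment> \<open>The symplectic projection of \<open>u\<close> to the plane of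
      \<open>x1\<close> and \<open>x2\<close>.\<close>
    show "(- \<phi> [v, x2, u]) *\<^sub>R x1 + \<phi> [v, x1, u] *\<^sub>R x2 \<in> span {x1, x2}"
      by (intro span_add span_scale span_base) auto
    fix x assume "x \<in> {x1, x2}"
    then show "\<phi> [v, x, u - ((- \<phi> [v, x2, u]) *\<^sub>R x1 + \<phi> [v, x1, u] *\<^sub>R x2)] = 0"
      using 1 form3_swap(2)[OF \<phi>, of v x2 x1]
      by (auto simp: linear_diff[OF lin] linear_add[OF lin] linear_scale[OF lin] rep)
  qed
  note proj2 = this
  have "card {x1, x2} < 6" using card_length[of "[x1, x2]"] by simp
  then have "\<exists>x3 x4. \<phi> [v, x3, x4] = 1 \<and> (\<forall>x\<in>{x1, x2}. \<phi> [v, x, x3] = 0)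
      \<and> (\<forall>x\<in>{x1, x2}. \<phi> [v, x, x4] = 0)"
    using symplectic_step[OF \<phi> rad _ _ proj2] by (metis finite.emptyI finite.insertI)
  then obtain x3 x4 where 2: "\<phi> [v, x3, x4] = 1" "\<phi> [v, x1, x3] = 0" "\<phi> [v, x2, x3] = 0"
    "\<phi> [v, x1, x4] = 0" "\<phi> [v, x2, x4] = 0"
    by auto
  have "\<exists>p\<in>span {x1, x2, x3, x4}. \<forall>x\<in>{x1, x2, x3, x4}. \<phi> [v, x, u - p] = 0" for u
  proof (intro bexI ballI)
    let ?p = "((- \<phi> [v, x2, u]) *\<^sub>R x1 + \<phi> [v, x1, u] *\<^sub>R x2) + ((- \<phi> [v, x4, u]) *\<^sub>R x3
        + \<phi> [v, x3, u] *\<^sub>R x4)"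
    show "?p \<in> span {x1, x2, x3, x4}"
      by (intro span_add span_scale span_base) auto
    fix x assume "x \<in> {x1, x2, x3, x4}"
    then show "\<phi> [v, x, u - ?p] = 0"
      using 1 2 form3_swap(2)[OF \<phi>, of v x2 x1] form3_swap(2)[OF \<phi>, of v x4 x3]
        form3_swap(2)[OF \<phi>, of v x3 x1] form3_swap(2)[OF \<phi>, of v x4 x1]
        form3_swap(2)[OF \<phi>, of v x3 x2] form3_swap(2)[OF \<phi>, of v x4 x2]
      by (auto simp: linear_diff[OF lin] linear_add[OF lin] linear_scale[OF lin] rep)
  qed
  note proj4 = this
  have "card {x1, x2, x3, x4} < 6" using card_length[of "[x1, x2, x3, x4]"] by simp
  then have "\<exists>x5 x6. \<phi> [v, x5, x6] = 1 \<and> (\<forall>x\<in>{x1, x2, x3, x4}. \<phi> [v, x, x5] = 0)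
      \<and> (\<forall>x\<in>{x1, x2, x3, x4}. \<phi> [v, x, x6] = 0)"
    using symplectic_step[OF \<phi> rad _ _ proj4] by (metis finite.emptyI finite.insertI)
  then obtain x5 x6 where 3: "\<phi> [v, x5, x6] = 1"
    "\<phi> [v, x1, x5] = 0" "\<phi> [v, x2, x5] = 0" "\<phi> [v, x3, x5] = 0" "\<phi> [v, x4, x5] = 0"
    "\<phi> [v, x1, x6] = 0" "\<phi> [v, x2, x6] = 0" "\<phi> [v, x3, x6] = 0" "\<phi> [v, x4, x6] = 0"
    by auto
  have "G2_b \<phi> v v [v, x1, x2, x3, x4, x5, x6] = 1"
    by (simp add: G2_b_simps[OF \<phi>] rep 1 2 3)
  moreover have "G2_b \<phi> v v = (\<lambda>_. 0)"
    by (rule forms_7_eqI) (simp_all add: G2_b_forms[OF \<phi>] forms_zero 0)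
  ultimately show False by simp
qed

lemma contract_add:
  assumes "\<phi> \<in> forms k"
  shows "contract (v + w) \<phi> = (\<lambda>xs. contract v \<phi> xs + contract w \<phi> xs)"
    and "contract (c *\<^sub>R v) \<phi> = (\<lambda>xs. c * contract v \<phi> xs)"
proof -
  have "linear (\<lambda>v. \<phi> (v # xs))" for xs using forms_linear[OF assms, of "[]"] by simp
  from linear_add[OF this] linear_scale[OF this]
  show "contract (v + w) \<phi> = (\<lambda>xs. contract v \<phi> xs + contract w \<phi> xs)"
    and "contract (c *\<^sub>R v) \<phi> = (\<lambda>xs. c * contract v \<phi> xs)"
    unfolding contract_def by (auto simp only: real_scaleR_def)
qed

lemma wedge_left_linear:
  "wedge (\<lambda>xs. \<alpha> xs + \<beta> xs) \<gamma> xs = wedge \<alpha> \<gamma> xs + wedge \<beta> \<gamma> xs"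
  "wedge (\<lambda>xs. c * \<alpha> xs) \<gamma> xs = c * wedge \<alpha> \<gamma> xs"
  by (simp_all add: wedge_def sum.distrib sum_distrib_left algebra_simps)

lemma G2_b_commute:
  assumes \<phi>: "\<phi> \<in> forms 3"
  shows "G2_b \<phi> v w = G2_b \<phi> w v"
proof -
  have "wedge (contract v \<phi>) (contract w \<phi>) xs = wedge (contract w \<phi>) (contract v \<phi>) xs" for xs
  proof (cases "length xs = 4")
    case True
    then obtain a b c d where "xs = [a, b, c, d]"
      by (auto simp: numeral_eq_Suc length_Suc_conv)
    then show ?thesis by (simp add: wedge_contract[OF \<phi>])
  next
    case False
    then show ?thesis
      using wedge_contract_homogeneous[OF \<phi>] by (simp add: homogeneous_def)
  qed
  then have "wedge (contract v \<phi>) (contract w \<phi>) = wedge (contract w \<phi>) (contract v \<phi>)" by blast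
  then show ?thesis by (simp add: G2_b_def)
qed

lemma G2_b_bilinear:
  assumes \<phi>: "\<phi> \<in> forms 3"
  shows "bilinear (\<lambda>v w. G2_b \<phi> v w xs)"
proof -
  have "linear (\<lambda>v. G2_b \<phi> v w xs)" for w
    by (rule linearI)
       (simp_all add: G2_b_def contract_add[OF \<phi>] wedge_left_linear[abs_def] algebra_simps)
  moreover have "(\<lambda>w. G2_b \<phi> v w xs) = (\<lambda>w. G2_b \<phi> w v xs)" for v
    by (rule ext) (rule fun_cong[OF G2_b_commute[OF \<phi>]])
  ultimately show ?thesis by (simp add: bilinear_def)
qed

text \<open>Opposite signs at \<open>e\<close> and \<open>v\<close> would force a zero of the
  quadratic form on the segment between them. By \<open>nz\<close> the segment then passes through
  the origin, so \<open>v\<close> is a multiple of \<open>e\<close>, against the opposite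
  signs.\<close>

lemma G2_b_definite:
  fixes \<phi> :: "(real^7) form"
  assumes \<phi>: "\<phi> \<in> forms 3" and nz: "\<And>v. v \<noteq> 0 \<Longrightarrow> G2_b \<phi> v v std \<noteq> 0"
  obtains s where "s \<noteq> 0" "\<And>v. v \<noteq> 0 \<Longrightarrow> s * G2_b \<phi> v v std > 0"
proof -
  define q where "q v w = G2_b \<phi> v w std" for v w
  have bil: "bilinear q" unfolding q_def by (rule G2_b_bilinear[OF \<phi>])
  have sym: "q v w = q w v" for v w by (simp add: q_def G2_b_commute[OF \<phi>])
  define e :: "real^7" where "e = ax 1"
  have e: "e \<noteq> 0" by (simp add: e_def)
  have qe: "q e e \<noteq> 0" using nz[OF e] by (simp add: q_def)
  have "q e e * q v v > 0" if v: "v \<noteq> 0" for v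
  proof (rule ccontr)
    assume "\<not> ?thesis"
    moreover have "q v v \<noteq> 0" using nz[OF v] by (simp add: q_def)
    ultimately have neg: "q e e * q v v < 0" using qe by (simp add: not_less less_le)
    define g where "g t = q e e * q (e + t *\<^sub>R (v - e)) (e + t *\<^sub>R (v - e))" for t
    have "g t = q e e * (q e e + 2 * t * q e (v - e) + t * t * q (v - e) (v - e))" for t
      unfolding g_def bilinear_ladd[OF bil] bilinear_radd[OF bil] bilinear_lmul[OF bil]
          bilinear_rmul[OF bil]
      using sym[of "v - e" e] by (simp add: algebra_simps)
    then have "continuous_on {0..1} g" by (simp add: continuous_intros)
    moreover have "g 0 \<ge> 0" "g 1 \<le> 0" using neg by (simp_all add: g_def)
    ultimately obtain t where t: "0 \<le> t" "t \<le> 1" "g t = 0"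
      using IVT2'[of g 1 0 0] by auto
    then have "q (e + t *\<^sub>R (v - e)) (e + t *\<^sub>R (v - e)) = 0" using qe by (simp add: g_def)
    then have "e + t *\<^sub>R (v - e) = 0" using nz unfolding q_def by blast
    then have tv: "t *\<^sub>R v = (t - 1) *\<^sub>R e" by (simp add: algebra_simps)
    then have "q (t *\<^sub>R v) (t *\<^sub>R v) = q ((t - 1) *\<^sub>R e) ((t - 1) *\<^sub>R e)" by simp
    then have "t * t * q v v = (t - 1) * (t - 1) * q e e"
      by (simp only: bilinear_lmul[OF bil] bilinear_rmul[OF bil] real_scaleR_def mult.assoc)
    then have "t * t * (q e e * q v v) = (t - 1) * (t - 1) * (q e e * q e e)" by algebra
    moreover have "(t - 1) * (t - 1) * (q e e * q e e) \<ge> 0" by simp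
    ultimately have "t * t * (q e e * q v v) \<ge> 0" by (simp only:)
    then have nonneg: "\<not> t * t * (q e e * q v v) < 0" by simp
    have "t = 0"
    proof (rule ccontr)
      assume "t \<noteq> 0"
      then have "t * t > 0" by (simp flip: power2_eq_square)
      then show False using nonneg mult_pos_neg[OF _ neg] by blast
    qed
    then show False using tv e by simp
  qed
  then show ?thesis using that[of "q e e"] qe by (simp add: q_def)
qed

lemma orthonormal_independent:
  assumes bil: "bilinear g" and on: "\<And>x y. x \<in> F \<Longrightarrow> y \<in> F \<Longrightarrow> g x y = (if x = y then 1 else (0::real))"
  shows "independent F"
proof
  assume "dependent F"
  then obtain x where x: "x \<in> F" "x \<in> span (F - {x})" by (auto simp: dependent_def)
  have "linear (g x)" using bil by (simp add: bilinear_def)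
  then have "g x x = 0"
    by (rule linear_eq_0_on_span[OF _ _ x(2)]) (use on x(1) in auto)
  then show False using on x(1) by simp
qed

text \<open>\<open>h\<close> takes the standard basis to an orthonormal basis of \<open>g\<close>.
  Pulling back also multiplies 7-forms by the volume of \<open>h\<close>, which together with
  \<open>s\<close> makes up \<kappa>.\<close>

lemma exists_metric_normalization:
  fixes \<phi> :: "(real^7) form"
  assumes \<phi>: "\<phi> \<in> forms 3" and nz: "\<And>v. v \<noteq> 0 \<Longrightarrow> G2_b \<phi> v v std \<noteq> 0"
  obtains h \<kappa> where "linear h" "bij h" "\<kappa> \<noteq> 0"
    "\<And>v w xs. G2_b (\<lambda>xs. \<phi> (map h xs)) v w xs = \<kappa> * (v \<bullet> w) * vol7 xs"
proof -
  obtain s where s: "s \<noteq> 0" "\<And>v. v \<noteq> 0 \<Longrightarrow> s * G2_b \<phi> v v std > 0"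
    using G2_b_definite[OF \<phi> nz] by blast
  define g where "g v w = s * G2_b \<phi> v w std" for v w
  have bil: "bilinear g"
    using G2_b_bilinear[OF \<phi>, of std] unfolding bilinear_def g_def
    by (auto intro!: linear_compose_scale_right[where 'b = real, simplified])
  have sym: "g v w = g w v" for v w by (simp add: g_def G2_b_commute[OF \<phi>, of v w])
  have pos: "g v v > 0" if "v \<noteq> 0" for v using s(2)[OF that] by (simp add: g_def)
  obtain F where F: "finite F" "span F = span (Basis :: (real^7) set)"
    "\<forall>x\<in>F. \<forall>y\<in>F. g x y = (if x = y then 1 else 0)"
    using exists_orthonormal_set[OF finite_Basis bil sym pos] by blast
  have "independent F" using orthonormal_independent[OF bil] F(3) by blast
  then have "card F = 7"
    using dim_eq_card[of F "UNIV :: (real^7) set"] F(2) by simp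
  then obtain b where b: "bij_betw b (Basis :: (real^7) set) F"
    using finite_same_card_bij[of "Basis :: (real^7) set" F] F(1) by auto
  obtain h where h: "linear h" "\<forall>x\<in>Basis. h x = b x"
    using linear_independent_extend[OF independent_Basis, of b] by blast
  have gb: "g (h i) (h j) = i \<bullet> j" if "i \<in> Basis" "j \<in> Basis" for i j
    using that h(2) F(3) b by (auto simp: inner_Basis bij_betw_def inj_on_def)
  have gh: "g (h v) (h w) = v \<bullet> w" for v w
  proof -
    have l: "linear (\<lambda>v. g (h v) y)" "linear (\<lambda>v. g y (h v))" for y
      using bil linear_compose[OF h(1)] by (auto simp: bilinear_def o_def)
    have "(\<lambda>w. g (h i) (h w)) = (\<lambda>w. i \<bullet> w)" if "i \<in> Basis" for i
      by (rule linear_eq_stdbasis[OF l(2)]) (auto intro!: linearI simp: inner_simps gb that)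
    then have "(\<lambda>v. g (h v) (h w)) = (\<lambda>v. v \<bullet> w)"
      by (intro linear_eq_stdbasis[OF l(1)]) (auto intro!: linearI simp: inner_simps dest: fun_cong)
    then show ?thesis by (rule fun_cong)
  qed
  have "inj h"
    unfolding linear_injective_0[OF h(1)]
    using gh bilinear_lzero[OF bil] by (metis inner_eq_zero_iff)
  then have bij: "bij h"
    using linear_injective_imp_surjective[OF h(1)] by (simp add: bij_def)
  let ?\<phi>' = "\<lambda>xs. \<phi> (map h xs)"
  have \<phi>': "?\<phi>' \<in> forms 3" by (rule forms_compose_linear[OF \<phi> h(1)])
  have nat: "G2_b ?\<phi>' v w xs = G2_b \<phi> (h v) (h w) (map h xs)" for v w xs
  proof -
    have "contract u ?\<phi>' = (\<lambda>xs. contract (h u) \<phi> (map h xs))" for u by (simp add: contract_def)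
    then show ?thesis
      by (simp add: G2_b_def wedge_map[of _ _ h] wedge_map[of "contract _ _" _ h])
  qed
  have top: "\<alpha> xs = \<alpha> std * vol7 xs" if "\<alpha> \<in> forms 7" for \<alpha> xs
  proof -
    have "\<alpha> = (\<lambda>xs. \<alpha> std * vol7 xs)"
      by (rule forms_7_eqI) (simp_all add: that forms_scale vol7_forms vol7_std)
    then show ?thesis by metis
  qed
  have 1: "G2_b ?\<phi>' v w xs = (vol7 (map h std) / s) * (v \<bullet> w) * vol7 xs" for v w xs
  proof -
    have "G2_b ?\<phi>' v w std = G2_b \<phi> (h v) (h w) std * vol7 (map h std)"
      unfolding nat by (rule top[OF G2_b_forms[OF \<phi>]])
    also have "G2_b \<phi> (h v) (h w) std = (v \<bullet> w) / s"
      using gh[of v w] s(1) by (simp add: g_def field_simps)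
    finally show ?thesis using top[OF G2_b_forms[OF \<phi>'], of v w xs] by (simp add: field_simps)
  qed
  have "vol7 (map h std) \<noteq> 0"
  proof
    assume z: "vol7 (map h std) = 0"
    have "(\<lambda>xs. vol7 (map h xs)) = (\<lambda>_. 0)"
      by (rule forms_7_eqI) (simp_all add: forms_compose_linear[OF vol7_forms h(1)] forms_zero z)
    then have "vol7 (map h (map (inv h) std)) = 0" by metis
    moreover have "map h (map (inv h) std) = std"
      using bij by (simp add: o_def bij_is_surj surj_f_inv_f map_idI)
    ultimately show False using vol7_std by simp
  qed
  then show ?thesis using that[OF h(1) bij _ 1] s(1) by simp
qed

section \<open>Maximising a 3-form over triples of unit vectors\<close>

lemma form3_expand:
  fixes \<phi> :: "(real^7) form"
  assumes \<phi>: "\<phi> \<in> forms 3"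
  shows "\<phi> [x, y, z] = (\<Sum>i\<in>Basis. \<Sum>j\<in>Basis. \<Sum>k\<in>Basis. (x \<bullet> i) * ((y \<bullet> j) * ((z \<bullet> k) * \<phi> [i, j,
      k])))"
  by (subst linear_sum_Basis[OF form3_linear(1)[OF \<phi>]], subst linear_sum_Basis[OF
      form3_linear(2)[OF \<phi>]],
      subst linear_sum_Basis[OF form3_linear(3)[OF \<phi>]]) (simp add: sum_distrib_left)

lemma exists_max_triple:
  fixes \<phi> :: "(real^7) form"
  assumes \<phi>: "\<phi> \<in> forms 3"
  obtains e1 e2 e3 where "norm e1 = 1" "norm e2 = 1" "norm e3 = 1"
    "\<And>x y z. norm x = 1 \<Longrightarrow> norm y = 1 \<Longrightarrow> norm z = 1 \<Longrightarrow> \<phi> [x, y, z] \<le> \<phi> [e1, e2, e3]"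
proof -
  let ?S = "sphere 0 1 :: (real^7) set"
  let ?T = "\<lambda>(x, y, z). \<phi> [x, y, z]"
  have "compact (?S \<times> ?S \<times> ?S)" by (intro compact_Times compact_sphere)
  moreover have "ax 1 \<in> ?S" by simp
  then have "?S \<times> ?S \<times> ?S \<noteq> {}" by blast
  moreover have "continuous_on (?S \<times> ?S \<times> ?S) ?T"
  proof -
    have "?T = (\<lambda>t. \<Sum>i\<in>Basis. \<Sum>j\<in>Basis. \<Sum>k\<in>Basis.
        (fst t \<bullet> i) * ((fst (snd t) \<bullet> j) * ((snd (snd t) \<bullet> k) * \<phi> [i, j, k])))"
      by (rule ext) (simp only: case_prod_unfold, rule form3_expand[OF \<phi>])
    moreover have "continuous_on (?S \<times> ?S \<times> ?S) (\<lambda>t. \<Sum>i\<in>Basis. \<Sum>j\<in>Basis. \<Sum>k\<in>Basis.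
        (fst t \<bullet> i) * ((fst (snd t) \<bullet> j) * ((snd (snd t) \<bullet> k) * \<phi> [i, j, k])))"
      by (intro continuous_on_sum continuous_on_mult continuous_on_inner continuous_on_fst
          continuous_on_snd continuous_on_id continuous_on_const)
    ultimately show ?thesis by (simp only:)
  qed
  ultimately have "\<exists>t\<in>?S \<times> ?S \<times> ?S. \<forall>u\<in>?S \<times> ?S \<times> ?S. ?T u \<le> ?T t"
    by (rule continuous_attains_sup)
  then obtain e1 e2 e3 where e: "(e1, e2, e3) \<in> ?S \<times> ?S \<times> ?S"
    and max: "\<forall>u\<in>?S \<times> ?S \<times> ?S. ?T u \<le> ?T (e1, e2, e3)"
    by (elim bexE) (metis prod_cases3)
  show ?thesis
  proof (rule that)
    show "norm e1 = 1" "norm e2 = 1" "norm e3 = 1" using e by simp_all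
    show "\<phi> [x, y, z] \<le> \<phi> [e1, e2, e3]" if "norm x = 1" "norm y = 1" "norm z = 1" for x y z
      using max[rule_format, of "(x, y, z)"] that by simp
  qed
qed

text \<open>Testing the representing vector \<open>a\<close> of \<open>f\<close> at its own
  direction bounds its norm by \<open>f z\<close>. Then the squared distance of \<open>a\<close>
  from \<open>f z *\<^sub>R z\<close> is at most zero.\<close>

lemma unit_max_linear:
  fixes f :: "'v::euclidean_space \<Rightarrow> real"
  assumes lin: "linear f" and le: "\<And>u. norm u = 1 \<Longrightarrow> f u \<le> f z" and z: "norm z = 1"
  shows "f w = f z * (z \<bullet> w)"
proof -
  define a where "a = (\<Sum>i\<in>Basis. f i *\<^sub>R i)"
  have f: "f x = a \<bullet> x" for x
    by (subst linear_sum_Basis[OF lin, of x]) (simp add: a_def inner_sum_left inner_commute[of x]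
        mult.commute)
  have "norm a \<le> f z"
  proof (cases "a = 0")
    case True
    then show ?thesis by (simp add: f)
  next
    case False
    then have "f (a /\<^sub>R norm a) = norm a"
      by (simp add: f dot_square_norm power2_eq_square)
    then show ?thesis using le[of "a /\<^sub>R norm a"] False by simp
  qed
  then have "a \<bullet> a \<le> f z * f z"
    using mult_mono[of "norm a" "f z" "norm a" "f z"] by (simp add: dot_square_norm
        power2_eq_square)
  moreover have "(a - f z *\<^sub>R z) \<bullet> (a - f z *\<^sub>R z) = a \<bullet> a - f z * f z"
  proof -
    have "z \<bullet> z = 1" using z by (simp add: dot_square_norm)
    then show ?thesis by (simp add: inner_diff_left inner_diff_right inner_commute[of z a] f)
  qed
  ultimately have "(a - f z *\<^sub>R z) \<bullet> (a - f z *\<^sub>R z) \<le> 0" by simp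
  then have "a = f z *\<^sub>R z" by (metis eq_iff_diff_eq_0 inner_ge_zero inner_eq_zero_iff
      order_antisym)
  then have "f w = (f z *\<^sub>R z) \<bullet> w" using f[of w] by simp
  then show ?thesis by simp
qed

text \<open>The component of \<open>n1\<close> orthogonal to \<open>n2\<close> and
  \<open>n3\<close>, rescaled. Staying inside the span keeps the dual vectors in
  \<open>V\<close>.\<close>

lemma dual_vector:
  fixes n1 n2 n3 :: "real^7"
  assumes "\<And>\<beta> \<gamma>. n1 \<noteq> \<beta> *\<^sub>R n2 + \<gamma> *\<^sub>R n3"
  obtains y where "y \<in> span {n1, n2, n3}" "n1 \<bullet> y = 1" "n2 \<bullet> y = 0" "n3 \<bullet> y = 0"
proof -
  obtain p r where pr: "p \<in> span {n2, n3}" "\<And>w. w \<in> span {n2, n3} \<Longrightarrow> orthogonal r w" "n1 = p + r"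
    using orthogonal_subspace_decomp_exists[of "{n2, n3}" n1] by blast
  obtain \<beta> \<gamma> where p: "p = \<beta> *\<^sub>R n2 + \<gamma> *\<^sub>R n3"
  proof -
    obtain \<beta> where "p - \<beta> *\<^sub>R n2 \<in> span {n3}" using pr(1) span_breakdown_eq[of p n2 "{n3}"] by blast
    then obtain \<gamma> where "p - \<beta> *\<^sub>R n2 = \<gamma> *\<^sub>R n3" by (auto simp: span_singleton)
    then have "p = \<beta> *\<^sub>R n2 + \<gamma> *\<^sub>R n3" by (simp add: algebra_simps)
    then show ?thesis by (rule that)
  qed
  have r: "r \<noteq> 0"
  proof
    assume "r = 0"
    then have "n1 = \<beta> *\<^sub>R n2 + \<gamma> *\<^sub>R n3" using p pr(3) by simp
    then show False using assms by blast
  qed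
  have rp: "p \<bullet> r = 0" using pr(2)[OF pr(1)] by (simp add: orthogonal_def inner_commute)
  have rn: "n2 \<bullet> r = 0" "n3 \<bullet> r = 0"
    using pr(2)[OF span_base, of n2] pr(2)[OF span_base, of n3] by (simp_all add: orthogonal_def
        inner_commute)
  have "p \<in> span {n1, n2, n3}" using pr(1) span_mono[of "{n2, n3}" "{n1, n2, n3}"] by blast
  then have "n1 - p \<in> span {n1, n2, n3}" using span_diff[OF span_base[of n1]] by simp
  then have "r \<in> span {n1, n2, n3}" using pr(3) by simp
  then show ?thesis
    using r by (intro that[of "r /\<^sub>R (r \<bullet> r)"]) (simp_all add: span_scale pr(3) rn rp
        inner_add_left)
qed

text \<open>An orthonormal triple maximising a \<open>G\<^sub>2\<close>-form; the equations \<open>calib\<close> are the first-order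
  conditions for the maximum.\<close>

locale calibrated_triple =
  fixes \<phi> :: "(real^7) form" and e1 e2 e3 :: "real^7" and lam kap :: real
  assumes form: "\<phi> \<in> forms 3"
    and on: "e1 \<bullet> e1 = 1" "e2 \<bullet> e2 = 1" "e3 \<bullet> e3 = 1" "e1 \<bullet> e2 = 0" "e1 \<bullet> e3 = 0" "e2 \<bullet> e3 = 0"
    and lam: "lam > 0" and kap: "kap \<noteq> 0"
    and calib: "\<phi> [e1, e2, w] = lam * (e3 \<bullet> w)" "\<phi> [e2, e3, w] = lam * (e1 \<bullet> w)"
      "\<phi> [e3, e1, w] = lam * (e2 \<bullet> w)"
    and metric: "G2_b \<phi> v w xs = kap * (v \<bullet> w) * vol7 xs"
begin

definition V :: "(real^7) set" where
  "V = {x. x \<bullet> e1 = 0 \<and> x \<bullet> e2 = 0 \<and> x \<bullet> e3 = 0}"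

lemmas lin = form3_linear[OF form]
lemmas swap = form3_swap[OF form]
lemmas rep = form3_repeat[OF form]

lemma e_values:
  "\<phi> [e1, e2, e3] = lam" "\<phi> [e1, e3, e2] = - lam" "\<phi> [e2, e1, e3] = - lam"
  "\<phi> [e2, e3, e1] = lam" "\<phi> [e3, e1, e2] = lam" "\<phi> [e3, e2, e1] = - lam"
  using swap(2)[of e1 e3 e2] swap(1)[of e2 e1 e3] swap(1)[of e3 e2 e1] by (simp_all add: calib on)

text \<open>The first-order conditions leave no component with two arguments among
  \<open>e1\<close>, \<open>e2\<close>, \<open>e3\<close> and one in \<open>V\<close>.\<close>

lemma V_zero:
  assumes "x \<in> V"
  shows "\<phi> [e1, e2, x] = 0" "\<phi> [e2, e1, x] = 0" "\<phi> [e1, e3, x] = 0" "\<phi> [e3, e1, x] = 0"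
    "\<phi> [e2, e3, x] = 0" "\<phi> [e3, e2, x] = 0"
    "\<phi> [e1, x, e2] = 0" "\<phi> [e2, x, e1] = 0" "\<phi> [e1, x, e3] = 0" "\<phi> [e3, x, e1] = 0"
    "\<phi> [e2, x, e3] = 0" "\<phi> [e3, x, e2] = 0"
    "\<phi> [x, e1, e2] = 0" "\<phi> [x, e2, e1] = 0" "\<phi> [x, e1, e3] = 0" "\<phi> [x, e3, e1] = 0"
    "\<phi> [x, e2, e3] = 0" "\<phi> [x, e3, e2] = 0"
proof -
  show a: "\<phi> [e1, e2, x] = 0" "\<phi> [e2, e3, x] = 0" "\<phi> [e3, e1, x] = 0"
    using assms by (simp_all add: calib V_def inner_commute)
  show b: "\<phi> [e2, e1, x] = 0" "\<phi> [e3, e2, x] = 0" "\<phi> [e1, e3, x] = 0"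
    using a swap(1)[of e2 e1 x] swap(1)[of e3 e2 x] swap(1)[of e1 e3 x] by simp_all
  show c: "\<phi> [e1, x, e2] = 0" "\<phi> [e2, x, e1] = 0" "\<phi> [e1, x, e3] = 0" "\<phi> [e3, x, e1] = 0"
    "\<phi> [e2, x, e3] = 0" "\<phi> [e3, x, e2] = 0"
    using a b swap(2)[of e1 x e2] swap(2)[of e2 x e1] swap(2)[of e1 x e3] swap(2)[of e3 x e1]
      swap(2)[of e2 x e3] swap(2)[of e3 x e2] by simp_all
  show "\<phi> [x, e1, e2] = 0" "\<phi> [x, e2, e1] = 0" "\<phi> [x, e1, e3] = 0" "\<phi> [x, e3, e1] = 0"
    "\<phi> [x, e2, e3] = 0" "\<phi> [x, e3, e2] = 0"
    using c swap(1)[of x e1 e2] swap(1)[of x e2 e1] swap(1)[of x e1 e3] swap(1)[of x e3 e1]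
      swap(1)[of x e2 e3] swap(1)[of x e3 e2] by simp_all
qed

text \<open>The component of the wedge product of the contractions with \<open>p\<close> and \<open>q\<close> along \<open>a, b, c, d\<close>.
  That the contractions with \<open>e1, e2, e3\<close> are orthonormal for this pairing on \<open>V\<close> makes them a
  hyperkaehler triple.\<close>

definition pf where
  "pf p q a b c d = \<phi> [p, a, b] * \<phi> [q, c, d] - \<phi> [p, a, c] * \<phi> [q, b, d]
      + \<phi> [p, a, d] * \<phi> [q, b, c]
     + \<phi> [p, b, c] * \<phi> [q, a, d] - \<phi> [p, b, d] * \<phi> [q, a, c] + \<phi> [p, c, d] * \<phi> [q, a, b]"

lemma pf_commute: "pf p q a b c d = pf q p a b c d"
  by (simp add: pf_def algebra_simps)

text \<open>Of the seven arguments \<open>e1\<close>, \<open>e2\<close>, \<open>e3\<close> must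
  supply the factor \<open>lam\<close> once; this can happen in any of the three factors of the
  wedge product, so the coefficient is three sixths of \<open>lam\<close>.\<close>

lemma G2_b_pf:
  assumes V: "a \<in> V" "b \<in> V" "c \<in> V" "d \<in> V"
  shows "G2_b \<phi> e1 e1 [e1, e2, e3, a, b, c, d] = lam / 2 * pf e1 e1 a b c d"
    "G2_b \<phi> e2 e2 [e1, e2, e3, a, b, c, d] = lam / 2 * pf e2 e2 a b c d"
    "G2_b \<phi> e3 e3 [e1, e2, e3, a, b, c, d] = lam / 2 * pf e3 e3 a b c d"
    "G2_b \<phi> e1 e2 [e1, e2, e3, a, b, c, d] = lam / 2 * pf e1 e2 a b c d"
    "G2_b \<phi> e1 e3 [e1, e2, e3, a, b, c, d] = lam / 2 * pf e1 e3 a b c d"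
    "G2_b \<phi> e2 e3 [e1, e2, e3, a, b, c, d] = lam / 2 * pf e2 e3 a b c d"
  by (simp_all add: G2_b_simps[OF form] rep e_values V_zero[OF V(1)] V_zero[OF V(2)] V_zero[OF V(3)]
      V_zero[OF V(4)] pf_def algebra_simps)

lemma pf_values:
  assumes V: "a \<in> V" "b \<in> V" "c \<in> V" "d \<in> V"
  defines "C \<equiv> 2 * kap / lam * vol7 [e1, e2, e3, a, b, c, d]"
  shows "pf e1 e1 a b c d = C" "pf e2 e2 a b c d = C" "pf e3 e3 a b c d = C"
    "pf e1 e2 a b c d = 0" "pf e1 e3 a b c d = 0" "pf e2 e3 a b c d = 0"
    "pf e2 e1 a b c d = 0" "pf e3 e1 a b c d = 0" "pf e3 e2 a b c d = 0"
  using G2_b_pf[OF V] lam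
  by (simp_all add: metric on C_def field_simps pf_commute[of e2 e1] pf_commute[of e3 e1]
      pf_commute[of e3 e2])

text \<open>If such a relation held, the 2-form of p - \<beta> q - \<gamma> r would have
  \<open>a\<close> in its radical among \<open>a\<close>, \<open>b\<close>, \<open>c\<close>,
  \<open>d\<close>, so its square would vanish. Orthonormality makes that square C (1 + \<beta>^2 +
  \<gamma>^2).\<close>

lemma pf_independent:
  assumes "pf p p a b c d = C" "pf q q a b c d = C" "pf r r a b c d = C"
    "pf p q a b c d = 0" "pf p r a b c d = 0" "pf q r a b c d = 0" "C \<noteq> 0"
    and L: "\<And>x. \<phi> [p, a, x] = \<beta> * \<phi> [q, a, x] + \<gamma> * \<phi> [r, a, x]"
  shows False
proof -
  have "pf p p a b c d - 2 * \<beta> * pf p q a b c d - 2 * \<gamma> * pf p r a b c d + \<beta> * \<beta> * pf q q a b c d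
     + 2 * \<beta> * \<gamma> * pf q r a b c d + \<gamma> * \<gamma> * pf r r a b c d = 0"
    unfolding pf_def L by algebra
  then have "C * (1 + \<beta> * \<beta> + \<gamma> * \<gamma>) = 0" using assms(1-6) by (simp add: algebra_simps)
  then have "1 + \<beta> * \<beta> + \<gamma> * \<gamma> = 0" using assms(7) by simp
  then show False using zero_le_square[of \<beta>] zero_le_square[of \<gamma>] by linarith
qed

lemma subspace_V: "subspace V"
  by (auto simp: V_def subspace_def inner_simps)

lemma exists_V_frame:
  obtains f a b c where "f \<in> V" "a \<in> V" "b \<in> V" "c \<in> V" "f \<bullet> f = 1" "vol7 [e1, e2, e3, f, a, b, c]
      \<noteq> 0"
proof -
  have c7: "card (set xs) < 7" if "length xs < 7" for xs :: "(real^7) list"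
    using card_length[of xs] that by simp
  obtain f where f: "f \<bullet> f = 1" "\<And>x. x \<in> set [e1, e2, e3] \<Longrightarrow> f \<bullet> x = 0"
    using exists_unit_orthogonal[of "set [e1, e2, e3]"] c7[of "[e1, e2, e3]"] by auto
  obtain a where a: "a \<bullet> a = 1" "\<And>x. x \<in> set [e1, e2, e3, f] \<Longrightarrow> a \<bullet> x = 0"
    using exists_unit_orthogonal[of "set [e1, e2, e3, f]"] c7[of "[e1, e2, e3, f]"] by auto
  obtain b where b: "b \<bullet> b = 1" "\<And>x. x \<in> set [e1, e2, e3, f, a] \<Longrightarrow> b \<bullet> x = 0"
    using exists_unit_orthogonal[of "set [e1, e2, e3, f, a]"] c7[of "[e1, e2, e3, f, a]"] by auto
  obtain c where c: "c \<bullet> c = 1" "\<And>x. x \<in> set [e1, e2, e3, f, a, b] \<Longrightarrow> c \<bullet> x = 0"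
    using exists_unit_orthogonal[of "set [e1, e2, e3, f, a, b]"] c7[of "[e1, e2, e3, f, a, b]"] by
        auto
  let ?xs = "[e1, e2, e3, f, a, b, c]"
  have o: "?xs ! i \<bullet> ?xs ! j = (if i = j then 1 else 0)" if "i < 7" "j < 7" for i j
  proof -
    have n: "i = 0 \<or> i = 1 \<or> i = 2 \<or> i = 3 \<or> i = 4 \<or> i = 5 \<or> i = 6" if "i < 7" for i :: nat
      using that by auto
    have l: "f \<bullet> e1 = 0" "f \<bullet> e2 = 0" "f \<bullet> e3 = 0" "a \<bullet> e1 = 0" "a \<bullet> e2 = 0" "a \<bullet> e3
        = 0" "a \<bullet> f = 0"
      "b \<bullet> e1 = 0" "b \<bullet> e2 = 0" "b \<bullet> e3 = 0" "b \<bullet> f = 0" "b \<bullet> a = 0"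
      "c \<bullet> e1 = 0" "c \<bullet> e2 = 0" "c \<bullet> e3 = 0" "c \<bullet> f = 0" "c \<bullet> a = 0" "c \<bullet> b = 0"
      using f(2) a(2) b(2) c(2) by simp_all
    then show ?thesis
      using n[OF that(1)] n[OF that(2)]
      by (elim disjE) (simp_all add: on f(1) a(1) b(1) c(1) inner_commute)
  qed
  have inj: "idx7 i = idx7 j \<longleftrightarrow> i = j" for i j by (metis of_nat_idx7)
  have "(\<chi> i j. ?xs ! idx7 i \<bullet> ?xs ! idx7 j) = mat 1"
    by (simp only: o[OF idx7_less idx7_less] inj mat_def)
  then have "(vol7 ?xs)\<^sup>2 = 1" using vol7_square[of ?xs] by simp
  then have "vol7 ?xs \<noteq> 0" by auto
  then show ?thesis
    using f a b c by (intro that[of f a b c]) (simp_all add: V_def)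
qed

end

context calibrated_triple
begin

text \<open>The three covectors obtained by contraction with \<open>e1\<close>, \<open>e2\<close>,
  \<open>e3\<close> and \<open>f\<close> are independent, and dual vectors normalise the values at
  \<open>f\<close>. The minus sign at \<open>f7\<close> is that of e^347 in the standard
  form.\<close>

lemma exists_adapted_frame:
  obtains f4 f5 f6 f7 where "f4 \<in> V" "f5 \<in> V" "f6 \<in> V" "f7 \<in> V" "f4 \<bullet> f4 = 1"
    "\<phi> [e1, f4, f5] = 1" "\<phi> [e1, f4, f6] = 0" "\<phi> [e1, f4, f7] = 0"
    "\<phi> [e2, f4, f5] = 0" "\<phi> [e2, f4, f6] = 1" "\<phi> [e2, f4, f7] = 0"
    "\<phi> [e3, f4, f5] = 0" "\<phi> [e3, f4, f6] = 0" "\<phi> [e3, f4, f7] = - 1"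
    "\<phi> [e1, f5, f6] = 0" "\<phi> [e1, f5, f7] = 0" "\<phi> [e2, f5, f6] = 0"
proof -
  obtain f a b c where V: "f \<in> V" "a \<in> V" "b \<in> V" "c \<in> V" and ff: "f \<bullet> f = 1"
    and vol7: "vol7 [e1, e2, e3, f, a, b, c] \<noteq> 0"
    by (rule exists_V_frame)
  define n where "n p = (\<Sum>k\<in>Basis. \<phi> [p, f, k] *\<^sub>R k)" for p
  have n: "n p \<bullet> x = \<phi> [p, f, x]" for p x
    by (subst linear_sum_Basis[OF lin(3), of p f x])
       (simp add: n_def inner_sum_left inner_commute[of x] mult.commute)
  let ?C = "2 * kap / lam * vol7 [e1, e2, e3, f, a, b, c]"
  have C: "?C \<noteq> 0" using vol7 kap lam by simp
  note pv = pf_values[OF V]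
  have L: "\<phi> [p, f, x] = \<beta> * \<phi> [q, f, x] + \<gamma> * \<phi> [r, f, x]" if "n p = \<beta> *\<^sub>R n q
      + \<gamma> *\<^sub>R n r" for p q r \<beta> \<gamma> x
    using n[of p x] by (simp add: that inner_add_left n)
  have i1: "n e1 \<noteq> \<beta> *\<^sub>R n e2 + \<gamma> *\<^sub>R n e3" for \<beta> \<gamma>
    using pf_independent[OF pv(1,2,3,4,5,6) C L] by blast
  have i2: "n e2 \<noteq> \<beta> *\<^sub>R n e1 + \<gamma> *\<^sub>R n e3" for \<beta> \<gamma>
    using pf_independent[OF pv(2,1,3,7,6,5) C L] by blast
  have i3: "n e3 \<noteq> \<beta> *\<^sub>R n e1 + \<gamma> *\<^sub>R n e2" for \<beta> \<gamma>
    using pf_independent[OF pv(3,1,2,8,9,4) C L] by blast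
  have nV: "n e1 \<in> V" "n e2 \<in> V" "n e3 \<in> V"
    by (simp_all add: V_def n V_zero[OF V(1)] rep)
  have sV: "y \<in> V" if "y \<in> span {p, q, r}" "p \<in> V" "q \<in> V" "r \<in> V" for y p q r
    using that span_minimal[of "{p, q, r}" V] subspace_V by blast
  obtain g5 where g5: "g5 \<in> span {n e1, n e2, n e3}" "n e1 \<bullet> g5 = 1" "n e2 \<bullet> g5 = 0" "n e3 \<bullet> g5 = 0"
    using dual_vector[OF i1] by blast
  obtain g6 where g6: "g6 \<in> span {n e2, n e1, n e3}" "n e2 \<bullet> g6 = 1" "n e1 \<bullet> g6 = 0" "n e3 \<bullet> g6 = 0"
    using dual_vector[OF i2] by blast
  obtain g7 where g7: "g7 \<in> span {n e3, n e1, n e2}" "n e3 \<bullet> g7 = 1" "n e1 \<bullet> g7 = 0" "n e2 \<bullet> g7 = 0"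
    using dual_vector[OF i3] by blast
  have gV: "g5 \<in> V" "g6 \<in> V" "g7 \<in> V"
    using sV[OF g5(1)] sV[OF g6(1)] sV[OF g7(1)] nV by blast+
  note g = g5(2-4)[unfolded n] g6(2-4)[unfolded n] g7(2-4)[unfolded n]
  \<comment> \<open>Adding multiples of \<open>f\<close> preserves the values already fixed; these
    three coefficients solve the last three equations.\<close>
  define A where "A = - \<phi> [e2, g5, g6]"
  define B where "B = \<phi> [e1, g5, g6]"
  define E where "E = - \<phi> [e1, g5, g7]"
  have sw: "\<phi> [p, x, f] = - \<phi> [p, f, x]" for p x by (rule swap(2))
  note ls = linear_add[OF lin(2)] linear_add[OF lin(3)] linear_scale[OF lin(2)] linear_scale[OF
      lin(3)]
    linear_neg[OF lin(2)] linear_neg[OF lin(3)] linear_diff[OF lin(2)] linear_diff[OF lin(3)]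
  show ?thesis
  proof (rule that[of f "g5 + A *\<^sub>R f" "g6 + B *\<^sub>R f" "- g7 + E *\<^sub>R f"])
    show "g5 + A *\<^sub>R f \<in> V" "g6 + B *\<^sub>R f \<in> V" "- g7 + E *\<^sub>R f \<in> V"
      using gV V(1) subspace_V by (simp_all add: subspace_add subspace_diff subspace_scale)
  qed (simp_all add: V ff ls rep g sw, simp_all add: A_def B_def E_def)
qed

theorem exists_normal_form: "\<exists>h. linear h \<and> bij h \<and> (\<forall>xs. \<phi> (map h xs) = phi0 xs)"
proof -
  obtain f4 f5 f6 f7 where V: "f4 \<in> V" "f5 \<in> V" "f6 \<in> V" "f7 \<in> V" and f44: "f4 \<bullet> f4 = 1"
    and w: "\<phi> [e1, f4, f5] = 1" "\<phi> [e1, f4, f6] = 0" "\<phi> [e1, f4, f7] = 0"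
    "\<phi> [e2, f4, f5] = 0" "\<phi> [e2, f4, f6] = 1" "\<phi> [e2, f4, f7] = 0"
    "\<phi> [e3, f4, f5] = 0" "\<phi> [e3, f4, f6] = 0" "\<phi> [e3, f4, f7] = - 1"
    "\<phi> [e1, f5, f6] = 0" "\<phi> [e1, f5, f7] = 0" "\<phi> [e2, f5, f6] = 0"
    by (rule exists_adapted_frame)
  let ?xs = "[e1, e2, e3, f4, f5, f6, f7]"
  define s where "s = kap / lam * vol7 ?xs"
  note pv = pf_values[OF V, unfolded pf_def]
  \<comment> \<open>With the values involving \<open>f4\<close> known, the six equations for
    \<open>pf\<close> are linear in these six unknowns.\<close>
  have w': "\<phi> [e1, f6, f7] = s" "\<phi> [e2, f5, f7] = - s" "\<phi> [e3, f5, f6] = - s"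
    "\<phi> [e2, f6, f7] = 0" "\<phi> [e3, f6, f7] = 0" "\<phi> [e3, f5, f7] = 0"
    using pv(1-6) by (simp_all add: w s_def)
  have perm: "\<phi> [f5, f4, f6] = - \<phi> [f4, f5, f6]" "\<phi> [f5, f4, f7] = - \<phi> [f4, f5, f7]"
    "\<phi> [f6, f4, f5] = \<phi> [f4, f5, f6]" "\<phi> [f6, f4, f7] = - \<phi> [f4, f6, f7]" "\<phi> [f6, f5, f7]
        = - \<phi> [f5, f6, f7]"
    "\<phi> [f7, f4, f5] = \<phi> [f4, f5, f7]" "\<phi> [f7, f4, f6] = \<phi> [f4, f6, f7]" "\<phi> [f7, f5, f6]
        = \<phi> [f5, f6, f7]"
    using swap(1)[of f5 f4 f6] swap(1)[of f5 f4 f7] swap(1)[of f6 f4 f5] swap(2)[of f4 f6 f5]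
      swap(1)[of f6 f4 f7] swap(1)[of f6 f5 f7] swap(1)[of f7 f4 f5] swap(2)[of f4 f7 f5]
      swap(1)[of f7 f4 f6] swap(2)[of f4 f7 f6] swap(1)[of f7 f5 f6] swap(2)[of f5 f7 f6]
    by linarith+
  note S = G2_b_simps[OF form] rep e_values V_zero[OF V(1)] V_zero[OF V(2)] V_zero[OF V(3)]
    V_zero[OF V(4)] w w' perm
  have mvi: "\<phi> [x, e1, y] = - \<phi> [e1, x, y]" "\<phi> [x, e2, y] = - \<phi> [e2, x, y]" "\<phi> [x, e3, y]
      = - \<phi> [e3, x, y]"
    if "x \<in> {f4, f5, f6, f7}" "y \<in> {f4, f5, f6, f7}" for x y
    by (rule swap(1))+
  note m = mvi[of f4 f5, simplified] mvi[of f4 f6, simplified] mvi[of f4 f7, simplified]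
    mvi[of f5 f4, simplified] mvi[of f5 f6, simplified] mvi[of f5 f7, simplified]
    mvi[of f6 f4, simplified] mvi[of f6 f5, simplified] mvi[of f6 f7, simplified]
    mvi[of f7 f4, simplified] mvi[of f7 f5, simplified] mvi[of f7 f6, simplified]
  have rev: "\<phi> [p, f5, f4] = - \<phi> [p, f4, f5]" "\<phi> [p, f6, f4] = - \<phi> [p, f4, f6]" "\<phi> [p, f7, f4]
      = - \<phi> [p, f4, f7]"
    "\<phi> [p, f6, f5] = - \<phi> [p, f5, f6]" "\<phi> [p, f7, f5] = - \<phi> [p, f5, f7]" "\<phi> [p, f7, f6]
        = - \<phi> [p, f6, f7]" for p
    by (rule swap(2))+
  have orth: "p \<bullet> x = 0" if "p \<in> {e1, e2, e3}" "x \<in> V" for p x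
    using that by (auto simp: V_def inner_commute)
  \<comment> \<open>The part of \<phi> on \<open>V\<close> is detected by b(e,x) with
    \<open>e\<close> among \<open>e1\<close>, \<open>e2\<close>, \<open>e3\<close> and
    \<open>x\<close> in \<open>V\<close>, which is zero by orthogonality.\<close>
  have g0: "\<phi> [f4, f5, f6] = 0" "\<phi> [f4, f5, f7] = 0" "\<phi> [f4, f6, f7] = 0" "\<phi> [f5, f6, f7] = 0"
  proof -
    have "G2_b \<phi> p x ?xs = 0" if "p \<in> {e1, e2, e3}" "x \<in> V" for p x
      by (simp add: metric orth[OF that])
    then have "G2_b \<phi> e1 f6 ?xs = 0" "G2_b \<phi> e1 f7 ?xs = 0" "G2_b \<phi> e1 f4 ?xs
        = 0" "G2_b \<phi> e1 f5 ?xs = 0"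
      "G2_b \<phi> e2 f5 ?xs = 0" "G2_b \<phi> e2 f7 ?xs = 0" "G2_b \<phi> e3 f4 ?xs = 0" "G2_b \<phi> e2 f4 ?xs = 0"
      "G2_b \<phi> e3 f5 ?xs = 0" "G2_b \<phi> e3 f6 ?xs = 0"
      using V by blast+
    then show "\<phi> [f4, f5, f6] = 0" "\<phi> [f4, f5, f7] = 0" "\<phi> [f4, f6, f7] = 0" "\<phi> [f5, f6, f7] = 0"
      using lam by (simp_all add: S m rev)
  qed
  \<comment> \<open>This value ties \<open>kap\<close> to the volume of the frame and so determines
    \<open>s\<close>.\<close>
  have "G2_b \<phi> f4 f4 ?xs = 1"
    by (simp add: S m rev g0)
  then have s: "s = 1 / lam" by (simp add: metric f44 s_def)
  \<comment> \<open>The scalings of the \<open>e\<close>-vectors, of \<open>f4\<close> and of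
    \<open>f5\<close>, \<open>f6\<close>, \<open>f7\<close> are solved from p^3 lam = 1, p t r = 1
    and p r^2 s = 1, one equation for each kind of surviving component.\<close>
  define p where "p = root 3 (1 / lam)"
  define r where "r = sqrt (lam / p)"
  define t where "t = 1 / (p * r)"
  have p: "p > 0" "p * p * p * lam = 1"
  proof -
    show "p > 0" using lam by (simp add: p_def)
    have "p ^ 3 = 1 / lam" using lam by (simp add: p_def)
    then show "p * p * p * lam = 1" using lam by (simp add: power3_eq_cube)
  qed
  have r: "r > 0" "r * r = lam / p" using lam p(1) by (simp_all add: r_def)
  have coef: "p * (p * (p * lam)) = 1" "p * (t * r) = 1" "p * (r * (r * s)) = 1"
    using p r lam by (simp_all add: t_def s field_simps)
  define h where "h x = (x $ 1 * p) *\<^sub>R e1 + (x $ 2 * p) *\<^sub>R e2 + (x $ 3 * p) *\<^sub>R e3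
      + (x $ 4 * t) *\<^sub>R f4
     + (x $ 5 * r) *\<^sub>R f5 + (x $ 6 * r) *\<^sub>R f6 + (x $ 7 * r) *\<^sub>R f7" for x :: "real^7"
  have lin_h: "linear h"
    by (rule linearI) (simp_all add: h_def algebra_simps)
  have ha: "h (ax 1) = p *\<^sub>R e1" "h (ax 2) = p *\<^sub>R e2" "h (ax 3) = p *\<^sub>R e3"
    "h (ax 4) = t *\<^sub>R f4" "h (ax 5) = r *\<^sub>R f5" "h (ax 6) = r *\<^sub>R f6" "h (ax 7) = r *\<^sub>R f7"
    by (simp_all add: h_def axis_nth)
  have "(\<lambda>xs. \<phi> (map h xs)) = phi0"
  proof (rule forms_eqI[OF forms_compose_linear[OF form lin_h] phi0_forms std_basis])
    fix ys :: "(real^7) list"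
    assume "ys \<in> set (subseqs std)" "length ys = 3"
    then show "\<phi> (map h ys) = phi0 ys"
      using coef
      by (auto simp: std_def Let_def ha linear_scale[OF lin(1)] linear_scale[OF lin(2)]
          linear_scale[OF lin(3)]
          e_values V_zero[OF V(1)] V_zero[OF V(2)] V_zero[OF V(3)] V_zero[OF V(4)] w w' g0
              phi0_axis axis_nth
          mult.commute mult.left_commute simp del: phi0.simps)
  qed
  then have eq: "\<phi> (map h xs) = phi0 xs" for xs by metis
  have "inj h"
    unfolding linear_injective_0[OF lin_h]
  proof (intro allI impI)
    fix x assume hx: "h x = 0"
    \<comment> \<open>A vector killed by \<open>h\<close> would annihilate the standard form, whose
      cross product has no kernel.\<close>
    have "cross7 x y \<bullet> z = 0" for y z
      using eq[of "[x, y, z]"] hx linear_0[OF lin(1)] by simp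
    then have c: "cross7 x y = 0" for y by (metis inner_eq_zero_iff)
    obtain y where y: "y \<bullet> y = 1" "y \<bullet> x = 0" using exists_unit_orthogonal[of "{x}"] by auto
    have "(x \<bullet> x) *\<^sub>R y = 0"
      using cross7_cross7[of x y] y(2) by (simp add: c inner_commute cross7_simps)
    then show "x = 0" using y(1) by auto
  qed
  then have "bij h" using linear_injective_imp_surjective[OF lin_h] by (simp add: bij_def)
  then show ?thesis using lin_h eq by blast
qed

end

section \<open>Assembly of the normal form and conclusion\<close>

theorem definite_form_normal_form:
  fixes \<phi> :: "'a::real_vector form"
  assumes dim: "dim (UNIV :: 'a set) = 7" and def: "definite_form \<phi>"
  shows "\<exists>f. G2_coframe f \<phi>"
proof -
  obtain h :: "real^7 \<Rightarrow> 'a" where h: "linear h" "bij h" by (rule exists_linear_iso_7[OF dim])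
  have \<phi>: "\<phi> \<in> forms 3" and rank: "\<And>w. w \<noteq> 0 \<Longrightarrow> form_rank (contract w \<phi>) = 6"
    using def by (auto simp: definite_form_def)
  define \<phi>1 where "\<phi>1 = (\<lambda>xs. \<phi> (map h xs))"
  have \<phi>1: "\<phi>1 \<in> forms 3" unfolding \<phi>1_def by (rule forms_compose_linear[OF \<phi> h(1)])
  have inj: "inj h" and surj: "surj h" using h(2) by (simp_all add: bij_def)
  have rank1: "form_rank (contract v \<phi>1) = 6" if "v \<noteq> 0" for v
  proof -
    have "h ` radical \<phi>1 v = radical \<phi> (h v)"
    proof -
      have "u \<in> radical \<phi>1 v \<longleftrightarrow> h u \<in> radical \<phi> (h v)" for u
      proof -
        have "(\<forall>w. \<phi> [h v, h u, h w] = 0) \<longleftrightarrow> (\<forall>w. \<phi> [h v, h u, w] = 0)"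
          using surj by (metis surj_def)
        then show ?thesis by (simp add: radical_def \<phi>1_def)
      qed
      then show ?thesis using surj by (auto simp: image_iff surj_def) metis
    qed
    then have "dim (radical \<phi>1 v) = dim (radical \<phi> (h v))"
      using dim_image_eq[OF h(1), of "radical \<phi>1 v"] inj_on_subset[OF inj subset_UNIV] by simp
    moreover have "h v \<noteq> 0" using that inj linear_0[OF h(1)] by (metis injD)
    ultimately show ?thesis
      using rank[of "h v"] dim by (simp add: radical_contract)
  qed
  have "G2_b \<phi>1 v v std \<noteq> 0" if "v \<noteq> 0" for v
    by (rule G2_b_nonzero[OF \<phi>1 rank1[OF that] that])
  then obtain k \<kappa> where k: "linear k" "bij k" "\<kappa> \<noteq> 0"
    "\<And>v w xs. G2_b (\<lambda>xs. \<phi>1 (map k xs)) v w xs = \<kappa> * (v \<bullet> w) * vol7 xs"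
    using exists_metric_normalization[OF \<phi>1] by blast
  define \<phi>2 where "\<phi>2 = (\<lambda>xs. \<phi>1 (map k xs))"
  have \<phi>2: "\<phi>2 \<in> forms 3" unfolding \<phi>2_def by (rule forms_compose_linear[OF \<phi>1 k(1)])
  note lin = form3_linear[OF \<phi>2]
  obtain e1 e2 e3 where e: "norm e1 = 1" "norm e2 = 1" "norm e3 = 1"
    and max: "\<And>x y z. norm x = 1 \<Longrightarrow> norm y = 1 \<Longrightarrow> norm z = 1 \<Longrightarrow> \<phi>2 [x, y, z] \<le> \<phi>2 [e1, e2, e3]"
    using exists_max_triple[OF \<phi>2] by blast
  let ?l = "\<phi>2 [e1, e2, e3]"
  \<comment> \<open>A maximum over triples is a maximum in each slot separately, where the form is
    linear.\<close>
  have c1: "\<phi>2 [e1, e2, w] = ?l * (e3 \<bullet> w)" for w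
    by (rule unit_max_linear[OF lin(3)]) (simp_all add: max e)
  have c2: "\<phi>2 [x, e2, e3] = ?l * (e1 \<bullet> x)" for x
    by (rule unit_max_linear[OF lin(1)]) (simp_all add: max e)
  have c3: "\<phi>2 [e1, x, e3] = ?l * (e2 \<bullet> x)" for x
    by (rule unit_max_linear[OF lin(2)]) (simp_all add: max e)
  \<comment> \<open>Changing the sign of one vector shows that a nonpositive maximum forces the form
    to vanish, and its bilinear form with it.\<close>
  have pos: "?l > 0"
  proof (rule ccontr)
    assume "\<not> ?l > 0"
    then have le: "\<phi>2 [x, y, z] \<le> 0" if "norm x = 1" "norm y = 1" "norm z = 1" for x y z
      using max[OF that] by simp
    have u: "\<phi>2 [x, y, z] = 0" if "norm x = 1" "norm y = 1" "norm z = 1" for x y z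
      using le[OF that] le[of "- x" y z] that linear_neg[OF lin(1)[of y z], of x] by simp
    have "\<phi>2 [x, y, z] = 0" for x y z
    proof (cases "x = 0 \<or> y = 0 \<or> z = 0")
      case True
      then show ?thesis using linear_0[OF lin(1)] linear_0[OF lin(2)] linear_0[OF lin(3)] by auto
    next
      case False
      then have "\<phi>2 [x /\<^sub>R norm x, y /\<^sub>R norm y, z /\<^sub>R norm z] = 0" by (intro u) simp_all
      then show ?thesis
        using False by (simp add: linear_scale[OF lin(1)] linear_scale[OF lin(2)] linear_scale[OF
            lin(3)])
    qed
    then have "G2_b \<phi>2 (ax 1) (ax 1) std = 0"
      by (simp add: std_def G2_b_simps[OF \<phi>2])
    then show False using k(3) k(4)[of "ax 1" "ax 1" std] by (simp add: \<phi>2_def vol7_std inner_axis)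
  qed
  have n: "e1 \<bullet> e1 = 1" "e2 \<bullet> e2 = 1" "e3 \<bullet> e3 = 1" using e by (simp_all add: dot_square_norm)
  \<comment> \<open>Orthogonality is automatic: a repeated argument gives 0 on the left of a
    first-order condition.\<close>
  have o: "e1 \<bullet> e2 = 0" "e1 \<bullet> e3 = 0" "e2 \<bullet> e3 = 0"
    using c2[of e2] c1[of e1] c1[of e2] form3_repeat[OF \<phi>2] pos by (simp_all add: inner_commute)
  have "calibrated_triple \<phi>2 e1 e2 e3 ?l \<kappa>"
  proof
    show "\<phi>2 [e2, e3, w] = ?l * (e1 \<bullet> w)" for w
      using c2[of w] form3_swap(1)[OF \<phi>2, of e2 w e3] form3_swap(2)[OF \<phi>2, of e2 e3 w] by simp
    show "\<phi>2 [e3, e1, w] = ?l * (e2 \<bullet> w)" for w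
      using c3[of w] form3_swap(1)[OF \<phi>2, of e3 e1 w] form3_swap(2)[OF \<phi>2, of e1 e3 w] by simp
    show "G2_b \<phi>2 v w xs = \<kappa> * (v \<bullet> w) * vol7 xs" for v w xs
      unfolding \<phi>2_def by (rule k(4))
  qed (rule \<phi>2 n o pos k(3) c1)+
  then obtain m where m: "linear m" "bij m" "\<And>xs. \<phi>2 (map m xs) = phi0 xs"
    using calibrated_triple.exists_normal_form by blast
  have "G2_coframe (h \<circ> (k \<circ> m)) \<phi>"
  proof (rule G2_coframe.intro)
    show "linear (h \<circ> (k \<circ> m))" using h(1) k(1) m(1) by (intro linear_compose)
    show "bij (h \<circ> (k \<circ> m))" using h(2) k(2) m(2) by (intro bij_comp)
    show "\<phi> (map (h \<circ> (k \<circ> m)) xs) = phi0 xs" for xs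
      using m(3)[of xs] by (simp add: \<phi>2_def \<phi>1_def o_assoc)
  qed
  then show ?thesis by blast
qed

theorem corollary4p3:
  fixes br :: "'a::real_vector \<Rightarrow> 'a \<Rightarrow> 'a"
  assumes "lie_algebra br"
    and "dim (UNIV :: 'a set) = 7"
    and "lie_center br \<noteq> {0}"
    and "\<exists>\<phi>. torsion_free_G2 br \<phi>"
  shows "lie_abelian br \<or> lie_isomorphic br s7_bracket"
proof -
  obtain \<phi> where \<phi>: "torsion_free_G2 br \<phi>" using assms(4) by blast
  then obtain f where "G2_coframe f \<phi>"
    using definite_form_normal_form[OF assms(2)] by (auto simp: torsion_free_G2_def)
  then show ?thesis
    by (rule G2_coframe.torsion_free_with_center[OF _ assms(1,3)])
       (use \<phi> in \<open>simp_all add: torsion_free_G2_def\<close>)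
qed

end
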